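(* Let $R$ be a local ring of Krull dimension one with regular maximal ideal $M$. The following are equivalent: (1) $R$ is a Bass ring. (2) $R$ is a generalized local ring and $\overline{R}$ can be generated by two elements as an $R$-module. (3) $\overline{R}$ is a Noetherian ring that can be generated by two elements as an $R$-module.
   Context: All rings are commutative with identity; a local ring is a ring with a unique maximal ideal (not necessarily Noetherian). $Q(R)$ is the total ring of quotients and $\overline{R}$ the integral closure of $R$ in $Q(R)$. An ideal is regular if it contains a nonzerodivisor. A Bass ring is a reduced Noetherian local ring $R$ such that $\overline{R}$ is a finitely generated $R$-module and every ideal of $R$ can be generated by two elements. A generalized local ring is a local ring $(R,M)$ whose maximal ideal $M$ is finitely generated and satisfies $\bigcap_{i\ge1}M^i=0$. *)

theory Defs
  imports "HOL-Algebra.Ring_Divisibility" "HOL-Algebra.Ideal_Product"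
begin

definition nzd :: "('a, 'b) ring_scheme \<Rightarrow> 'a set" where
  "nzd R = {s \<in> carrier R. \<forall>x \<in> carrier R. s \<otimes>\<^bsub>R\<^esub> x = \<zero>\<^bsub>R\<^esub> \<longrightarrow> x = \<zero>\<^bsub>R\<^esub>}"

definition frac_rel :: "('a, 'b) ring_scheme \<Rightarrow> (('a \<times> 'a) \<times> ('a \<times> 'a)) set" where
  "frac_rel R = {((a, s), (b, t)). a \<in> carrier R \<and> s \<in> nzd R \<and> b \<in> carrier R \<and> t \<in> nzd R
                   \<and> a \<otimes>\<^bsub>R\<^esub> t = b \<otimes>\<^bsub>R\<^esub> s}"

definition frac :: "('a, 'b) ring_scheme \<Rightarrow> 'a \<Rightarrow> 'a \<Rightarrow> ('a \<times> 'a) set" where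
  "frac R a s = frac_rel R `` {(a, s)}"

definition Frac_ring :: "('a, 'b) ring_scheme \<Rightarrow> ('a \<times> 'a) set ring" where
  "Frac_ring R = \<lparr> carrier = (carrier R \<times> nzd R) // frac_rel R,
     mult = (\<lambda>X Y. \<Union>(a, s) \<in> X. \<Union>(b, t) \<in> Y. frac R (a \<otimes>\<^bsub>R\<^esub> b) (s \<otimes>\<^bsub>R\<^esub> t)),
     one = frac R \<one>\<^bsub>R\<^esub> \<one>\<^bsub>R\<^esub>,
     zero = frac R \<zero>\<^bsub>R\<^esub> \<one>\<^bsub>R\<^esub>,
     add = (\<lambda>X Y. \<Union>(a, s) \<in> X. \<Union>(b, t) \<in> Y.
              frac R ((a \<otimes>\<^bsub>R\<^esub> t) \<oplus>\<^bsub>R\<^esub> (b \<otimes>\<^bsub>R\<^esub> s)) (s \<otimes>\<^bsub>R\<^esub> t)) \<rparr>"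

definition frac_emb :: "('a, 'b) ring_scheme \<Rightarrow> 'a \<Rightarrow> ('a \<times> 'a) set" where
  "frac_emb R r = frac R r \<one>\<^bsub>R\<^esub>"

definition int_closure :: "('a, 'b) ring_scheme \<Rightarrow> ('a \<times> 'a) set set" where
  "int_closure R = {x \<in> carrier (Frac_ring R). \<exists>n::nat. \<exists>c. (\<forall>i<n. c i \<in> carrier R) \<and>
      x [^]\<^bsub>Frac_ring R\<^esub> n \<oplus>\<^bsub>Frac_ring R\<^esub>
        finsum (Frac_ring R) (\<lambda>i. frac_emb R (c i) \<otimes>\<^bsub>Frac_ring R\<^esub> x [^]\<^bsub>Frac_ring R\<^esub> i) {..<n}
      = \<zero>\<^bsub>Frac_ring R\<^esub>}"

definition int_closure_ring :: "('a, 'b) ring_scheme \<Rightarrow> ('a \<times> 'a) set ring" where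
  "int_closure_ring R = (Frac_ring R) \<lparr> carrier := int_closure R \<rparr>"

definition generates_int_closure :: "('a, 'b) ring_scheme \<Rightarrow> ('a \<times> 'a) set set \<Rightarrow> bool" where
  "generates_int_closure R S \<longleftrightarrow> finite S \<and> S \<subseteq> int_closure R \<and>
     (\<forall>x \<in> int_closure R. \<exists>f. (\<forall>y \<in> S. f y \<in> carrier R) \<and>
        x = finsum (Frac_ring R) (\<lambda>y. frac_emb R (f y) \<otimes>\<^bsub>Frac_ring R\<^esub> y) S)"

definition int_closure_fin_gen :: "('a, 'b) ring_scheme \<Rightarrow> bool" where
  "int_closure_fin_gen R \<longleftrightarrow> (\<exists>S. generates_int_closure R S)"

definition int_closure_two_gen :: "('a, 'b) ring_scheme \<Rightarrow> bool" where
  "int_closure_two_gen R \<longleftrightarrow> (\<exists>S. generates_int_closure R S \<and> card S \<le> 2)"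

definition local_ring :: "('a, 'b) ring_scheme \<Rightarrow> bool" where
  "local_ring R \<longleftrightarrow> cring R \<and> (\<exists>!M. maximalideal M R)"

definition krull_dim_one :: "('a, 'b) ring_scheme \<Rightarrow> bool" where
  "krull_dim_one R \<longleftrightarrow>
     (\<exists>P Q. primeideal P R \<and> primeideal Q R \<and> P \<subset> Q) \<and>
     \<not> (\<exists>P Q T. primeideal P R \<and> primeideal Q R \<and> primeideal T R \<and> P \<subset> Q \<and> Q \<subset> T)"

definition reduced_ring :: "('a, 'b) ring_scheme \<Rightarrow> bool" where
  "reduced_ring R \<longleftrightarrow> (\<forall>x \<in> carrier R. \<forall>n::nat. x [^]\<^bsub>R\<^esub> n = \<zero>\<^bsub>R\<^esub> \<longrightarrow> x = \<zero>\<^bsub>R\<^esub>)"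

definition ideals_two_gen :: "('a, 'b) ring_scheme \<Rightarrow> bool" where
  "ideals_two_gen R \<longleftrightarrow>
     (\<forall>I. ideal I R \<longrightarrow> (\<exists>A \<subseteq> carrier R. finite A \<and> card A \<le> 2 \<and> I = Idl\<^bsub>R\<^esub> A))"

definition bass_ring :: "('a, 'b) ring_scheme \<Rightarrow> bool" where
  "bass_ring R \<longleftrightarrow> reduced_ring R \<and> noetherian_ring R \<and> local_ring R \<and>
     int_closure_fin_gen R \<and> ideals_two_gen R"

fun ideal_pow :: "('a, 'b) ring_scheme \<Rightarrow> 'a set \<Rightarrow> nat \<Rightarrow> 'a set" where
  "ideal_pow R I 0 = carrier R"
| "ideal_pow R I (Suc n) = ideal_prod R I (ideal_pow R I n)"

definition generalized_local_ring :: "('a, 'b) ring_scheme \<Rightarrow> bool" where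
  "generalized_local_ring R \<longleftrightarrow> local_ring R \<and>
     (\<forall>M. maximalideal M R \<longrightarrow>
        (\<exists>A \<subseteq> carrier R. finite A \<and> M = Idl\<^bsub>R\<^esub> A) \<and>
        (\<Inter>i \<in> {1..}. ideal_pow R M i) = {\<zero>\<^bsub>R\<^esub>})"

end

theory Submission
  imports Defs "HOL-Algebra.Subrings"
begin

text \<open>Write \<open>A\<close> for the integral closure, \<open>t\<close> for a nonzerodivisor in \<open>M\<close>, and \<open>J = M A\<close>.
  Each of (2) and (3) implies that \<open>A\<close> is generated by two elements, that
  \<open>\<Inter>\<^sub>n t\<^sup>n R = 0\<close>, and that \<open>J\<close> is finitely generated.
  These properties imply that \<open>J\<close> is invertible: a proper ideal \<open>T \<supseteq> J\<close> has some
  \<open>y \<notin> A\<close> with \<open>y T \<subseteq> A\<close>, and applied to \<open>T = J\<^sup>-\<^sup>1 J\<close> this gives \<open>y T \<subseteq> T\<close>, so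
  \<open>y\<close> is integral, a contradiction. As \<open>A / J\<close> has dimension at most two over \<open>R / M\<close>, there are at
  most two maximal ideals to avoid, whence \<open>J = x A\<close> with \<open>x \<in> M\<close>.

  Let \<open>N \<subseteq> A\<close> be a nonzero \<open>R\<close>-submodule; dividing by a power of \<open>x\<close>, one may assume that it contains
  some \<open>n \<notin> J\<close>. Then \<open>A = R n + R b\<close>. If some \<open>x\<^sup>j b\<close> lies in \<open>N\<close>, then \<open>N = R n + R x\<^sup>j b\<close> for
  the least such \<open>j\<close>; otherwise \<open>n\<close> is a zero divisor, it is a unit multiple of an idempotent, and
  \<open>N = R n\<close>. So every ideal of \<open>R\<close> has two generators, and \<open>\<Inter>\<^sub>i M\<^sup>i \<subseteq> \<Inter>\<^sub>i x\<^sup>i A = 0\<close>.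
  Conversely, if \<open>R\<close> is a Bass ring, then a common denominator embeds \<open>A\<close> and its ideals
  into \<open>R\<close> as ideals.\<close>

section \<open>Prime ideals\<close>

text \<open>\<open>R\<close> is not assumed Noetherian, so all finiteness has to come from
  \<open>A\<close> and \<open>J\<close>. Dimension one enters through one fact: a prime ideal of
  \<open>A\<close> that contains a nonzerodivisor of \<open>R\<close> contracts to \<open>M\<close>,
  hence contains \<open>J\<close>; so every element of \<open>J\<close> has a power in
  \<open>t A\<close>. Finite generation of \<open>J\<close> turns this elementwise nilpotency into a
  single \<open>b\<close> outside \<open>t A\<close> with \<open>T b\<close> inside
  \<open>t A\<close>, and \<open>y = b / t\<close> is the element of the overview. For
  \<open>T = J\<^sup>-\<^sup>1 J\<close> the inclusion \<open>y T \<subseteq> A\<close> says that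
  \<open>y J\<^sup>-\<^sup>1\<close> maps \<open>J\<close> into \<open>A\<close>, so
  \<open>y\<close> preserves \<open>J\<^sup>-\<^sup>1\<close> and therefore \<open>T\<close>. The
  generator \<open>x\<close> of \<open>J\<close> is wanted in \<open>M\<close>, not just in
  \<open>A\<close>, because the submodules studied afterwards are closed under scalars from
  \<open>R\<close> only. As there are only two ideals to avoid, a sum of two elements of
  \<open>M\<close> does it, whatever the size of the residue field.\<close>

lemma (in cring) idealI_cring:
  assumes "I \<subseteq> carrier R" "\<zero> \<in> I"
    and add: "\<And>a b. a \<in> I \<Longrightarrow> b \<in> I \<Longrightarrow> a \<oplus> b \<in> I"
    and mult: "\<And>a x. a \<in> I \<Longrightarrow> x \<in> carrier R \<Longrightarrow> x \<otimes> a \<in> I"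
  shows "ideal I R"
proof (rule idealI)
  show "subgroup I (add_monoid R)"
  proof (rule add.subgroupI)
    fix a assume "a \<in> I"
    then show "\<ominus> a \<in> I" using mult[of a "\<ominus> \<one>"] assms(1) by (auto simp: l_minus)
  qed (use assms in auto)
  fix a x assume "a \<in> I" "x \<in> carrier R"
  then show "x \<otimes> a \<in> I" "a \<otimes> x \<in> I" using mult[of a x] assms(1) m_comm[of a x] by auto
qed (rule ring_axioms)

lemma idealE:
  assumes "ideal I R"
  shows "I \<subseteq> carrier R" "\<zero>\<^bsub>R\<^esub> \<in> I" "\<And>a b. a \<in> I \<Longrightarrow> b \<in> I \<Longrightarrow> a \<oplus>\<^bsub>R\<^esub> b \<in> I"
    "\<And>a x. a \<in> I \<Longrightarrow> x \<in> carrier R \<Longrightarrow> x \<otimes>\<^bsub>R\<^esub> a \<in> I" "\<And>a. a \<in> I \<Longrightarrow> \<ominus>\<^bsub>R\<^esub> a \<in> I"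
proof -
  interpret ideal I R by fact
  show "I \<subseteq> carrier R" "\<zero>\<^bsub>R\<^esub> \<in> I" "\<And>a b. a \<in> I \<Longrightarrow> b \<in> I \<Longrightarrow> a \<oplus>\<^bsub>R\<^esub> b \<in> I"
    "\<And>a x. a \<in> I \<Longrightarrow> x \<in> carrier R \<Longrightarrow> x \<otimes>\<^bsub>R\<^esub> a \<in> I" "\<And>a. a \<in> I \<Longrightarrow> \<ominus>\<^bsub>R\<^esub> a \<in> I"
    using a_subset I_l_closed by auto
qed

lemma (in cring) ideal_add_principal:
  assumes "ideal I R" "a \<in> carrier R"
  shows "ideal {p \<oplus> x \<otimes> a | p x. p \<in> I \<and> x \<in> carrier R} R" (is "ideal ?K R")
proof (rule idealI_cring)
  note I = idealE[OF assms(1)]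
  show "?K \<subseteq> carrier R" using I(1) assms(2) by auto
  have "\<zero> = \<zero> \<oplus> \<zero> \<otimes> a" using assms(2) by simp
  then show "\<zero> \<in> ?K" using I(2) by blast
  fix u assume "u \<in> ?K"
  then obtain p x where u: "u = p \<oplus> x \<otimes> a" "p \<in> I" "x \<in> carrier R" by blast
  then have p: "p \<in> carrier R" using I(1) by blast
  { fix v assume "v \<in> ?K"
    then obtain q y where v: "v = q \<oplus> y \<otimes> a" "q \<in> I" "y \<in> carrier R" by blast
    then have "q \<in> carrier R" using I(1) by blast
    then have "u \<oplus> v = (p \<oplus> q) \<oplus> (x \<oplus> y) \<otimes> a"
      unfolding u(1) v(1) using u(3) v(3) p assms(2) by algebra
    then show "u \<oplus> v \<in> ?K" using I(3)[OF u(2) v(2)] u(3) v(3) by blast }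
  { fix y assume y: "y \<in> carrier R"
    have "y \<otimes> u = y \<otimes> p \<oplus> (y \<otimes> x) \<otimes> a"
      unfolding u(1) using u(3) y p assms(2) by algebra
    then show "y \<otimes> u \<in> ?K" using I(4)[OF u(2) y] u(3) y by blast }
qed

text \<open>Zorn's lemma in one form for two uses: with \<open>S\<close> multiplicatively closed the
  result is a prime ideal, with \<open>S = {\<one>}\<close> a maximal ideal.\<close>

lemma (in cring) ex_maximal_disjoint_ideal:
  assumes "ideal I R" "I \<inter> S = {}"
  obtains P where "ideal P R" "I \<subseteq> P" "P \<inter> S = {}"
    "\<And>J. ideal J R \<Longrightarrow> P \<subseteq> J \<Longrightarrow> J \<inter> S = {} \<Longrightarrow> J = P"
proof -
  let ?A = "{J. ideal J R \<and> I \<subseteq> J \<and> J \<inter> S = {}}"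
  have "\<exists>M\<in>?A. \<forall>X\<in>?A. M \<subseteq> X \<longrightarrow> X = M"
  proof (rule subset_Zorn_nonempty)
    show "?A \<noteq> {}" using assms by blast
    fix C assume C: "C \<noteq> {}" "subset.chain ?A C"
    have id: "\<And>J. J \<in> C \<Longrightarrow> ideal J R" using C(2) by (auto simp: subset.chain_def)
    have "ideal (\<Union>C) R"
    proof (rule idealI_cring)
      show "\<Union>C \<subseteq> carrier R" using idealE(1)[OF id] by blast
      show "\<zero> \<in> \<Union>C" using C(1) idealE(2)[OF id] by blast
      { fix a b assume "a \<in> \<Union>C" "b \<in> \<Union>C"
        then obtain X Y where XY: "a \<in> X" "b \<in> Y" "X \<in> C" "Y \<in> C" by blast
        then have "X \<subseteq> Y \<or> Y \<subseteq> X" using C(2) by (auto simp: subset_chain_def)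
        then show "a \<oplus> b \<in> \<Union>C"
          using XY idealE(3)[OF id, of X a b] idealE(3)[OF id, of Y a b] by blast }
      { fix a x assume "a \<in> \<Union>C" "x \<in> carrier R"
        then show "x \<otimes> a \<in> \<Union>C" using idealE(4)[OF id] by blast }
    qed
    then show "\<Union>C \<in> ?A" using C by (auto simp: subset.chain_def)
  qed
  then obtain P where "P \<in> ?A" "\<forall>X\<in>?A. P \<subseteq> X \<longrightarrow> X = P" by blast
  then show thesis by (intro that[of P]) auto
qed

text \<open>An ideal \<open>P\<close> maximal among those avoiding \<open>S\<close> is prime: for
  \<open>a\<close>, \<open>b\<close> outside \<open>P\<close> both \<open>P + R a\<close> and
  \<open>P + R b\<close> meet \<open>S\<close>, and the product of two such elements lies in
  \<open>S\<close>, while it would lie in \<open>P\<close> if \<open>a \<otimes> b\<close>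
  did.\<close>

lemma (in cring) ex_primeideal_disjoint:
  assumes "ideal I R" "I \<inter> S = {}" "S \<subseteq> carrier R" "\<one> \<in> S"
    and S_mult: "\<And>a b. a \<in> S \<Longrightarrow> b \<in> S \<Longrightarrow> a \<otimes> b \<in> S"
  obtains P where "primeideal P R" "I \<subseteq> P" "P \<inter> S = {}"
proof -
  obtain P where P: "ideal P R" "I \<subseteq> P" "P \<inter> S = {}"
    and max: "\<And>J. ideal J R \<Longrightarrow> P \<subseteq> J \<Longrightarrow> J \<inter> S = {} \<Longrightarrow> J = P"
    using ex_maximal_disjoint_ideal[OF assms(1,2)] by metis
  note PI = idealE[OF P(1)]
  have ext: "\<exists>p\<in>P. \<exists>x\<in>carrier R. p \<oplus> x \<otimes> a \<in> S" if a: "a \<in> carrier R" "a \<notin> P" for a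
  proof (rule ccontr)
    assume neg: "\<not> ?thesis"
    let ?J = "{p \<oplus> x \<otimes> a | p x. p \<in> P \<and> x \<in> carrier R}"
    have "p \<in> ?J" if "p \<in> P" for p
    proof -
      have "p = p \<oplus> \<zero> \<otimes> a" using that a PI(1) by auto
      then show ?thesis using that by blast
    qed
    moreover have "a \<in> ?J"
    proof -
      have "a = \<zero> \<oplus> \<one> \<otimes> a" using a by simp
      then show ?thesis using PI(2) by blast
    qed
    moreover have "?J \<inter> S = {}" using neg by blast
    ultimately show False using max[OF ideal_add_principal[OF P(1) a(1)]] a(2) by blast
  qed
  have "primeideal P R"
  proof (rule primeidealI[OF P(1) is_cring])
    show "carrier R \<noteq> P" using P(3) assms(4) by auto
    fix a b assume ab: "a \<in> carrier R" "b \<in> carrier R" "a \<otimes> b \<in> P"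
    show "a \<in> P \<or> b \<in> P"
    proof (rule ccontr)
      assume "\<not> ?thesis"
      then obtain p x q y where *: "p \<in> P" "x \<in> carrier R" "p \<oplus> x \<otimes> a \<in> S"
        "q \<in> P" "y \<in> carrier R" "q \<oplus> y \<otimes> b \<in> S" using ext ab by meson
      have pq: "p \<in> carrier R" "q \<in> carrier R" using * PI(1) by auto
      have "(p \<oplus> x \<otimes> a) \<otimes> (q \<oplus> y \<otimes> b) = (q \<oplus> y \<otimes> b) \<otimes> p \<oplus> ((x \<otimes> a) \<otimes> q \<oplus> (x \<otimes> y) \<otimes> (a \<otimes> b))"
        using * ab pq by algebra
      moreover have "\<dots> \<in> P" using * ab pq by (intro PI(3) PI(4)[OF *(1)] PI(4)[OF *(4)] PI(4)[OF ab(3)]) auto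
      ultimately show False using S_mult[OF *(3) *(6)] P(3) by auto
    qed
  qed
  then show thesis using that P by blast
qed

lemma (in cring) ex_maximalideal:
  assumes "ideal I R" "I \<noteq> carrier R"
  obtains P where "maximalideal P R" "I \<subseteq> P"
proof -
  have proper: "\<one> \<notin> J \<longleftrightarrow> J \<noteq> carrier R" if "ideal J R" for J
    using ideal.one_imp_carrier[OF that] by auto
  have "I \<inter> {\<one>} = {}" using proper[OF assms(1)] assms(2) by simp
  then obtain P where P: "ideal P R" "I \<subseteq> P" "P \<inter> {\<one>} = {}"
    and max: "\<And>J. ideal J R \<Longrightarrow> P \<subseteq> J \<Longrightarrow> J \<inter> {\<one>} = {} \<Longrightarrow> J = P"
    using ex_maximal_disjoint_ideal[OF assms(1), of "{\<one>}"] by metis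
  have "maximalideal P R"
    by (rule maximalidealI[OF P(1)]) (use P(3) proper max in auto)
  then show thesis using that P by blast
qed

text \<open>If no power of \<open>v\<close> were a multiple of \<open>a\<close>, some prime ideal
  containing \<open>a\<close> would avoid all powers of \<open>v\<close>. Applied in the integral
  closure, this turns knowledge about prime ideals into nilpotency.\<close>

lemma (in cring) in_all_primeideals_imp_power:
  assumes "a \<in> carrier R" "v \<in> carrier R"
    and "\<And>P. primeideal P R \<Longrightarrow> a \<in> P \<Longrightarrow> v \<in> P"
  obtains n :: nat and b where "b \<in> carrier R" "v [^] n = b \<otimes> a"
proof -
  let ?S = "range (\<lambda>n::nat. v [^] n)"
  have "PIdl a \<inter> ?S \<noteq> {}"
  proof
    assume disj: "PIdl a \<inter> ?S = {}"
    have "\<one> \<in> ?S" using nat_pow_0 by (metis rangeI)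
    moreover have "x \<otimes> y \<in> ?S" if "x \<in> ?S" "y \<in> ?S" for x y
      using that assms(2) by (auto simp: nat_pow_mult)
    moreover have "?S \<subseteq> carrier R" using assms(2) by auto
    ultimately obtain P where P: "primeideal P R" "PIdl a \<subseteq> P" "P \<inter> ?S = {}"
      using ex_primeideal_disjoint[OF cgenideal_ideal[OF assms(1)] disj] by metis
    then have "v \<in> P" using assms cgenideal_self by blast
    moreover have "v \<in> ?S" using nat_pow_eone[OF assms(2)] by (metis rangeI)
    ultimately show False using P by blast
  qed
  then show thesis using that unfolding cgenideal_def by auto
qed

lemma (in cring) local_ring_unit:
  assumes "local_ring R" "maximalideal M R" "a \<in> carrier R" "a \<notin> M"
  obtains b where "b \<in> carrier R" "a \<otimes> b = \<one>"
proof -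
  have "PIdl a = carrier R"
  proof (rule ccontr)
    assume "PIdl a \<noteq> carrier R"
    then obtain P where "maximalideal P R" "PIdl a \<subseteq> P"
      using ex_maximalideal[OF cgenideal_ideal[OF assms(3)]] by metis
    then show False using assms cgenideal_self[OF assms(3)] by (auto simp: local_ring_def)
  qed
  then have "\<one> \<in> PIdl a" by simp
  then show thesis using that assms(3) m_comm unfolding cgenideal_def by auto
qed

text \<open>If \<open>P\<close> contains the nonzerodivisor \<open>r\<close>, then \<open>P\<close> properly contains a prime ideal avoiding
  the multiplicative set \<open>{s r\<^sup>n | s \<notin> P}\<close>.\<close>

lemma (in cring) dim_one_primeideal_eq:
  assumes "local_ring R" "krull_dim_one R" "maximalideal M R"
    and P: "primeideal P R" and r: "r \<in> P" "r \<in> nzd R"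
  shows "P = M"
proof (rule ccontr)
  assume "P \<noteq> M"
  interpret P: primeideal P R by fact
  obtain N where "maximalideal N R" "P \<subseteq> N"
    using ex_maximalideal[OF P.is_ideal] P.I_notcarr by metis
  then have PM: "P \<subset> M" using assms(1,3) \<open>P \<noteq> M\<close> by (auto simp: local_ring_def)
  have rc: "r \<in> carrier R" and nz: "\<And>x. x \<in> carrier R \<Longrightarrow> r \<otimes> x = \<zero> \<Longrightarrow> x = \<zero>"
    using r(2) by (auto simp: nzd_def)
  have nzp: "r [^] n \<otimes> x = \<zero> \<Longrightarrow> x = \<zero>" if "x \<in> carrier R" for n :: nat and x
  proof (induction n)
    case (Suc n)
    have "r \<otimes> (r [^] n \<otimes> x) = r [^] Suc n \<otimes> x" using that rc by (simp add: m_ac)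
    then show ?case using Suc nz[of "r [^] n \<otimes> x"] that rc by auto
  qed (use that in simp)
  define S where "S = {s \<otimes> r [^] n | s (n::nat). s \<in> carrier R \<and> s \<notin> P}"
  have one: "\<one> \<in> carrier R" "\<one> \<notin> P" using P.one_imp_carrier P.I_notcarr by auto
  have memS: "s \<otimes> r [^] n \<in> S" if "s \<in> carrier R" "s \<notin> P" for s and n :: nat
    using that unfolding S_def by blast
  \<comment> \<open>A relation \<open>s \<otimes> r [^] n = \<zero>\<close> would give
    \<open>s = \<zero>\<close>, which lies in \<open>P\<close>.\<close>
  have disj: "{\<zero>} \<inter> S = {}"
  proof -
    have False if "s \<in> carrier R" "s \<notin> P" "\<zero> = s \<otimes> r [^] n" for s and n :: nat
      using nzp[of s n] that rc m_comm[of s "r [^] n"] P.zero_closed by auto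
    then show ?thesis unfolding S_def by blast
  qed
  have "\<one> = \<one> \<otimes> r [^] (0::nat)" by simp
  then have "\<one> \<in> S" using memS[OF one, of 0] by metis
  moreover have "S \<subseteq> carrier R" using rc unfolding S_def by auto
  moreover have "x \<otimes> y \<in> S" if xy: "x \<in> S" "y \<in> S" for x y
  proof -
    obtain s m where s: "x = s \<otimes> r [^] (m::nat)" "s \<in> carrier R" "s \<notin> P" using xy(1) unfolding S_def by blast
    obtain t n where t: "y = t \<otimes> r [^] (n::nat)" "t \<in> carrier R" "t \<notin> P" using xy(2) unfolding S_def by blast
    note * = s t
    have "x \<otimes> y = (s \<otimes> t) \<otimes> (r [^] m \<otimes> r [^] n)" using * rc by (simp add: m_ac)
    also have "\<dots> = (s \<otimes> t) \<otimes> r [^] (m + n)" using rc by (simp add: nat_pow_mult)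
    finally show ?thesis using memS[of "s \<otimes> t" "m + n"] * P.I_prime[of s t] by auto
  qed
  ultimately obtain P' where P': "primeideal P' R" "P' \<inter> S = {}"
    using ex_primeideal_disjoint[OF zeroideal disj] by metis
  \<comment> \<open>Exponent \<open>0\<close> puts the complement of \<open>P\<close> into
    \<open>S\<close>, hence \<open>P' \<subseteq> P\<close>. Exponent \<open>1\<close> puts
    \<open>r\<close> into \<open>S\<close>, so the inclusion is strict and \<open>P'\<close>,
    \<open>P\<close>, \<open>M\<close> is a forbidden chain.\<close>
  have "x \<in> P" if "x \<in> P'" for x
  proof (rule ccontr)
    assume "x \<notin> P"
    moreover have "x \<in> carrier R" using that idealE(1)[OF primeideal.axioms(1)[OF P'(1)]] by blast
    ultimately have "x \<otimes> r [^] (0::nat) \<in> S" by (rule memS[rotated])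
    then show False using that P'(2) \<open>x \<in> carrier R\<close> by auto
  qed
  moreover have "r \<notin> P'" using memS[OF one, of 1] P'(2) rc by (metis disjoint_iff l_one nat_pow_eone)
  ultimately have "P' \<subset> P" using r(1) by blast
  then show False
    using PM P P'(1) maximalideal_prime[OF assms(3)] assms(2) by (auto simp: krull_dim_one_def)
qed

section \<open>Elimination for integral elements\<close>

text \<open>Coefficients range over a mere set \<open>C\<close>, since three kinds occur: a subring,
  the polynomial values of bounded degree, and the fractional ideal \<open>Jinv\<close>. Only the
  first is a ring in general.\<close>

inductive_set lin_span :: "('a, 'b) ring_scheme \<Rightarrow> 'a set \<Rightarrow> 'a set \<Rightarrow> 'a set"
  for Q C G where
  zero: "\<zero>\<^bsub>Q\<^esub> \<in> lin_span Q C G"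
| step: "c \<in> C \<Longrightarrow> g \<in> G \<Longrightarrow> s \<in> lin_span Q C G \<Longrightarrow> c \<otimes>\<^bsub>Q\<^esub> g \<oplus>\<^bsub>Q\<^esub> s \<in> lin_span Q C G"

text \<open>Values at \<open>y\<close> of polynomials of degree below \<open>n\<close>. Values stand
  in for polynomials, so degree is not a function of the element and only the bound \<open>n\<close>
  is tracked.\<close>

definition pow_span :: "('a, 'b) ring_scheme \<Rightarrow> 'a set \<Rightarrow> 'a \<Rightarrow> nat \<Rightarrow> 'a set" where
  "pow_span Q K y n = lin_span Q K ((\<lambda>i. y [^]\<^bsub>Q\<^esub> i) ` {..<n})"

definition monic_val :: "('a, 'b) ring_scheme \<Rightarrow> 'a set \<Rightarrow> 'a \<Rightarrow> nat \<Rightarrow> 'a set" where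
  "monic_val Q K y n = {y [^]\<^bsub>Q\<^esub> n \<oplus>\<^bsub>Q\<^esub> p | p. p \<in> pow_span Q K y n}"

context cring
begin

lemma lin_span_closed:
  assumes "C \<subseteq> carrier R" "G \<subseteq> carrier R"
  shows "lin_span R C G \<subseteq> carrier R"
proof
  fix s assume "s \<in> lin_span R C G"
  then show "s \<in> carrier R" by induction (use assms in auto)
qed

lemma lin_span_mult_mem:
  assumes "C \<subseteq> carrier R" "G \<subseteq> carrier R" "a \<in> carrier R" "s \<in> lin_span R C G"
    and "\<zero> \<in> N" "\<And>u v. u \<in> N \<Longrightarrow> v \<in> N \<Longrightarrow> u \<oplus> v \<in> N"
    and "\<And>c g. c \<in> C \<Longrightarrow> g \<in> G \<Longrightarrow> a \<otimes> (c \<otimes> g) \<in> N"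
  shows "a \<otimes> s \<in> N"
  using assms(4)
proof induction
  case (step c g s)
  have "s \<in> carrier R" "c \<in> carrier R" "g \<in> carrier R"
    using step lin_span_closed[OF assms(1,2)] assms(1,2) by auto
  then have "a \<otimes> (c \<otimes> g \<oplus> s) = a \<otimes> (c \<otimes> g) \<oplus> a \<otimes> s" using assms(3) by (simp add: r_distr)
  then show ?case using step assms(6,7) by simp
qed (use assms in simp)

lemma lin_span_subset:
  assumes "C \<subseteq> carrier R" "G \<subseteq> carrier R"
    and "\<zero> \<in> N" "\<And>u v. u \<in> N \<Longrightarrow> v \<in> N \<Longrightarrow> u \<oplus> v \<in> N"
    and "\<And>c g. c \<in> C \<Longrightarrow> g \<in> G \<Longrightarrow> c \<otimes> g \<in> N"
  shows "lin_span R C G \<subseteq> N"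
proof
  fix s assume "s \<in> lin_span R C G"
  then show "s \<in> N" by induction (use assms in auto)
qed

lemma lin_span_add:
  assumes "C \<subseteq> carrier R" "G \<subseteq> carrier R" "s \<in> lin_span R C G" "t \<in> lin_span R C G"
  shows "s \<oplus> t \<in> lin_span R C G"
  using assms(3)
proof induction
  case zero
  have "t \<in> carrier R" using assms(4) lin_span_closed[OF assms(1,2)] by blast
  then show ?case using assms(4) by simp
next
  case (step c g s)
  have "s \<in> carrier R" "t \<in> carrier R" "c \<in> carrier R" "g \<in> carrier R"
    using step assms lin_span_closed[OF assms(1,2)] by auto
  then have "c \<otimes> g \<oplus> s \<oplus> t = c \<otimes> g \<oplus> (s \<oplus> t)" by (simp add: a_assoc)
  then show ?case using lin_span.step[OF step(1,2,4)] by simp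
qed

lemma lin_span_term:
  assumes "C \<subseteq> carrier R" "G \<subseteq> carrier R" "c \<in> C" "g \<in> G"
  shows "c \<otimes> g \<in> lin_span R C G"
proof -
  have "c \<otimes> g \<oplus> \<zero> \<in> lin_span R C G" by (intro lin_span.intros assms)
  moreover have "c \<in> carrier R" "g \<in> carrier R" using assms by auto
  ultimately show ?thesis by simp
qed

lemma lin_span_base:
  assumes "subring K R" "G \<subseteq> carrier R" "g \<in> G"
  shows "g \<in> lin_span R K G"
  using lin_span_term[OF _ assms(2) _ assms(3), of K \<one>] subringE(1,3)[OF assms(1)] assms by auto

lemma lin_span_smult:
  assumes "subring K R" "G \<subseteq> carrier R" "a \<in> K" "s \<in> lin_span R K G"
  shows "a \<otimes> s \<in> lin_span R K G"
proof (rule lin_span_mult_mem[OF _ assms(2) _ assms(4)])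
  note K = subringE[OF assms(1)]
  show "K \<subseteq> carrier R" "a \<in> carrier R" using K(1) assms(3) by auto
  show "\<zero> \<in> lin_span R K G" by (rule lin_span.zero)
  show "\<And>u v. u \<in> lin_span R K G \<Longrightarrow> v \<in> lin_span R K G \<Longrightarrow> u \<oplus> v \<in> lin_span R K G"
    using lin_span_add K(1) assms(2) by blast
  fix c g assume "c \<in> K" "g \<in> G"
  moreover from this have "a \<in> carrier R" "c \<in> carrier R" "g \<in> carrier R" using K(1) assms by auto
  ultimately show "a \<otimes> (c \<otimes> g) \<in> lin_span R K G"
    using lin_span_term[OF K(1) assms(2), of "a \<otimes> c" g] K(6)[OF assms(3)] by (simp add: m_assoc)
qed

lemma lin_span_mono:
  assumes "C \<subseteq> D" "G \<subseteq> H"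
  shows "lin_span R C G \<subseteq> lin_span R D H"
proof
  fix s assume "s \<in> lin_span R C G"
  then show "s \<in> lin_span R D H" by induction (use assms in \<open>auto intro: lin_span.intros\<close>)
qed

text \<open>The inductive definition may use \<open>h\<close> several times; closure of
  \<open>C\<close> under addition lets these terms be collected into one coefficient, which the
  elimination needs.\<close>

lemma lin_span_insertE:
  assumes "C \<subseteq> carrier R" "insert h G \<subseteq> carrier R" "\<zero> \<in> C"
    and add: "\<And>a b. a \<in> C \<Longrightarrow> b \<in> C \<Longrightarrow> a \<oplus> b \<in> C"
    and "s \<in> lin_span R C (insert h G)"
  obtains c t where "c \<in> C" "t \<in> lin_span R C G" "s = c \<otimes> h \<oplus> t"
proof -
  have "\<exists>c\<in>C. \<exists>t\<in>lin_span R C G. s = c \<otimes> h \<oplus> t" using assms(5)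
  proof induction
    case zero
    have "\<zero> = \<zero> \<otimes> h \<oplus> \<zero>" using assms(2) by simp
    then show ?case using assms(3) lin_span.zero by blast
  next
    case (step c g s)
    then obtain d t where d: "d \<in> C" "t \<in> lin_span R C G" "s = d \<otimes> h \<oplus> t" by blast
    have car: "c \<in> carrier R" "g \<in> carrier R" "d \<in> carrier R" "t \<in> carrier R" "h \<in> carrier R"
      using step d assms(1,2) lin_span_closed[OF assms(1)] by auto
    show ?case
    proof (cases "g = h")
      case True
      have "c \<otimes> h \<oplus> (d \<otimes> h \<oplus> t) = (c \<oplus> d) \<otimes> h \<oplus> t" using car by algebra
      then show ?thesis using True d add[OF step(1) d(1)] by blast
    next
      case False
      have "c \<otimes> g \<oplus> (d \<otimes> h \<oplus> t) = d \<otimes> h \<oplus> (c \<otimes> g \<oplus> t)" using car by algebra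
      moreover have "c \<otimes> g \<oplus> t \<in> lin_span R C G"
        using step False d by (intro lin_span.step) auto
      ultimately show ?thesis using d by blast
    qed
  qed
  then show thesis using that by blast
qed

lemma lin_span_kill:
  assumes "C \<subseteq> carrier R" "G \<subseteq> carrier R" "a \<in> carrier R" "s \<in> lin_span R C G"
    and "\<And>g. g \<in> G \<Longrightarrow> a \<otimes> g = \<zero>"
  shows "a \<otimes> s = \<zero>"
proof -
  have "a \<otimes> s \<in> {\<zero>}"
  proof (rule lin_span_mult_mem[OF assms(1-4)])
    fix c g assume "c \<in> C" "g \<in> G"
    moreover from this have "c \<in> carrier R" "g \<in> carrier R" using assms by auto
    ultimately show "a \<otimes> (c \<otimes> g) \<in> {\<zero>}" using assms(3,5) m_lcomm[of a c g] by simp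
  qed auto
  then show ?thesis by simp
qed

section \<open>Polynomial values of bounded degree at a fixed element\<close>

context
  fixes K :: "'a set" and y :: 'a
  assumes K: "subring K R" and y: "y \<in> carrier R"
begin

lemma pow_span_props:
  shows "pow_span R K y n \<subseteq> carrier R" "\<zero> \<in> pow_span R K y n"
    "\<And>p q. p \<in> pow_span R K y n \<Longrightarrow> q \<in> pow_span R K y n \<Longrightarrow> p \<oplus> q \<in> pow_span R K y n"
    "\<And>p. p \<in> pow_span R K y n \<Longrightarrow> \<ominus> p \<in> pow_span R K y n"
    "\<And>c i. c \<in> K \<Longrightarrow> i < n \<Longrightarrow> c \<otimes> y [^] i \<in> pow_span R K y n"
    "\<And>m. n \<le> m \<Longrightarrow> pow_span R K y n \<subseteq> pow_span R K y m"
proof -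
  have G: "(\<lambda>i. y [^] i) ` {..<n} \<subseteq> carrier R" using y by auto
  note KE = subringE[OF K]
  show c: "pow_span R K y n \<subseteq> carrier R"
    unfolding pow_span_def by (rule lin_span_closed[OF KE(1) G])
  show "\<zero> \<in> pow_span R K y n" unfolding pow_span_def by (rule lin_span.zero)
  show "\<And>p q. p \<in> pow_span R K y n \<Longrightarrow> q \<in> pow_span R K y n \<Longrightarrow> p \<oplus> q \<in> pow_span R K y n"
    unfolding pow_span_def by (rule lin_span_add[OF KE(1) G])
  show "\<ominus> p \<in> pow_span R K y n" if "p \<in> pow_span R K y n" for p
  proof -
    have "\<ominus> \<one> \<otimes> p \<in> pow_span R K y n"
      using lin_span_smult[OF K G, of "\<ominus> \<one>" p] that KE unfolding pow_span_def by auto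
    then show ?thesis using that c by (auto simp: l_minus)
  qed
  show "\<And>c i. c \<in> K \<Longrightarrow> i < n \<Longrightarrow> c \<otimes> y [^] i \<in> pow_span R K y n"
    unfolding pow_span_def by (rule lin_span_term[OF KE(1) G]) auto
  show "\<And>m. n \<le> m \<Longrightarrow> pow_span R K y n \<subseteq> pow_span R K y m"
    unfolding pow_span_def by (rule lin_span_mono) auto
qed

lemma pow_span_mult:
  assumes "p \<in> pow_span R K y m" "q \<in> pow_span R K y n"
  shows "p \<otimes> q \<in> pow_span R K y (m + n)"
proof -
  have G: "\<And>n. (\<lambda>i. y [^] i) ` {..<n::nat} \<subseteq> carrier R" using y by auto
  note KE = subringE[OF K]
  have pc: "p \<in> carrier R" using assms pow_span_props(1) by blast
  show ?thesis
  proof (rule lin_span_mult_mem[OF KE(1) G pc assms(2)[unfolded pow_span_def]])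
    show "\<zero> \<in> pow_span R K y (m + n)" by (rule pow_span_props)
    show "\<And>u v. u \<in> pow_span R K y (m + n) \<Longrightarrow> v \<in> pow_span R K y (m + n) \<Longrightarrow>
      u \<oplus> v \<in> pow_span R K y (m + n)" by (rule pow_span_props)
    fix c g assume c: "c \<in> K" "g \<in> (\<lambda>i. y [^] i) ` {..<n}"
    then obtain j where j: "g = y [^] j" "j < n" by blast
    have cc: "c \<in> carrier R" using c KE by auto
    have "(c \<otimes> g) \<otimes> p \<in> pow_span R K y (m + n)"
    proof (rule lin_span_mult_mem[OF KE(1) G _ assms(1)[unfolded pow_span_def]])
      show "c \<otimes> g \<in> carrier R" using cc j y by simp
      show "\<zero> \<in> pow_span R K y (m + n)" by (rule pow_span_props)
      show "\<And>u v. u \<in> pow_span R K y (m + n) \<Longrightarrow> v \<in> pow_span R K y (m + n) \<Longrightarrow>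
        u \<oplus> v \<in> pow_span R K y (m + n)" by (rule pow_span_props)
      fix d h assume d: "d \<in> K" "h \<in> (\<lambda>i. y [^] i) ` {..<m}"
      then obtain i where i: "h = y [^] i" "i < m" by blast
      have dc: "d \<in> carrier R" using d KE by auto
      have "(c \<otimes> g) \<otimes> (d \<otimes> h) = (c \<otimes> d) \<otimes> (y [^] i \<otimes> y [^] j)"
        unfolding i j using cc dc y by (simp add: m_ac)
      also have "\<dots> = (c \<otimes> d) \<otimes> y [^] (i + j)" using y by (simp add: nat_pow_mult)
      finally show "(c \<otimes> g) \<otimes> (d \<otimes> h) \<in> pow_span R K y (m + n)"
        using pow_span_props(5)[of "c \<otimes> d" "i + j" "m + n"] KE(6)[OF c(1) d(1)] i j by simp
    qed
    then show "p \<otimes> (c \<otimes> g) \<in> pow_span R K y (m + n)"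
      using pc cc j y m_comm[of p "c \<otimes> g"] by simp
  qed
qed

lemma monic_in_pow_span: "p \<in> monic_val R K y n \<Longrightarrow> p \<in> pow_span R K y (Suc n)"
proof -
  assume "p \<in> monic_val R K y n"
  then obtain q where q: "p = y [^] n \<oplus> q" "q \<in> pow_span R K y n" by (auto simp: monic_val_def)
  have "\<one> \<otimes> y [^] n \<in> pow_span R K y (Suc n)"
    by (rule pow_span_props(5)) (use subringE[OF K] in auto)
  moreover have "q \<in> pow_span R K y (Suc n)" using q pow_span_props(6)[of n "Suc n"] by auto
  ultimately have "\<one> \<otimes> y [^] n \<oplus> q \<in> pow_span R K y (Suc n)" by (rule pow_span_props(3))
  then show ?thesis using q y by simp
qed

text \<open>Combining \<open>monic_in_pow_span\<close> with \<open>pow_span_mult\<close> would give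
  a bound that is too large by one. The elimination needs coefficients of degree strictly below that
  of the monic factor.\<close>

lemma monic_mult_span:
  assumes "p \<in> monic_val R K y m" "q \<in> pow_span R K y n"
  shows "p \<otimes> q \<in> pow_span R K y (m + n)"
proof (cases n)
  case 0
  have "pow_span R K y 0 \<subseteq> {\<zero>}"
    unfolding pow_span_def by (rule lin_span_subset) (use subringE[OF K] in auto)
  then have "q = \<zero>" using assms(2) 0 by auto
  moreover have "p \<in> carrier R" using monic_in_pow_span[OF assms(1)] pow_span_props(1) by blast
  ultimately show ?thesis using pow_span_props(2) by simp
next
  case (Suc k)
  obtain l where l: "p = y [^] m \<oplus> l" "l \<in> pow_span R K y m"
    using assms(1) by (auto simp: monic_val_def)
  have G: "(\<lambda>i. y [^] i) ` {..<n} \<subseteq> carrier R" using y by auto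
  have "y [^] m \<otimes> q \<in> pow_span R K y (m + n)"
  proof (rule lin_span_mult_mem[OF subringE(1)[OF K] G _ assms(2)[unfolded pow_span_def]])
    fix c g assume c: "c \<in> K" "g \<in> (\<lambda>i. y [^] i) ` {..<n}"
    then obtain j where j: "g = y [^] j" "j < n" by blast
    have "y [^] m \<otimes> (c \<otimes> g) = c \<otimes> y [^] (m + j)"
      using c j y subringE(1)[OF K] by (auto simp: m_lcomm nat_pow_mult)
    then show "y [^] m \<otimes> (c \<otimes> g) \<in> pow_span R K y (m + n)"
      using pow_span_props(5)[of c "m + j" "m + n"] c j by simp
  qed (use y pow_span_props in auto)
  moreover have "l \<otimes> q \<in> pow_span R K y (m + n)" by (rule pow_span_mult[OF l(2) assms(2)])
  ultimately have "y [^] m \<otimes> q \<oplus> l \<otimes> q \<in> pow_span R K y (m + n)" by (rule pow_span_props(3))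
  moreover have "l \<in> carrier R" "q \<in> carrier R" using l assms pow_span_props(1) by blast+
  ultimately show ?thesis unfolding l(1) using y by (simp add: l_distr)
qed

lemma monic_mult:
  assumes "p \<in> monic_val R K y m" "q \<in> monic_val R K y n"
  shows "p \<otimes> q \<in> monic_val R K y (m + n)"
proof -
  obtain l where l: "p = y [^] m \<oplus> l" "l \<in> pow_span R K y m"
    using assms(1) by (auto simp: monic_val_def)
  obtain k where k: "q = y [^] n \<oplus> k" "k \<in> pow_span R K y n"
    using assms(2) by (auto simp: monic_val_def)
  have "q \<otimes> l \<in> pow_span R K y (n + m)" by (rule monic_mult_span[OF assms(2) l(2)])
  moreover have "y [^] m \<otimes> k \<in> pow_span R K y (m + n)"
  proof (rule monic_mult_span[OF _ k(2)])
    have "y [^] m = y [^] m \<oplus> \<zero>" using y by simp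
    then show "y [^] m \<in> monic_val R K y m"
      unfolding monic_val_def using pow_span_props(2) by blast
  qed
  ultimately have s: "y [^] m \<otimes> k \<oplus> q \<otimes> l \<in> pow_span R K y (m + n)"
    using pow_span_props(3) by (simp add: add.commute)
  have car: "l \<in> carrier R" "k \<in> carrier R" "y [^] m \<in> carrier R" "y [^] n \<in> carrier R"
    using l k y pow_span_props(1) by blast+
  have "p \<otimes> q = y [^] m \<otimes> y [^] n \<oplus> (y [^] m \<otimes> k \<oplus> (y [^] n \<oplus> k) \<otimes> l)"
    unfolding l(1) k(1) using car by algebra
  also have "\<dots> = y [^] (m + n) \<oplus> (y [^] m \<otimes> k \<oplus> q \<otimes> l)" unfolding k(1) using y by (simp add: nat_pow_mult)
  finally show ?thesis unfolding monic_val_def using s by blast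
qed

text \<open>Elimination in place of the determinant trick: if \<open>p h = l h + s\<close> with \<open>l\<close> of lower degree,
  then \<open>p - l\<close> is monic and multiplying the other relations by it removes \<open>h\<close>.\<close>

lemma monic_annihilator:
  assumes "finite G" "G \<subseteq> carrier R" "p \<in> monic_val R K y N"
    and "\<And>g. g \<in> G \<Longrightarrow> p \<otimes> g \<in> lin_span R (pow_span R K y N) G"
  shows "\<exists>n. \<exists>q\<in>monic_val R K y n. \<forall>g\<in>G. q \<otimes> g = \<zero>"
  using assms
proof (induction G arbitrary: p N rule: finite_induct)
  case empty
  then show ?case by blast
next
  case (insert h G)
  let ?L = "pow_span R K y N"
  note L = pow_span_props[where n = N]
  have G: "G \<subseteq> carrier R" and h: "h \<in> carrier R" using insert by auto
  have split: "\<exists>c t. c \<in> ?L \<and> t \<in> lin_span R ?L G \<and> p \<otimes> g = c \<otimes> h \<oplus> t" if "g \<in> insert h G" for g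
    using lin_span_insertE[OF L(1) insert(4) L(2,3) insert(6)[OF that]] by metis
  obtain l s where l: "l \<in> ?L" "s \<in> lin_span R ?L G" "p \<otimes> h = l \<otimes> h \<oplus> s"
    using split[of h] by blast
  have p: "p \<in> carrier R" using monic_in_pow_span[OF insert(5)] pow_span_props(1) by blast
  have lc: "l \<in> carrier R" and sc: "s \<in> carrier R"
    using l L(1) lin_span_closed[OF L(1) G] by auto
  define p' where "p' = p \<ominus> l"
  have p'c: "p' \<in> carrier R" using p lc by (simp add: p'_def)
  have p': "p' \<in> monic_val R K y N"
  proof -
    obtain k where k: "p = y [^] N \<oplus> k" "k \<in> ?L" using insert(5) by (auto simp: monic_val_def)
    have "k \<in> carrier R" "y [^] N \<in> carrier R" using k L(1) y by auto
    then have "p' = y [^] N \<oplus> (k \<oplus> \<ominus> l)" unfolding p'_def k(1) using lc by algebra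
    then show ?thesis using L(3)[OF k(2) L(4)[OF l(1)]] by (auto simp: monic_val_def)
  qed
  have p'h: "p' \<otimes> h = s"
  proof -
    have "p' \<otimes> h = p \<otimes> h \<ominus> l \<otimes> h" unfolding p'_def using p lc h by algebra
    also have "\<dots> = s" unfolding l(3) using lc h sc by algebra
    finally show ?thesis .
  qed
  let ?L2 = "pow_span R K y (N + N)"
  \<comment> \<open>The induction hypothesis is applied to \<open>p' \<otimes> p\<close>, of degree
    \<open>N + N\<close>: \<open>p \<otimes> g\<close> is \<open>c \<otimes> h \<oplus> t\<close>,
    multiplication by \<open>p'\<close> turns \<open>h\<close> into \<open>s\<close>, and only
    generators from \<open>G\<close> remain.\<close>
  have "\<exists>n. \<exists>q\<in>monic_val R K y n. \<forall>g\<in>G. q \<otimes> g = \<zero>"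
  proof (rule insert.IH[OF G monic_mult[OF p' insert(5)]])
    fix g assume g: "g \<in> G"
    then obtain c t where c: "c \<in> ?L" "t \<in> lin_span R ?L G" "p \<otimes> g = c \<otimes> h \<oplus> t"
      using split[of g] by blast
    have car: "c \<in> carrier R" "t \<in> carrier R" "g \<in> carrier R"
      using c L(1) lin_span_closed[OF L(1) G] g G by auto
    have "p' \<otimes> p \<otimes> g = p' \<otimes> (c \<otimes> h \<oplus> t)" using p p'c car c(3) by (simp add: m_assoc)
    also have "\<dots> = c \<otimes> (p' \<otimes> h) \<oplus> p' \<otimes> t" using p'c car h by algebra
    finally have eq: "p' \<otimes> p \<otimes> g = c \<otimes> s \<oplus> p' \<otimes> t" unfolding p'h .
    have mm: "a \<otimes> w \<in> lin_span R ?L2 G"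
      if a: "a \<in> carrier R" "\<And>b. b \<in> ?L \<Longrightarrow> a \<otimes> b \<in> ?L2" and w: "w \<in> lin_span R ?L G" for a w
    proof (rule lin_span_mult_mem[OF L(1) G a(1) w])
      show "\<zero> \<in> lin_span R ?L2 G" by (rule lin_span.zero)
      show "\<And>u v. u \<in> lin_span R ?L2 G \<Longrightarrow> v \<in> lin_span R ?L2 G \<Longrightarrow> u \<oplus> v \<in> lin_span R ?L2 G"
        by (rule lin_span_add[OF pow_span_props(1) G])
      fix b g assume b: "b \<in> ?L" "g \<in> G"
      then have "b \<in> carrier R" "g \<in> carrier R" using L(1) G by auto
      then show "a \<otimes> (b \<otimes> g) \<in> lin_span R ?L2 G"
        using lin_span_term[OF pow_span_props(1) G a(2)[OF b(1)] b(2)] a(1) by (simp add: m_assoc)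
    qed
    show "p' \<otimes> p \<otimes> g \<in> lin_span R ?L2 G" unfolding eq
      by (rule lin_span_add[OF pow_span_props(1) G mm[OF car(1) pow_span_mult[OF c(1)] l(2)]
        mm[OF p'c monic_mult_span[OF p'] c(2)]])
  qed
  then obtain n q where q: "q \<in> monic_val R K y n" "\<And>g. g \<in> G \<Longrightarrow> q \<otimes> g = \<zero>" by blast
  have qc: "q \<in> carrier R" using monic_in_pow_span[OF q(1)] pow_span_props(1) by blast
  \<comment> \<open>On \<open>G\<close> the factor \<open>q\<close> suffices. On \<open>h\<close>
    the factor \<open>p'\<close> produces \<open>s\<close>, which lies in the span of
    \<open>G\<close> and is therefore killed by \<open>q\<close>.\<close>
  have "q \<otimes> p' \<otimes> g = \<zero>" if "g \<in> insert h G" for g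
  proof (cases "g = h")
    case True
    have "q \<otimes> s = \<zero>" by (rule lin_span_kill[OF L(1) G qc l(2) q(2)])
    then show ?thesis using True p'h qc p'c h by (simp add: m_assoc)
  next
    case False
    then have "q \<otimes> g = \<zero>" "g \<in> carrier R" using that q(2) G by auto
    moreover have "q \<otimes> p' \<otimes> g = p' \<otimes> (q \<otimes> g)" using qc p'c \<open>g \<in> carrier R\<close> by (simp add: m_ac)
    ultimately show ?thesis using p'c by simp
  qed
  then show ?case using monic_mult[OF q(1) p'] by blast
qed

text \<open>Returns from the inductive span to the coefficient function that the definition of
  integrality asks for; repeated powers are merged by updating one coefficient.\<close>

lemma pow_span_finsum:
  assumes "p \<in> pow_span R K y n"
  obtains c where "\<And>i. i < n \<Longrightarrow> c i \<in> K" "p = (\<Oplus>i\<in>{..<n}. c i \<otimes> y [^] i)"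
proof -
  note KE = subringE[OF K]
  have "\<exists>c. (\<forall>i<n. c i \<in> K) \<and> p = (\<Oplus>i\<in>{..<n}. c i \<otimes> y [^] i)"
    using assms unfolding pow_span_def
  proof induction
    case zero
    have "(\<Oplus>i\<in>{..<n}. \<zero> \<otimes> y [^] i) = \<zero>" using y by (intro add.finprod_one_eqI) auto
    then show ?case using KE(2) by (intro exI[of _ "\<lambda>_. \<zero>"]) auto
  next
    case (step a g s)
    then obtain c j where c: "\<And>i. i < n \<Longrightarrow> c i \<in> K" "s = (\<Oplus>i\<in>{..<n}. c i \<otimes> y [^] i)"
      and j: "g = y [^] j" "j < n" by auto
    have ac: "a \<in> carrier R" and cc: "\<And>i. i < n \<Longrightarrow> c i \<in> carrier R" using step c KE by auto
    define d where "d = c(j := a \<oplus> c j)"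
    have rem: "(\<Oplus>i\<in>{..<n}. f i \<otimes> y [^] i) = f j \<otimes> y [^] j \<oplus> (\<Oplus>i\<in>{..<n} - {j}. f i \<otimes> y [^] i)"
      if "\<And>i. i < n \<Longrightarrow> f i \<in> carrier R" for f
    proof -
      have "{..<n} = insert j ({..<n} - {j})" using j(2) by auto
      then show ?thesis
        using that j(2) y add.finprod_insert[of "{..<n} - {j}" j "\<lambda>i. f i \<otimes> y [^] i"] by auto
    qed
    have "(\<Oplus>i\<in>{..<n}. d i \<otimes> y [^] i)
      = d j \<otimes> y [^] j \<oplus> (\<Oplus>i\<in>{..<n} - {j}. d i \<otimes> y [^] i)"
      using ac cc j by (intro rem) (auto simp: d_def)
    also have "(\<Oplus>i\<in>{..<n} - {j}. d i \<otimes> y [^] i) = (\<Oplus>i\<in>{..<n} - {j}. c i \<otimes> y [^] i)"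
      using y cc by (intro add.finprod_cong') (auto simp: d_def)
    also have "d j \<otimes> y [^] j \<oplus> (\<Oplus>i\<in>{..<n} - {j}. c i \<otimes> y [^] i)
      = a \<otimes> g \<oplus> (c j \<otimes> y [^] j \<oplus> (\<Oplus>i\<in>{..<n} - {j}. c i \<otimes> y [^] i))"
      using j y ac cc[of j] by (subst a_assoc[symmetric]) (auto simp: d_def l_distr intro!: finsum_closed cc)
    also have "c j \<otimes> y [^] j \<oplus> (\<Oplus>i\<in>{..<n} - {j}. c i \<otimes> y [^] i) = s"
      unfolding c(2) using cc by (intro rem[symmetric])
    finally have "a \<otimes> g \<oplus> s = (\<Oplus>i\<in>{..<n}. d i \<otimes> y [^] i)" by simp
    moreover have "\<forall>i<n. d i \<in> K" using c(1) step(1) j KE(7) by (auto simp: d_def)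
    ultimately show ?case by blast
  qed
  then show thesis using that by blast
qed

lemma finsum_in_pow_span:
  assumes "\<And>i. i < n \<Longrightarrow> c i \<in> K"
  shows "(\<Oplus>i\<in>{..<n}. c i \<otimes> y [^] i) \<in> pow_span R K y n"
  using assms
proof (induction n)
  case 0
  then show ?case using pow_span_props(2) by simp
next
  case (Suc n)
  have cc: "\<And>i. i < Suc n \<Longrightarrow> c i \<in> carrier R" using Suc(2) subringE(1)[OF K] by auto
  have "(\<Oplus>i\<in>{..<Suc n}. c i \<otimes> y [^] i) = c n \<otimes> y [^] n \<oplus> (\<Oplus>i\<in>{..<n}. c i \<otimes> y [^] i)"
    unfolding lessThan_Suc using y cc by (intro add.finprod_insert) auto
  moreover have "(\<Oplus>i\<in>{..<n}. c i \<otimes> y [^] i) \<in> pow_span R K y (Suc n)"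
    using Suc pow_span_props(6)[of n "Suc n"] by auto
  ultimately show ?case using Suc(2) pow_span_props(3,5) by auto
qed

end

end

section \<open>Integral elements\<close>

text \<open>This is \<open>int_closure\<close> with coefficients taken from a subset of the ambient
  ring instead of through the embedding, so that integrality can be studied inside one ring.\<close>

definition integral_elems :: "('a, 'b) ring_scheme \<Rightarrow> 'a set \<Rightarrow> 'a set" where
  "integral_elems Q K = {x \<in> carrier Q. \<exists>n::nat. \<exists>c. (\<forall>i<n. c i \<in> K) \<and>
     x [^]\<^bsub>Q\<^esub> n \<oplus>\<^bsub>Q\<^esub> finsum Q (\<lambda>i. c i \<otimes>\<^bsub>Q\<^esub> x [^]\<^bsub>Q\<^esub> i) {..<n} = \<zero>\<^bsub>Q\<^esub>}"

context cring
begin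

lemma lin_span_prod:
  assumes K: "subring K R" and F: "F \<subseteq> carrier R" and H: "H \<subseteq> carrier R"
    and "s \<in> lin_span R K F" "t \<in> lin_span R K H"
  shows "s \<otimes> t \<in> lin_span R K {f \<otimes> h | f h. f \<in> F \<and> h \<in> H}" (is "_ \<in> lin_span R K ?G")
proof -
  note KE = subringE[OF K]
  have G: "?G \<subseteq> carrier R" using F H by auto
  have z: "\<zero> \<in> lin_span R K ?G" by (rule lin_span.zero)
  have a: "\<And>u v. u \<in> lin_span R K ?G \<Longrightarrow> v \<in> lin_span R K ?G \<Longrightarrow> u \<oplus> v \<in> lin_span R K ?G"
    by (rule lin_span_add[OF KE(1) G])
  have sc: "s \<in> carrier R" using assms(4) lin_span_closed[OF KE(1) F] by blast
  show ?thesis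
  proof (rule lin_span_mult_mem[OF KE(1) H sc assms(5) z a])
    fix c h assume c: "c \<in> K" "h \<in> H"
    have car: "c \<in> carrier R" "h \<in> carrier R" using c KE(1) H by auto
    have "(c \<otimes> h) \<otimes> s \<in> lin_span R K ?G"
    proof (rule lin_span_mult_mem[OF KE(1) F _ assms(4) z a])
      show "c \<otimes> h \<in> carrier R" using car by simp
      fix d f assume d: "d \<in> K" "f \<in> F"
      have dc: "d \<in> carrier R" "f \<in> carrier R" using d KE(1) F by auto
      have "(c \<otimes> h) \<otimes> (d \<otimes> f) = (c \<otimes> d) \<otimes> (f \<otimes> h)" using car dc by algebra
      moreover have "f \<otimes> h \<in> ?G" using c d by blast
      ultimately show "(c \<otimes> h) \<otimes> (d \<otimes> f) \<in> lin_span R K ?G"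
        using lin_span_term[OF KE(1) G KE(6)[OF c(1) d(1)]] by simp
    qed
    then show "s \<otimes> (c \<otimes> h) \<in> lin_span R K ?G" using m_comm[OF sc, of "c \<otimes> h"] car by simp
  qed
qed

text \<open>The elimination starts from the monic value \<open>y\<close> of degree one and constant
  coefficients. The monic value that it produces kills \<open>G\<close>, hence the unit
  \<open>u\<close> in the span of \<open>G\<close>, hence vanishes: this is an integral equation. A
  unit is asked for instead of \<open>\<one>\<close> because one of the modules will be a proper
  ideal containing \<open>t\<close>.\<close>

lemma integralI_module:
  assumes K: "subring K R" and y: "y \<in> carrier R" and G: "finite G" "G \<subseteq> carrier R"
    and yG: "\<And>g. g \<in> G \<Longrightarrow> y \<otimes> g \<in> lin_span R K G"
    and u: "u \<in> lin_span R K G" "u \<in> Units R"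
  shows "y \<in> integral_elems R K"
proof -
  note KE = subringE[OF K]
  note props = pow_span_props[OF K y]
  have "K \<subseteq> pow_span R K y 1"
  proof
    fix c assume "c \<in> K"
    then show "c \<in> pow_span R K y 1" using props(5)[of c 0 1] KE(1) by auto
  qed
  then have mono: "lin_span R K G \<subseteq> lin_span R (pow_span R K y 1) G" by (intro lin_span_mono) auto
  have "y = y [^] (1::nat) \<oplus> \<zero>" using y by simp
  then have "y \<in> monic_val R K y 1" unfolding monic_val_def using props(2) by blast
  from monic_annihilator[OF K y G this] yG mono
  obtain n q where q: "q \<in> monic_val R K y n" "\<And>g. g \<in> G \<Longrightarrow> q \<otimes> g = \<zero>" by blast
  have qc: "q \<in> carrier R" using monic_in_pow_span[OF K y q(1)] props(1) by blast
  have uc: "u \<in> carrier R" using u(2) by (rule Units_closed)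
  have "q \<otimes> u = \<zero>" by (rule lin_span_kill[OF KE(1) G(2) qc u(1) q(2)])
  then have "q \<otimes> u \<otimes> inv u = \<zero>" using u(2) by simp
  then have q0: "q = \<zero>" using u(2) qc uc by (simp add: m_assoc)
  obtain p where p: "q = y [^] n \<oplus> p" "p \<in> pow_span R K y n" using q(1) by (auto simp: monic_val_def)
  obtain c where "\<And>i. i < n \<Longrightarrow> c i \<in> K" "p = (\<Oplus>i\<in>{..<n}. c i \<otimes> y [^] i)"
    using pow_span_finsum[OF K y p(2)] by metis
  then show ?thesis unfolding integral_elems_def using y p(1) q0 by auto
qed

lemma integral_module:
  assumes K: "subring K R" and x: "x \<in> integral_elems R K"
  obtains F where "finite F" "F \<subseteq> carrier R" "\<one> \<in> F" "\<And>f. f \<in> F \<Longrightarrow> x \<otimes> f \<in> lin_span R K F"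
proof -
  note KE = subringE[OF K]
  have xc: "x \<in> carrier R" using x by (simp add: integral_elems_def)
  note props = pow_span_props[OF K xc]
  obtain n :: nat and c where c: "\<And>i. i < n \<Longrightarrow> c i \<in> K"
    and eq: "x [^] n \<oplus> (\<Oplus>i\<in>{..<n}. c i \<otimes> x [^] i) = \<zero>"
    using x unfolding integral_elems_def by blast
  define l where "l = (\<Oplus>i\<in>{..<n}. c i \<otimes> x [^] i)"
  have l: "l \<in> pow_span R K x n" unfolding l_def by (rule finsum_in_pow_span[OF K xc c])
  have lc: "l \<in> carrier R" using l props(1) by blast
  have xn: "x [^] n = \<ominus> l" using eq lc xc unfolding l_def[symmetric] by (simp add: minus_equality[symmetric])
  \<comment> \<open>All powers up to \<open>x [^] n\<close> inclusive, so that \<open>\<one>\<close>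
    belongs to \<open>F\<close> even for \<open>n = 0\<close>. The product of \<open>x\<close> with
    the last power is minus \<open>x \<otimes> l\<close>, where \<open>l\<close> has degree below
    \<open>n\<close>, so it stays in the span.\<close>
  define F where "F = (\<lambda>i. x [^] i) ` {..<Suc n}"
  have sp: "lin_span R K F = pow_span R K x (Suc n)" by (simp add: F_def pow_span_def)
  show thesis
  proof (rule that[of F])
    show "finite F" "F \<subseteq> carrier R" using xc by (auto simp: F_def)
    show "\<one> \<in> F" unfolding F_def by (rule image_eqI[of _ _ 0]) auto
    fix f assume "f \<in> F"
    then obtain i where i: "f = x [^] i" "i < Suc n" by (auto simp: F_def)
    show "x \<otimes> f \<in> lin_span R K F"
    proof (cases "i = n")
      case True
      have "x = x [^] (1::nat) \<oplus> \<zero>" using xc by simp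
      then have "x \<in> monic_val R K x 1" unfolding monic_val_def using props(2) by blast
      from monic_mult_span[OF K xc this l] have "x \<otimes> l \<in> pow_span R K x (Suc n)" by simp
      then have "\<ominus> (x \<otimes> l) \<in> pow_span R K x (Suc n)" by (rule props(4))
      then show ?thesis using True i xn xc lc by (simp add: sp r_minus)
    next
      case False
      then have "\<one> \<otimes> x [^] (Suc i) \<in> pow_span R K x (Suc n)" using i KE(3) by (intro props(5)) auto
      then show ?thesis using i xc m_comm[of x "x [^] i"] by (simp add: sp)
    qed
  qed
qed

text \<open>Sums and products of two integral elements act on the module generated by all products
  of a generator for \<open>x\<close> and a generator for \<open>y\<close>. This module contains
  \<open>\<one>\<close>, so \<open>integralI_module\<close> applies.\<close>

lemma subring_integral_elems:
  assumes K: "subring K R"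
  shows "subring (integral_elems R K) R" "K \<subseteq> integral_elems R K"
proof -
  note KE = subringE[OF K]
  show sub: "K \<subseteq> integral_elems R K"
  proof
    fix k assume k: "k \<in> K"
    show "k \<in> integral_elems R K"
    proof (rule integralI_module[OF K, of k "{\<one>}" \<one>])
      show "\<one> \<in> lin_span R K {\<one>}" by (rule lin_span_base[OF K]) auto
      show "k \<otimes> g \<in> lin_span R K {\<one>}" if "g \<in> {\<one>}" for g
        using that lin_span_term[OF KE(1), of "{\<one>}" k \<one>] k by simp
    qed (use k KE(1) in auto)
  qed
  have closed: "x \<otimes> y \<in> integral_elems R K" "x \<oplus> y \<in> integral_elems R K"
    if x: "x \<in> integral_elems R K" and y: "y \<in> integral_elems R K" for x y
  proof -
    have xc: "x \<in> carrier R" "y \<in> carrier R" using x y by (auto simp: integral_elems_def)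
    obtain F where F: "finite F" "F \<subseteq> carrier R" "\<one> \<in> F" "\<And>f. f \<in> F \<Longrightarrow> x \<otimes> f \<in> lin_span R K F"
      using integral_module[OF K x] by metis
    obtain H where H: "finite H" "H \<subseteq> carrier R" "\<one> \<in> H" "\<And>f. f \<in> H \<Longrightarrow> y \<otimes> f \<in> lin_span R K H"
      using integral_module[OF K y] by metis
    let ?G = "{f \<otimes> h | f h. f \<in> F \<and> h \<in> H}"
    have "?G = (\<lambda>(f, h). f \<otimes> h) ` (F \<times> H)" by auto
    then have fin: "finite ?G" using F(1) H(1) by simp
    have G: "?G \<subseteq> carrier R" using F(2) H(2) by auto
    have "\<one> = \<one> \<otimes> \<one>" by simp
    then have "\<one> \<in> ?G" using F(3) H(3) by blast
    then have one: "\<one> \<in> lin_span R K ?G" by (rule lin_span_base[OF K G])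
    have base: "s \<in> lin_span R K F" if "s \<in> F" for s using that by (rule lin_span_base[OF K F(2)])
    have base': "s \<in> lin_span R K H" if "s \<in> H" for s using that by (rule lin_span_base[OF K H(2)])
    show "x \<otimes> y \<in> integral_elems R K"
    proof (rule integralI_module[OF K _ fin G _ one Units_one_closed])
      fix g assume "g \<in> ?G"
      then obtain f h where g: "g = f \<otimes> h" "f \<in> F" "h \<in> H" by blast
      have "f \<in> carrier R" "h \<in> carrier R" using g F H by auto
      then have "x \<otimes> y \<otimes> g = (x \<otimes> f) \<otimes> (y \<otimes> h)" unfolding g(1) using xc by algebra
      then show "x \<otimes> y \<otimes> g \<in> lin_span R K ?G"
        using lin_span_prod[OF K F(2) H(2) F(4)[OF g(2)] H(4)[OF g(3)]] by simp
    qed (use xc in simp)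
    show "x \<oplus> y \<in> integral_elems R K"
    proof (rule integralI_module[OF K _ fin G _ one Units_one_closed])
      fix g assume "g \<in> ?G"
      then obtain f h where g: "g = f \<otimes> h" "f \<in> F" "h \<in> H" by blast
      have "f \<in> carrier R" "h \<in> carrier R" using g F H by auto
      then have "(x \<oplus> y) \<otimes> g = (x \<otimes> f) \<otimes> h \<oplus> f \<otimes> (y \<otimes> h)" unfolding g(1) using xc by algebra
      then show "(x \<oplus> y) \<otimes> g \<in> lin_span R K ?G"
        using lin_span_add[OF KE(1) G lin_span_prod[OF K F(2) H(2) F(4)[OF g(2)] base'[OF g(3)]]
          lin_span_prod[OF K F(2) H(2) base[OF g(2)] H(4)[OF g(3)]]] by simp
    qed (use xc in simp)
  qed
  show "subring (integral_elems R K) R"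
  proof (rule subringI)
    show c: "integral_elems R K \<subseteq> carrier R" by (auto simp: integral_elems_def)
    show "\<one> \<in> integral_elems R K" using sub KE(3) by blast
    fix h assume h: "h \<in> integral_elems R K"
    have "\<ominus> \<one> \<in> integral_elems R K" using sub KE(3,5) by blast
    then have "\<ominus> \<one> \<otimes> h \<in> integral_elems R K" by (rule closed(1)[OF _ h])
    then show "\<ominus> h \<in> integral_elems R K" using h c by (auto simp: l_minus)
  qed (use closed in auto)
qed

end

section \<open>Local ring extensions generated by two elements\<close>

lemma (in ring) diff_add_cancel:
  assumes "a \<in> carrier R" "b \<in> carrier R"
  shows "(a \<ominus> b) \<oplus> b = a"
  using assms by (simp add: minus_eq a_assoc l_neg)

text \<open>\<open>K\<close> stands for the image of a local ring in an ambient ring, and the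
  elements of \<open>K\<close> outside \<open>M\<close> are invertible in \<open>K\<close>.
  Integrality and dimension are kept out, so that Nakayama's lemma is already available while the
  stronger axioms below are being verified.\<close>

locale local_two_gen = cring Q for Q (structure) +
  fixes K A M :: "'a set" and \<alpha> \<beta> :: 'a
  assumes K: "subring K Q" and A: "subring A Q" and KA: "K \<subseteq> A"
    and M: "M \<subseteq> K" "\<zero> \<in> M" "\<one> \<notin> M"
    and M_add: "\<And>a b. a \<in> M \<Longrightarrow> b \<in> M \<Longrightarrow> a \<oplus> b \<in> M"
    and M_mult: "\<And>a b. a \<in> K \<Longrightarrow> b \<in> M \<Longrightarrow> a \<otimes> b \<in> M"
    and M_unit: "\<And>a. a \<in> K \<Longrightarrow> a \<notin> M \<Longrightarrow> \<exists>b\<in>K. a \<otimes> b = \<one>"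
    and \<alpha>\<beta>: "\<alpha> \<in> A" "\<beta> \<in> A"
    and gen: "\<And>a. a \<in> A \<Longrightarrow> \<exists>r\<in>K. \<exists>s\<in>K. a = r \<otimes> \<alpha> \<oplus> s \<otimes> \<beta>"
begin

text \<open>This is the extended ideal \<open>M A\<close>: as \<open>\<alpha>\<close> and
  \<open>\<beta>\<close> generate \<open>A\<close> over \<open>K\<close>, coefficients in
  \<open>M\<close> suffice (\<open>MA_in_J\<close>). In this form the coefficients for Nakayama's
  lemma can be read off.\<close>

definition J :: "'a set" where
  "J = {r \<otimes> \<alpha> \<oplus> s \<otimes> \<beta> | r s. r \<in> M \<and> s \<in> M}"

lemmas KE = subringE[OF K] and AE = subringE[OF A]

lemma K_closed [simp, intro]: "a \<in> K \<Longrightarrow> a \<in> carrier Q" using KE(1) by blast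
lemma A_closed [simp, intro]: "a \<in> A \<Longrightarrow> a \<in> carrier Q" using AE(1) by blast
lemma M_in_K: "a \<in> M \<Longrightarrow> a \<in> K" using M(1) by blast
lemma M_closed [simp, intro]: "a \<in> M \<Longrightarrow> a \<in> carrier Q" using M_in_K by blast
lemma K_in_A: "a \<in> K \<Longrightarrow> a \<in> A" using KA by blast

lemma K_diff: "a \<in> K \<Longrightarrow> b \<in> K \<Longrightarrow> a \<ominus> b \<in> K" using KE(5,7) by (simp add: minus_eq)

lemma M_neg: "a \<in> M \<Longrightarrow> \<ominus> a \<in> M"
  using M_mult[of "\<ominus> \<one>" a] KE(3,5) by (simp add: l_minus)

lemma M_diff: "a \<in> M \<Longrightarrow> b \<in> M \<Longrightarrow> a \<ominus> b \<in> M" using M_neg M_add by (simp add: minus_eq)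

lemma M_prime:
  assumes "a \<in> K" "a \<notin> M" "b \<in> K" "a \<otimes> b \<in> M"
  shows "b \<in> M"
proof -
  obtain c where c: "c \<in> K" "a \<otimes> c = \<one>" using M_unit[OF assms(1,2)] by blast
  have "c \<otimes> (a \<otimes> b) = (a \<otimes> c) \<otimes> b" using assms(1,3) c(1) by (simp add: m_ac)
  then show ?thesis using M_mult[OF c(1) assms(4)] c(2) assms(3) by simp
qed

lemma J_mem: "r \<in> M \<Longrightarrow> s \<in> M \<Longrightarrow> r \<otimes> \<alpha> \<oplus> s \<otimes> \<beta> \<in> J" unfolding J_def by blast

lemma MA_in_J: assumes "m \<in> M" "a \<in> A" shows "m \<otimes> a \<in> J"
proof -
  obtain r s where rs: "r \<in> K" "s \<in> K" "a = r \<otimes> \<alpha> \<oplus> s \<otimes> \<beta>" using gen[OF assms(2)] by blast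
  have car: "r \<in> carrier Q" "s \<in> carrier Q" "m \<in> carrier Q" "\<alpha> \<in> carrier Q" "\<beta> \<in> carrier Q"
    using rs assms \<alpha>\<beta> by auto
  have "m \<otimes> a = (r \<otimes> m) \<otimes> \<alpha> \<oplus> (s \<otimes> m) \<otimes> \<beta>" unfolding rs(3) using car by algebra
  then show ?thesis using J_mem M_mult rs assms(1) by simp
qed

lemma M_in_J: "m \<in> M \<Longrightarrow> m \<in> J" using MA_in_J[OF _ AE(3)] r_one[OF M_closed] by metis

lemma J_in_A: assumes "j \<in> J" shows "j \<in> A"
proof -
  obtain r s where rs: "r \<in> M" "s \<in> M" "j = r \<otimes> \<alpha> \<oplus> s \<otimes> \<beta>" using assms unfolding J_def by blast
  have "r \<in> A" "s \<in> A" using rs K_in_A M_in_K by auto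
  then show ?thesis unfolding rs(3) using AE(6,7) \<alpha>\<beta> by simp
qed

lemma J_closed [simp, intro]: "j \<in> J \<Longrightarrow> j \<in> carrier Q" using J_in_A by blast

lemma J_zero: "\<zero> \<in> J" using M_in_J M(2) by blast

lemma J_add: assumes "i \<in> J" "j \<in> J" shows "i \<oplus> j \<in> J"
proof -
  obtain r s r' s' where *: "r \<in> M" "s \<in> M" "i = r \<otimes> \<alpha> \<oplus> s \<otimes> \<beta>"
    "r' \<in> M" "s' \<in> M" "j = r' \<otimes> \<alpha> \<oplus> s' \<otimes> \<beta>" using assms unfolding J_def by blast
  have car: "r \<in> carrier Q" "s \<in> carrier Q" "r' \<in> carrier Q" "s' \<in> carrier Q"
    "\<alpha> \<in> carrier Q" "\<beta> \<in> carrier Q" using * \<alpha>\<beta> by auto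
  have "i \<oplus> j = (r \<oplus> r') \<otimes> \<alpha> \<oplus> (s \<oplus> s') \<otimes> \<beta>" unfolding *(3,6) using car by algebra
  then show ?thesis using J_mem M_add * by simp
qed

lemma J_mult: assumes "a \<in> A" "j \<in> J" shows "a \<otimes> j \<in> J"
proof -
  obtain r s where *: "r \<in> M" "s \<in> M" "j = r \<otimes> \<alpha> \<oplus> s \<otimes> \<beta>" using assms unfolding J_def by blast
  have car: "r \<in> carrier Q" "s \<in> carrier Q" "a \<in> carrier Q" "\<alpha> \<in> carrier Q" "\<beta> \<in> carrier Q"
    using * \<alpha>\<beta> assms by auto
  have "a \<otimes> j = r \<otimes> (a \<otimes> \<alpha>) \<oplus> s \<otimes> (a \<otimes> \<beta>)" unfolding *(3) using car by algebra
  then show ?thesis using J_add MA_in_J AE(6) \<alpha>\<beta> * assms(1) by simp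
qed

text \<open>Modulo \<open>I\<close> the generators satisfy a two by two linear system with
  coefficients in \<open>M\<close>, solved by substitution: inverting
  \<open>\<one> \<ominus> a\<close> expresses \<open>\<alpha>\<close> through
  \<open>\<beta>\<close>, then inverting
  \<open>\<one> \<ominus> (d \<oplus> c \<otimes> (u \<otimes> b))\<close> puts
  \<open>\<beta>\<close> into \<open>I\<close>. Both are units because they differ from
  \<open>\<one>\<close> by an element of \<open>M\<close>.\<close>

lemma nakayama:
  assumes I: "I \<subseteq> carrier Q" "\<And>u v. u \<in> I \<Longrightarrow> v \<in> I \<Longrightarrow> u \<oplus> v \<in> I"
    "\<And>r u. r \<in> K \<Longrightarrow> u \<in> I \<Longrightarrow> r \<otimes> u \<in> I"
    and sum: "\<And>a. a \<in> A \<Longrightarrow> \<exists>i\<in>I. \<exists>j\<in>J. a = i \<oplus> j"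
  shows "A \<subseteq> I"
proof -
  have unit: "\<exists>u\<in>K. u \<otimes> (\<one> \<ominus> m) = \<one>" if m: "m \<in> M" for m
  proof -
    have mK: "\<one> \<ominus> m \<in> K" using K_diff KE(3) M_in_K m by blast
    have "\<one> \<ominus> m \<notin> M"
    proof
      assume "\<one> \<ominus> m \<in> M"
      then have "(\<one> \<ominus> m) \<oplus> m \<in> M" using m by (rule M_add)
      moreover have "m \<in> carrier Q" using m by auto
      then have "(\<one> \<ominus> m) \<oplus> m = \<one>" by algebra
      ultimately show False using M(3) by simp
    qed
    then obtain b where "b \<in> K" "(\<one> \<ominus> m) \<otimes> b = \<one>" using M_unit[OF mK] by blast
    then show ?thesis using m_comm[of b "\<one> \<ominus> m"] mK by auto
  qed
  obtain i1 j1 where 1: "i1 \<in> I" "j1 \<in> J" "\<alpha> = i1 \<oplus> j1" using sum[OF \<alpha>\<beta>(1)] by blast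
  obtain i2 j2 where 2: "i2 \<in> I" "j2 \<in> J" "\<beta> = i2 \<oplus> j2" using sum[OF \<alpha>\<beta>(2)] by blast
  obtain a b where ab: "a \<in> M" "b \<in> M" "j1 = a \<otimes> \<alpha> \<oplus> b \<otimes> \<beta>" using 1 unfolding J_def by blast
  obtain c d where cd: "c \<in> M" "d \<in> M" "j2 = c \<otimes> \<alpha> \<oplus> d \<otimes> \<beta>" using 2 unfolding J_def by blast
  obtain u where u: "u \<in> K" "u \<otimes> (\<one> \<ominus> a) = \<one>" using unit[OF ab(1)] by blast
  have "d \<oplus> c \<otimes> (u \<otimes> b) \<in> M" using ab(2) cd(1,2) u(1) M_add M_mult M_in_K by simp
  then obtain v where v: "v \<in> K" "v \<otimes> (\<one> \<ominus> (d \<oplus> c \<otimes> (u \<otimes> b))) = \<one>" using unit by blast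
  have car: "a \<in> carrier Q" "b \<in> carrier Q" "c \<in> carrier Q" "d \<in> carrier Q" "u \<in> carrier Q"
    "v \<in> carrier Q" "i1 \<in> carrier Q" "i2 \<in> carrier Q" "\<alpha> \<in> carrier Q" "\<beta> \<in> carrier Q"
    using ab(1,2) cd(1,2) u(1) v(1) 1(1) 2(1) \<alpha>\<beta> I(1) by auto
  have e1: "\<alpha> = i1 \<oplus> (a \<otimes> \<alpha> \<oplus> b \<otimes> \<beta>)" using 1(3) ab(3) by simp
  have e2: "\<beta> = i2 \<oplus> (c \<otimes> \<alpha> \<oplus> d \<otimes> \<beta>)" using 2(3) cd(3) by simp
  have "\<alpha> = (u \<otimes> (\<one> \<ominus> a)) \<otimes> \<alpha>" using u(2) car by simp
  also have "\<dots> = u \<otimes> (\<alpha> \<ominus> a \<otimes> \<alpha>)" using car by algebra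
  also have "\<alpha> \<ominus> a \<otimes> \<alpha> = i1 \<oplus> b \<otimes> \<beta>"
  proof -
    have "\<alpha> \<ominus> a \<otimes> \<alpha> = (i1 \<oplus> (a \<otimes> \<alpha> \<oplus> b \<otimes> \<beta>)) \<ominus> a \<otimes> \<alpha>" using e1 by simp
    also have "\<dots> = i1 \<oplus> b \<otimes> \<beta>" using car by algebra
    finally show ?thesis .
  qed
  finally have e3: "\<alpha> = u \<otimes> (i1 \<oplus> b \<otimes> \<beta>)" .
  have "\<beta> = (v \<otimes> (\<one> \<ominus> (d \<oplus> c \<otimes> (u \<otimes> b)))) \<otimes> \<beta>" using v(2) car by simp
  also have "\<dots> = v \<otimes> (\<beta> \<ominus> (d \<otimes> \<beta> \<oplus> c \<otimes> (u \<otimes> (b \<otimes> \<beta>))))" using car by algebra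
  also have "\<beta> \<ominus> (d \<otimes> \<beta> \<oplus> c \<otimes> (u \<otimes> (b \<otimes> \<beta>))) = i2 \<oplus> (c \<otimes> u) \<otimes> i1"
  proof -
    have "\<beta> \<ominus> (d \<otimes> \<beta> \<oplus> c \<otimes> (u \<otimes> (b \<otimes> \<beta>)))
      = (i2 \<oplus> (c \<otimes> (u \<otimes> (i1 \<oplus> b \<otimes> \<beta>)) \<oplus> d \<otimes> \<beta>)) \<ominus> (d \<otimes> \<beta> \<oplus> c \<otimes> (u \<otimes> (b \<otimes> \<beta>)))"
      using e2 e3 by simp
    also have "\<dots> = i2 \<oplus> (c \<otimes> u) \<otimes> i1" using car by algebra
    finally show ?thesis .
  qed
  finally have \<beta>I: "\<beta> \<in> I" using I(2,3) v(1) 1 2 cd u KE(6) M_in_K by metis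
  have \<alpha>I: "\<alpha> \<in> I" using e3 \<beta>I I(2,3) 1(1) ab u M_in_K by metis
  show "A \<subseteq> I"
  proof
    fix x assume "x \<in> A"
    then show "x \<in> I" using gen[of x] I(2,3) \<alpha>I \<beta>I by metis
  qed
qed

text \<open>If \<open>J\<close> were all of \<open>A\<close>, Nakayama's lemma with
  \<open>I = {\<zero>}\<close> would give \<open>\<one> = \<zero>\<close>, although
  \<open>\<zero>\<close> lies in \<open>M\<close> and \<open>\<one>\<close> does not.\<close>

lemma one_notin_J: "\<one> \<notin> J"
proof
  assume one: "\<one> \<in> J"
  have "A \<subseteq> {\<zero>}"
  proof (rule nakayama)
    fix a assume a: "a \<in> A"
    then have "a = \<zero> \<oplus> a \<otimes> \<one>" by auto
    then show "\<exists>i\<in>{\<zero>}. \<exists>j\<in>J. a = i \<oplus> j" using J_mult[OF a one] by blast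
  qed auto
  then have "\<one> = \<zero>" using AE(3) by blast
  then show False using M(2,3) by simp
qed

text \<open>Outside \<open>J\<close> some coordinate of \<open>n\<close> lies outside
  \<open>M\<close> and is a unit of \<open>K\<close>, so \<open>n\<close> can replace the
  corresponding generator and \<open>b\<close> is the other one.\<close>

lemma basis_extension:
  assumes "n \<in> A" "n \<notin> J"
  obtains b where "b \<in> A" "\<And>a. a \<in> A \<Longrightarrow> \<exists>r\<in>K. \<exists>s\<in>K. a = r \<otimes> n \<oplus> s \<otimes> b"
proof -
  obtain p q where pq: "p \<in> K" "q \<in> K" "n = p \<otimes> \<alpha> \<oplus> q \<otimes> \<beta>" using gen[OF assms(1)] by blast
  have swap: "\<exists>b\<in>A. \<forall>a\<in>A. \<exists>r\<in>K. \<exists>s\<in>K. a = r \<otimes> n \<oplus> s \<otimes> b"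
    if g: "\<And>a. a \<in> A \<Longrightarrow> \<exists>r\<in>K. \<exists>s\<in>K. a = r \<otimes> x \<oplus> s \<otimes> y" and xy: "x \<in> A" "y \<in> A"
      and n: "n = p \<otimes> x \<oplus> q \<otimes> y" and p: "p \<in> K" "p \<notin> M" and q: "q \<in> K" for x y p q
  proof (rule bexI[OF _ xy(2)], rule ballI)
    obtain u where u: "u \<in> K" "p \<otimes> u = \<one>" using M_unit[OF p] by blast
    fix a assume "a \<in> A"
    then obtain r s where rs: "r \<in> K" "s \<in> K" "a = r \<otimes> x \<oplus> s \<otimes> y" using g by blast
    have car: "p \<in> carrier Q" "q \<in> carrier Q" "u \<in> carrier Q" "r \<in> carrier Q" "s \<in> carrier Q"
      "x \<in> carrier Q" "y \<in> carrier Q" using p q u rs xy by auto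
    have "(r \<otimes> u) \<otimes> n \<oplus> (s \<ominus> r \<otimes> (u \<otimes> q)) \<otimes> y = r \<otimes> ((p \<otimes> u) \<otimes> x) \<oplus> s \<otimes> y"
      unfolding n using car by algebra
    then have "a = (r \<otimes> u) \<otimes> n \<oplus> (s \<ominus> r \<otimes> (u \<otimes> q)) \<otimes> y" using rs(3) u(2) car by simp
    moreover have "r \<otimes> u \<in> K" "s \<ominus> r \<otimes> (u \<otimes> q) \<in> K" using rs(1,2) u(1) q KE(6) K_diff by simp_all
    ultimately show "\<exists>r\<in>K. \<exists>s\<in>K. a = r \<otimes> n \<oplus> s \<otimes> y" by blast
  qed
  have "\<not> (p \<in> M \<and> q \<in> M)" using assms(2) pq(3) J_mem by blast
  then have "\<exists>b\<in>A. \<forall>a\<in>A. \<exists>r\<in>K. \<exists>s\<in>K. a = r \<otimes> n \<oplus> s \<otimes> b"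
  proof (cases "p \<in> M")
    case False
    show ?thesis by (rule swap[OF gen \<alpha>\<beta> pq(3,1) False pq(2)])
  next
    case True
    then have q: "q \<notin> M" using \<open>\<not> (p \<in> M \<and> q \<in> M)\<close> by blast
    have "n = q \<otimes> \<beta> \<oplus> p \<otimes> \<alpha>" using pq \<alpha>\<beta> by (simp add: a_comm)
    moreover have "\<exists>r\<in>K. \<exists>s\<in>K. a = r \<otimes> \<beta> \<oplus> s \<otimes> \<alpha>" if a: "a \<in> A" for a
    proof -
      obtain r s where "r \<in> K" "s \<in> K" "a = r \<otimes> \<alpha> \<oplus> s \<otimes> \<beta>" using gen[OF a] by blast
      moreover from this have "a = s \<otimes> \<beta> \<oplus> r \<otimes> \<alpha>" using \<alpha>\<beta> by (simp add: a_comm)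
      ultimately show ?thesis by blast
    qed
    ultimately show ?thesis using swap[OF _ \<alpha>\<beta>(2,1) _ pq(2) q pq(1)] by blast
  qed
  then show thesis using that by blast
qed

end

text \<open>The facts about the integral closure that the main argument rests on.
  \<open>frac\<close> and \<open>nonunit\<close> say that \<open>Q\<close> is a total ring of
  quotients; \<open>sep\<close> is separatedness for the powers of \<open>t\<close>;
  \<open>integ\<close> is integral closedness in the form of the module criterion;
  \<open>rad\<close> carries dimension one, with \<open>r\<close> ranging over the elements of
  \<open>K\<close> invertible in \<open>Q\<close>; \<open>E\<close> is a finite set of generators of
  \<open>J\<close> over \<open>K\<close>.\<close>

locale two_gen_extension = local_two_gen +
  fixes t :: 'a and E :: "'a set"
  assumes frac: "\<And>q. q \<in> carrier Q \<Longrightarrow> \<exists>s\<in>K \<inter> Units Q. s \<otimes> q \<in> K"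
    and nonunit: "\<And>q. q \<in> carrier Q \<Longrightarrow> q \<notin> Units Q \<Longrightarrow> \<exists>z\<in>carrier Q. z \<noteq> \<zero> \<and> z \<otimes> q = \<zero>"
    and t: "t \<in> M" "t \<in> Units Q"
    and sep: "\<And>x. x \<in> K \<Longrightarrow> (\<And>n::nat. \<exists>b\<in>K. x = t [^] n \<otimes> b) \<Longrightarrow> x = \<zero>"
    and integ: "\<And>y G u. y \<in> carrier Q \<Longrightarrow> finite G \<Longrightarrow> G \<subseteq> carrier Q \<Longrightarrow>
      (\<And>g. g \<in> G \<Longrightarrow> y \<otimes> g \<in> lin_span Q K G) \<Longrightarrow> u \<in> lin_span Q K G \<Longrightarrow> u \<in> Units Q \<Longrightarrow> y \<in> A"
    and rad: "\<And>v r. v \<in> J \<Longrightarrow> r \<in> K \<inter> Units Q \<Longrightarrow> \<exists>n::nat. \<exists>b\<in>A. v [^] n = b \<otimes> r"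
    and E: "finite E" "E \<subseteq> J" "J \<subseteq> lin_span Q K E"
begin

lemma common_denominator:
  obtains d where "d \<in> K" "d \<in> Units Q" "\<And>a. a \<in> A \<Longrightarrow> d \<otimes> a \<in> K"
proof -
  obtain s where s: "s \<in> K" "s \<in> Units Q" "s \<otimes> \<alpha> \<in> K" using frac[of \<alpha>] \<alpha>\<beta> by blast
  obtain s' where s': "s' \<in> K" "s' \<in> Units Q" "s' \<otimes> \<beta> \<in> K" using frac[of \<beta>] \<alpha>\<beta> by blast
  show thesis
  proof (rule that[of "s \<otimes> s'"])
    show "s \<otimes> s' \<in> K" "s \<otimes> s' \<in> Units Q" using s s' KE(6) by auto
    fix a assume "a \<in> A"
    then obtain p q where pq: "p \<in> K" "q \<in> K" "a = p \<otimes> \<alpha> \<oplus> q \<otimes> \<beta>" using gen by blast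
    have "p \<in> carrier Q" "q \<in> carrier Q" "s \<in> carrier Q" "s' \<in> carrier Q"
      "\<alpha> \<in> carrier Q" "\<beta> \<in> carrier Q" using pq s s' \<alpha>\<beta> by auto
    then have "s \<otimes> s' \<otimes> a = (p \<otimes> s') \<otimes> (s \<otimes> \<alpha>) \<oplus> (q \<otimes> s) \<otimes> (s' \<otimes> \<beta>)"
      unfolding pq(3) by algebra
    then show "s \<otimes> s' \<otimes> a \<in> K" using s s' pq KE(6,7) by simp
  qed
qed

text \<open>A common denominator \<open>d\<close> transports the divisibility from \<open>A\<close>
  to \<open>K\<close>, where \<open>sep\<close> applies; then \<open>d\<close> is cancelled.\<close>

lemma sepA:
  assumes "a \<in> A" "\<And>n::nat. \<exists>b\<in>A. a = t [^] n \<otimes> b"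
  shows "a = \<zero>"
proof -
  obtain d where d: "d \<in> K" "d \<in> Units Q" "\<And>a. a \<in> A \<Longrightarrow> d \<otimes> a \<in> K" using common_denominator by metis
  have tc: "t \<in> carrier Q" using t by auto
  have "d \<otimes> a = \<zero>"
  proof (rule sep[OF d(3)[OF assms(1)]])
    fix n :: nat
    obtain b where b: "b \<in> A" "a = t [^] n \<otimes> b" using assms(2) by blast
    then have "d \<otimes> a = t [^] n \<otimes> (d \<otimes> b)" using d tc m_lcomm[of d "t [^] n" b] by auto
    then show "\<exists>b\<in>K. d \<otimes> a = t [^] n \<otimes> b" using d(3)[OF b(1)] by blast
  qed
  then show ?thesis using d assms(1) Units_l_cancel[of d a \<zero>] by auto
qed

section \<open>Ideals of \<open>A\<close> above \<open>J\<close>, that is, ideals of the algebra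
  \<open>A / J\<close> over the residue field\<close>

definition ideal_of_A :: "'a set \<Rightarrow> bool" where
  "ideal_of_A T \<longleftrightarrow> T \<subseteq> A \<and> J \<subseteq> T \<and> (\<forall>u\<in>T. \<forall>v\<in>T. u \<oplus> v \<in> T) \<and> (\<forall>a\<in>A. \<forall>u\<in>T. a \<otimes> u \<in> T)"

lemma ideal_of_AD:
  assumes "ideal_of_A T"
  shows "T \<subseteq> A" "J \<subseteq> T" "\<And>u v. u \<in> T \<Longrightarrow> v \<in> T \<Longrightarrow> u \<oplus> v \<in> T"
    "\<And>a u. a \<in> A \<Longrightarrow> u \<in> T \<Longrightarrow> a \<otimes> u \<in> T" "\<And>u v. u \<in> T \<Longrightarrow> v \<in> T \<Longrightarrow> u \<ominus> v \<in> T"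
proof -
  show "T \<subseteq> A" "J \<subseteq> T" and add: "\<And>u v. u \<in> T \<Longrightarrow> v \<in> T \<Longrightarrow> u \<oplus> v \<in> T"
    and mult: "\<And>a u. a \<in> A \<Longrightarrow> u \<in> T \<Longrightarrow> a \<otimes> u \<in> T"
    using assms unfolding ideal_of_A_def by auto
  fix u v assume "u \<in> T" "v \<in> T"
  moreover have "v \<in> carrier Q" using \<open>v \<in> T\<close> \<open>T \<subseteq> A\<close> by blast
  ultimately show "u \<ominus> v \<in> T"
    using add[OF _ mult[of "\<ominus> \<one>" v]] AE(3,5) by (simp add: minus_eq l_minus)
qed

lemma proper_ideal_K:
  assumes "ideal_of_A T" "\<one> \<notin> T" "e \<in> K" "e \<in> T"
  shows "e \<in> M"
proof (rule ccontr)
  assume "e \<notin> M"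
  then obtain b where b: "b \<in> K" "e \<otimes> b = \<one>" using M_unit assms by blast
  then have "b \<otimes> e = \<one>" using m_comm[of e b] assms(3) by auto
  then show False using ideal_of_AD(4)[OF assms(1) K_in_A[OF b(1)] assms(4)] assms(2) by simp
qed

text \<open>\<open>A / J\<close> has dimension at most two over \<open>K / M\<close>, so a proper
  ideal strictly above \<open>J\<close> is a line there, spanned by \<open>u\<close>, and
  \<open>\<one>\<close> and \<open>u\<close> generate \<open>A\<close>. In
  \<open>u \<otimes> u = e \<oplus> c \<otimes> u\<close> the constant term \<open>e\<close> lies in
  \<open>T \<inter> K\<close>, hence in \<open>M\<close>; this gives the relation for
  \<open>c\<close>.\<close>

lemma proper_ideal_structure:
  assumes T: "ideal_of_A T" "\<one> \<notin> T" and u: "u \<in> T" "u \<notin> J"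
  obtains c where "\<And>a. a \<in> A \<Longrightarrow> \<exists>r\<in>K. \<exists>s\<in>K. a = r \<oplus> s \<otimes> u"
    "c \<in> K" "u \<otimes> (u \<ominus> c) \<in> J" "\<And>w. w \<in> T \<Longrightarrow> \<exists>m\<in>M. \<exists>s\<in>K. w = m \<oplus> s \<otimes> u"
proof -
  note TD = ideal_of_AD[OF T(1)]
  have uA: "u \<in> A" using u TD(1) by blast
  then have uc: "u \<in> carrier Q" by blast
  obtain b where b: "b \<in> A" "\<And>a. a \<in> A \<Longrightarrow> \<exists>r\<in>K. \<exists>s\<in>K. a = r \<otimes> u \<oplus> s \<otimes> b"
    using basis_extension[OF uA u(2)] by metis
  obtain p q where pq: "p \<in> K" "q \<in> K" "\<one> = p \<otimes> u \<oplus> q \<otimes> b" using b(2)[OF AE(3)] by blast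
  \<comment> \<open>The hypothesis \<open>\<one> \<notin> T\<close> makes the coefficient of
    \<open>b\<close> invertible, so \<open>b\<close> can be exchanged for
    \<open>\<one>\<close>.\<close>
  have "q \<notin> M"
  proof
    assume "q \<in> M"
    then have "q \<otimes> b \<in> T" using MA_in_J[OF _ b(1)] TD(2) by blast
    then have "\<one> \<in> T" using TD(3)[OF TD(4)[OF K_in_A[OF pq(1)] u(1)]] pq(3) by simp
    then show False using T(2) by simp
  qed
  then obtain v where v: "v \<in> K" "q \<otimes> v = \<one>" using M_unit[OF pq(2)] by blast
  have gen1: "\<exists>r\<in>K. \<exists>s\<in>K. a = r \<oplus> s \<otimes> u" if a: "a \<in> A" for a
  proof -
    obtain r s where rs: "r \<in> K" "s \<in> K" "a = r \<otimes> u \<oplus> s \<otimes> b" using b(2)[OF a] by blast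
    have car: "r \<in> carrier Q" "s \<in> carrier Q" "v \<in> carrier Q" "p \<in> carrier Q" "q \<in> carrier Q"
      "b \<in> carrier Q" using rs(1,2) v(1) pq(1,2) b(1) by auto
    define k where "k = r \<ominus> s \<otimes> (v \<otimes> p)"
    have k: "k \<in> K" "k \<in> carrier Q" "r = k \<oplus> s \<otimes> (v \<otimes> p)"
      using rs(1,2) v(1) pq(1) KE(6) K_diff car diff_add_cancel by (auto simp: k_def)
    have "(s \<otimes> v) \<otimes> (p \<otimes> u \<oplus> q \<otimes> b) \<oplus> k \<otimes> u = (k \<oplus> s \<otimes> (v \<otimes> p)) \<otimes> u \<oplus> s \<otimes> ((q \<otimes> v) \<otimes> b)"
      using car uc k(2) by algebra
    then have "a = s \<otimes> v \<oplus> k \<otimes> u"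
      unfolding pq(3)[symmetric] v(2) k(3)[symmetric] using rs(3) car by simp
    then show ?thesis using rs(2) v(1) k(1) KE(6) by blast
  qed
  obtain e c where ec: "e \<in> K" "c \<in> K" "u \<otimes> u = e \<oplus> c \<otimes> u" using gen1[OF AE(6)[OF uA uA]] by blast
  have car: "e \<in> carrier Q" "c \<in> carrier Q" using ec by auto
  have "u \<otimes> (u \<ominus> c) = u \<otimes> u \<ominus> c \<otimes> u" using uc car by algebra
  also have "\<dots> = e" unfolding ec(3) using uc car by algebra
  finally have e: "u \<otimes> (u \<ominus> c) = e" .
  have "u \<ominus> c \<in> A" using uA ec K_in_A AE(5,7) by (simp add: minus_eq)
  then have "(u \<ominus> c) \<otimes> u \<in> T" using TD(4) u(1) by blast
  then have "e \<in> T" using e uc car by (simp add: m_comm)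
  then have "e \<in> M" using proper_ideal_K[OF T ec(1)] by blast
  then have eJ: "u \<otimes> (u \<ominus> c) \<in> J" using e M_in_J by simp
  have str: "\<exists>m\<in>M. \<exists>s\<in>K. w = m \<oplus> s \<otimes> u" if w: "w \<in> T" for w
  proof -
    obtain r s where rs: "r \<in> K" "s \<in> K" "w = r \<oplus> s \<otimes> u" using gen1 w TD(1) by blast
    have "s \<otimes> u \<in> T" using TD(4) rs u K_in_A by blast
    then have "w \<ominus> s \<otimes> u \<in> T" using TD(5) w by blast
    moreover have "w \<ominus> s \<otimes> u = r"
    proof -
      have "r \<in> carrier Q" "s \<in> carrier Q" using rs by auto
      then show ?thesis unfolding rs(3) using uc by algebra
    qed
    ultimately show ?thesis using proper_ideal_K[OF T rs(1)] rs by auto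
  qed
  show thesis by (rule that[OF gen1 ec(2) eJ str])
qed

subsection \<open>Invertibility of the extended maximal ideal\<close>

definition tA :: "'a set" where "tA = {t \<otimes> a | a. a \<in> A}"

lemma tA_mult: "a \<in> A \<Longrightarrow> w \<in> tA \<Longrightarrow> a \<otimes> w \<in> tA"
proof -
  assume a: "a \<in> A" "w \<in> tA"
  then obtain b where b: "b \<in> A" "w = t \<otimes> b" unfolding tA_def by blast
  have "a \<otimes> w = t \<otimes> (a \<otimes> b)" unfolding b(2) using a b(1) t m_lcomm[of a t b] by auto
  then show ?thesis unfolding tA_def using AE(6) a(1) b(1) by blast
qed

lemma tA_add: "v \<in> tA \<Longrightarrow> w \<in> tA \<Longrightarrow> v \<oplus> w \<in> tA"
proof -
  assume "v \<in> tA" "w \<in> tA"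
  then obtain a b where ab: "a \<in> A" "v = t \<otimes> a" "b \<in> A" "w = t \<otimes> b" unfolding tA_def by blast
  then have "v \<oplus> w = t \<otimes> (a \<oplus> b)" using t by (simp add: r_distr)
  then show ?thesis unfolding tA_def using AE(7) ab by blast
qed

lemma tA_in_J: "w \<in> tA \<Longrightarrow> w \<in> J" unfolding tA_def using MA_in_J t by blast

lemma tA_zero: "\<zero> \<in> tA"
proof -
  have "\<zero> = t \<otimes> \<zero>" using t by auto
  then show ?thesis unfolding tA_def using AE(2) by blast
qed

lemma A_pow: "a \<in> A \<Longrightarrow> a [^] (n::nat) \<in> A"
  by (induction n) (use AE in auto)

lemma J_nilpotent_mod_t: assumes "v \<in> J" shows "\<exists>n::nat. v [^] n \<in> tA"
proof -
  obtain n :: nat and b where b: "b \<in> A" "v [^] n = b \<otimes> t"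
    using rad[OF assms, of t] t M_in_K by blast
  then have "v [^] n = t \<otimes> b" using t m_comm[of b t] by auto
  then show ?thesis unfolding tA_def using b by blast
qed

text \<open>Each \<open>g\<close> in turn is multiplied onto \<open>s\<close> as often as the
  product stays outside \<open>t A\<close>. Afterwards \<open>g\<close> kills the product, and later
  factors do not spoil this because \<open>t A\<close> is an ideal. Only finitely many elements can
  be treated in this way, which is why \<open>J\<close> has to be finitely generated.\<close>

lemma ex_killed_mod_t:
  assumes "finite G" "G \<subseteq> A" "s \<in> A" "s \<notin> tA"
    and "\<And>g. g \<in> G \<Longrightarrow> \<exists>k::nat. g [^] k \<otimes> s \<in> tA"
  shows "\<exists>a\<in>A. a \<otimes> s \<notin> tA \<and> (\<forall>g\<in>G. g \<otimes> (a \<otimes> s) \<in> tA)"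
  using assms
proof (induction G rule: finite_induct)
  case empty
  have "\<one> \<otimes> s \<notin> tA" using empty by auto
  then show ?case using AE(3) by blast
next
  case (insert g G)
  then obtain a where a: "a \<in> A" "a \<otimes> s \<notin> tA" "\<And>h. h \<in> G \<Longrightarrow> h \<otimes> (a \<otimes> s) \<in> tA" by auto
  have gA: "g \<in> A" using insert by blast
  have car: "a \<in> carrier Q" "s \<in> carrier Q" "g \<in> carrier Q" using a gA insert by auto
  obtain k0 :: nat where "g [^] k0 \<otimes> s \<in> tA" using insert by blast
  then have "a \<otimes> (g [^] k0 \<otimes> s) \<in> tA" by (rule tA_mult[OF a(1)])
  then have ex: "g [^] k0 \<otimes> (a \<otimes> s) \<in> tA" using car m_lcomm[of a "g [^] k0" s] by simp
  \<comment> \<open>The least exponent that kills \<open>a \<otimes> s\<close> modulo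
    \<open>t A\<close>; it is positive, and the power just below it is the factor that
    survives.\<close>
  define k where "k = (LEAST k::nat. g [^] k \<otimes> (a \<otimes> s) \<in> tA)"
  have k: "g [^] k \<otimes> (a \<otimes> s) \<in> tA" unfolding k_def using ex by (rule LeastI)
  have "k \<noteq> 0" using k a(2) car by (metis l_one m_closed nat_pow_0)
  then obtain l where l: "k = Suc l" using not0_implies_Suc by blast
  have l': "g [^] l \<otimes> (a \<otimes> s) \<notin> tA"
    by (rule not_less_Least[of l "\<lambda>k. g [^] k \<otimes> (a \<otimes> s) \<in> tA"]) (simp add: l k_def[symmetric])
  show ?case
  proof (intro bexI[of _ "g [^] l \<otimes> a"] conjI ballI)
    show "g [^] l \<otimes> a \<in> A" using AE(6) A_pow gA a(1) by blast
    have eq: "g [^] l \<otimes> a \<otimes> s = g [^] l \<otimes> (a \<otimes> s)" using car by (simp add: m_assoc)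
    show "g [^] l \<otimes> a \<otimes> s \<notin> tA" using l' eq by simp
    fix h assume h: "h \<in> insert g G"
    show "h \<otimes> (g [^] l \<otimes> a \<otimes> s) \<in> tA"
    proof (cases "h = g")
      case True
      have "g \<otimes> (g [^] l \<otimes> (a \<otimes> s)) = g [^] k \<otimes> (a \<otimes> s)" unfolding l using car by (simp add: m_ac)
      then show ?thesis using k True eq by simp
    next
      case False
      then have "h \<in> G" using h by blast
      then have hc: "h \<in> carrier Q" using insert(4) by blast
      have "g [^] l \<otimes> (h \<otimes> (a \<otimes> s)) \<in> tA" by (rule tA_mult[OF A_pow[OF gA] a(3)[OF \<open>h \<in> G\<close>]])
      then show ?thesis using eq car hc m_lcomm[of h "g [^] l" "a \<otimes> s"] by simp
    qed
  qed
qed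

lemma span_E_mult_mem:
  assumes "w \<in> J" "b \<in> A" "\<And>g. g \<in> E \<Longrightarrow> g \<otimes> b \<in> tA"
  shows "w \<otimes> b \<in> tA"
proof -
  have Ec: "E \<subseteq> carrier Q" using E by blast
  have "b \<otimes> w \<in> tA"
  proof (rule lin_span_mult_mem[OF KE(1) Ec _ subsetD[OF E(3) assms(1)] tA_zero tA_add])
    fix c g assume c: "c \<in> K" "g \<in> E"
    have "c \<in> carrier Q" "g \<in> carrier Q" "b \<in> carrier Q" using c assms(2) Ec by auto
    then have "b \<otimes> (c \<otimes> g) = c \<otimes> (g \<otimes> b)" by algebra
    then show "b \<otimes> (c \<otimes> g) \<in> tA" using tA_mult[OF K_in_A[OF c(1)] assms(3)[OF c(2)]] by simp
  qed (use assms in auto)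
  then show ?thesis using assms(1,2) m_comm[of b w] by auto
qed

text \<open>\<open>y = b / t\<close>, where \<open>b\<close> is nonzero in \<open>A / t A\<close>
  and annihilated by \<open>T\<close>. To get \<open>b\<close> from \<open>ex_killed_mod_t\<close>,
  some \<open>s\<close> outside \<open>t A\<close> is needed on which the generators of
  \<open>T\<close> act nilpotently modulo \<open>t A\<close>. The elements of \<open>E\<close> do so
  on every \<open>s\<close>; if \<open>T\<close> is strictly above \<open>J\<close>, one further
  generator \<open>u\<close> has to be treated.\<close>

lemma ex_socle_element:
  assumes T: "ideal_of_A T" "\<one> \<notin> T"
  obtains y where "y \<in> carrier Q" "y \<notin> A" "\<And>w. w \<in> T \<Longrightarrow> y \<otimes> w \<in> A"
proof -
  note TD = ideal_of_AD[OF T(1)]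
  have EA: "E \<subseteq> A" using E J_in_A by blast
  have tAT: "w \<in> T" if "w \<in> tA" for w using that tA_in_J TD(2) by blast
  have Epow: "\<exists>k::nat. g [^] k \<otimes> s \<in> tA" if "g \<in> E" "s \<in> A" for g s
  proof -
    have "g \<in> J" using that E by blast
    then obtain k :: nat where "g [^] k \<in> tA" using J_nilpotent_mod_t by blast
    then have "s \<otimes> g [^] k \<in> tA" using tA_mult that by blast
    moreover have "g \<in> carrier Q" using \<open>g \<in> J\<close> by blast
    ultimately show ?thesis using m_comm[of s "g [^] k"] that by auto
  qed
  have "\<exists>b\<in>A. b \<notin> tA \<and> (\<forall>w\<in>T. w \<otimes> b \<in> tA)"
  proof (cases "T \<subseteq> J")
    case True
    obtain a where a: "a \<in> A" "a \<otimes> \<one> \<notin> tA" "\<And>g. g \<in> E \<Longrightarrow> g \<otimes> (a \<otimes> \<one>) \<in> tA"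
      using ex_killed_mod_t[OF E(1) EA AE(3) _ Epow[OF _ AE(3)]] one_notin_J tA_in_J by blast
    have "a \<otimes> \<one> \<in> A" using a by auto
    then show ?thesis using a span_E_mult_mem[of _ "a \<otimes> \<one>"] True by blast
  next
    case False
    then obtain u where u: "u \<in> T" "u \<notin> J" by blast
    obtain c where c: "c \<in> K" "u \<otimes> (u \<ominus> c) \<in> J"
      and str: "\<And>w. w \<in> T \<Longrightarrow> \<exists>m\<in>M. \<exists>s\<in>K. w = m \<oplus> s \<otimes> u"
      using proper_ideal_structure[OF T u] by metis
    have uA: "u \<in> A" using u TD by blast
    have ucA: "u \<ominus> c \<in> A" using uA c K_in_A AE(5,7) by (simp add: minus_eq)
    have car: "u \<in> carrier Q" "c \<in> carrier Q" using uA c by auto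
    have "\<exists>s\<in>A. s \<notin> tA \<and> (\<exists>k::nat. u [^] k \<otimes> s \<in> tA)"
    \<comment> \<open>If \<open>c \<in> M\<close>, then \<open>u \<otimes> u\<close> is in
      \<open>J\<close> and \<open>s = \<one>\<close> works. Otherwise \<open>c\<close> is a unit,
      the factors \<open>u\<close> and \<open>u \<ominus> c\<close> are comaximal, and
      \<open>s\<close> is a power of \<open>u \<ominus> c\<close>.\<close>
    proof (cases "c \<in> M")
      case True
      have "u \<otimes> (u \<ominus> c) \<oplus> c \<otimes> u = u \<otimes> u" using car by algebra
      moreover have "u \<otimes> (u \<ominus> c) \<oplus> c \<otimes> u \<in> J" using J_add[OF c(2) MA_in_J[OF True uA]] .
      ultimately have "u [^] (2::nat) \<in> J" using car by (simp add: numeral_2_eq_2)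
      then obtain k :: nat where "(u [^] (2::nat)) [^] k \<in> tA" using J_nilpotent_mod_t by blast
      then have "u [^] (2 * k) \<otimes> \<one> \<in> tA" using car by (simp add: nat_pow_pow)
      moreover have "\<one> \<notin> tA" using tA_in_J one_notin_J by blast
      ultimately show ?thesis using AE(3) by blast
    next
      case False
      then obtain c' where c': "c' \<in> K" "c \<otimes> c' = \<one>" using M_unit[OF c(1)] by blast
      obtain k :: nat where k: "(u \<otimes> (u \<ominus> c)) [^] k \<in> tA" using J_nilpotent_mod_t[OF c(2)] by blast
      then have "u [^] k \<otimes> (u \<ominus> c) [^] k \<in> tA" using car by (simp add: nat_pow_distrib)
      \<comment> \<open>Modulo \<open>T\<close> the element \<open>u \<ominus> c\<close> is minus
        the unit \<open>c\<close>, so none of its powers falls into \<open>T\<close>, and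
        \<open>T\<close> contains \<open>t A\<close>.\<close>
      moreover have "(u \<ominus> c) [^] n \<notin> T" for n :: nat
      proof (induction n)
        case (Suc n)
        show ?case
        proof
          assume s: "(u \<ominus> c) [^] Suc n \<in> T"
          let ?p = "(u \<ominus> c) [^] n"
          have pc: "?p \<in> carrier Q" using car by simp
          have "?p \<otimes> u \<ominus> ?p \<otimes> (u \<ominus> c) \<in> T" using TD(5)[OF TD(4)[OF A_pow[OF ucA] u(1)]] s by simp
          moreover have "?p \<otimes> u \<ominus> ?p \<otimes> (u \<ominus> c) = ?p \<otimes> c"
          proof -
            { fix p assume "p \<in> carrier Q"
              then have "p \<otimes> u \<ominus> p \<otimes> (u \<ominus> c) = p \<otimes> c" using car by algebra }
            then show ?thesis using pc by blast
          qed
          ultimately have "c' \<otimes> (?p \<otimes> c) \<in> T" using TD(4)[OF K_in_A[OF c'(1)]] by simp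
          moreover have "c' \<otimes> (?p \<otimes> c) = ?p \<otimes> (c \<otimes> c')" using pc car c'(1) by (simp add: m_ac)
          ultimately show False using Suc c'(2) pc by simp
        qed
      qed (use T(2) in simp)
      ultimately show ?thesis using A_pow[OF ucA] tAT by blast
    qed
    then obtain s where s: "s \<in> A" "s \<notin> tA" "\<exists>k::nat. u [^] k \<otimes> s \<in> tA" by blast
    have fin: "finite (insert u E)" "insert u E \<subseteq> A" using E EA uA by auto
    have pow: "\<exists>k::nat. g [^] k \<otimes> s \<in> tA" if "g \<in> insert u E" for g
      using that s(3) Epow[OF _ s(1)] by blast
    obtain a where a: "a \<in> A" "a \<otimes> s \<notin> tA" "\<And>g. g \<in> insert u E \<Longrightarrow> g \<otimes> (a \<otimes> s) \<in> tA"
      using ex_killed_mod_t[OF fin s(1,2) pow] by blast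
    define b where "b = a \<otimes> s"
    have bA: "b \<in> A" using a s AE(6) by (simp add: b_def)
    have "w \<otimes> b \<in> tA" if w: "w \<in> T" for w
    proof -
      obtain m s' where ms: "m \<in> M" "s' \<in> K" "w = m \<oplus> s' \<otimes> u" using str[OF w] by blast
      have "m \<in> carrier Q" "s' \<in> carrier Q" "b \<in> carrier Q" using ms bA by auto
      then have "w \<otimes> b = m \<otimes> b \<oplus> s' \<otimes> (u \<otimes> b)" unfolding ms(3) using car by algebra
      moreover have "m \<otimes> b \<in> tA" using span_E_mult_mem[OF M_in_J[OF ms(1)] bA] a(3) b_def by auto
      moreover have "s' \<otimes> (u \<otimes> b) \<in> tA" using tA_mult[OF K_in_A[OF ms(2)]] a(3) b_def by auto
      ultimately show ?thesis using tA_add by simp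
    qed
    then show ?thesis using bA a(2) b_def by blast
  qed
  then obtain b where b: "b \<in> A" "b \<notin> tA" "\<And>w. w \<in> T \<Longrightarrow> w \<otimes> b \<in> tA" by blast
  have bc: "b \<in> carrier Q" and tc: "t \<in> carrier Q" and it: "inv t \<in> carrier Q" using b t by auto
  show thesis
  proof (rule that[of "inv t \<otimes> b"])
    show "inv t \<otimes> b \<in> carrier Q" using bc it by simp
    have "t \<otimes> (inv t \<otimes> b) = b" using bc tc it t by (simp add: m_assoc[symmetric])
    then show "inv t \<otimes> b \<notin> A" using b(2) unfolding tA_def by (metis (mono_tags, lifting) mem_Collect_eq)
    fix w assume w: "w \<in> T"
    then obtain a where a: "a \<in> A" "w \<otimes> b = t \<otimes> a" using b(3) unfolding tA_def by blast
    have wc: "w \<in> carrier Q" using w TD(1) by blast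
    have "inv t \<otimes> b \<otimes> w = inv t \<otimes> (w \<otimes> b)" using wc bc it by (simp add: m_ac)
    also have "\<dots> = a" unfolding a(2) using a(1) tc it t by (simp add: m_assoc[symmetric])
    finally show "inv t \<otimes> b \<otimes> w \<in> A" using a(1) by simp
  qed
qed

definition Jinv :: "'a set" where "Jinv = {y \<in> carrier Q. \<forall>j\<in>J. y \<otimes> j \<in> A}"

lemma JinvI: "y \<in> carrier Q \<Longrightarrow> (\<And>j. j \<in> J \<Longrightarrow> y \<otimes> j \<in> A) \<Longrightarrow> y \<in> Jinv"
  by (simp add: Jinv_def)

lemma JinvD: "y \<in> Jinv \<Longrightarrow> j \<in> J \<Longrightarrow> y \<otimes> j \<in> A"
  by (simp add: Jinv_def)

lemma Jinv_closed [simp, intro]: "y \<in> Jinv \<Longrightarrow> y \<in> carrier Q"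
  unfolding Jinv_def by blast

lemma Jinv_mult_A: assumes "a \<in> A" "y \<in> Jinv" shows "a \<otimes> y \<in> Jinv"
proof -
  have "a \<otimes> y \<otimes> j \<in> A" if "j \<in> J" for j
  proof -
    have "y \<otimes> j \<in> A" by (rule JinvD[OF assms(2) that])
    then have "a \<otimes> (y \<otimes> j) \<in> A" by (rule AE(6)[OF assms(1)])
    moreover have "a \<in> carrier Q" "y \<in> carrier Q" "j \<in> carrier Q" using assms that by auto
    ultimately show ?thesis by (simp add: m_assoc)
  qed
  then show ?thesis using A_closed[OF assms(1)] Jinv_closed[OF assms(2)] by (intro JinvI) simp_all
qed

lemma Jinv_add: assumes "x \<in> Jinv" "y \<in> Jinv" shows "x \<oplus> y \<in> Jinv"
proof -
  have "(x \<oplus> y) \<otimes> j \<in> A" if "j \<in> J" for j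
  proof -
    have "x \<otimes> j \<in> A" "y \<otimes> j \<in> A" using JinvD assms that by blast+
    then have "x \<otimes> j \<oplus> y \<otimes> j \<in> A" by (rule AE(7))
    moreover have "x \<in> carrier Q" "y \<in> carrier Q" "j \<in> carrier Q" using assms that by auto
    ultimately show ?thesis by (simp add: l_distr)
  qed
  then show ?thesis using Jinv_closed[OF assms(1)] Jinv_closed[OF assms(2)] by (intro JinvI) simp_all
qed

lemma J_invertible: "\<one> \<in> lin_span Q Jinv J"
proof (rule ccontr)
  let ?T = "lin_span Q Jinv J"
  assume one: "\<one> \<notin> ?T"
  have Jc: "J \<subseteq> carrier Q" and Jic: "Jinv \<subseteq> carrier Q" by auto
  have oneJ: "\<one> \<in> Jinv" by (rule JinvI) (simp_all add: J_in_A J_closed)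
  have z: "\<zero> \<in> ?T" by (rule lin_span.zero)
  have add: "\<And>u v. u \<in> ?T \<Longrightarrow> v \<in> ?T \<Longrightarrow> u \<oplus> v \<in> ?T" by (rule lin_span_add[OF Jic Jc])
  have stable: "y \<otimes> u \<in> ?T" if y: "y \<in> carrier Q" "\<And>z. z \<in> Jinv \<Longrightarrow> y \<otimes> z \<in> Jinv" and u: "u \<in> ?T" for y u
  proof (rule lin_span_mult_mem[OF Jic Jc y(1) u z add])
    fix c g assume c: "c \<in> Jinv" "g \<in> J"
    then have "y \<otimes> (c \<otimes> g) = (y \<otimes> c) \<otimes> g" using y(1) by (simp add: m_assoc Jinv_closed J_closed)
    then show "y \<otimes> (c \<otimes> g) \<in> ?T" using lin_span_term[OF Jic Jc y(2)[OF c(1)] c(2)] by simp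
  qed
  have JT: "J \<subseteq> ?T"
  proof
    fix j assume "j \<in> J"
    then show "j \<in> ?T" using lin_span_term[OF Jic Jc oneJ] by auto
  qed
  have "?T \<subseteq> A" by (rule lin_span_subset[OF Jic Jc AE(2) AE(7) JinvD])
  then have T: "ideal_of_A ?T"
    unfolding ideal_of_A_def using JT add stable[OF A_closed Jinv_mult_A] by auto
  obtain y where y: "y \<in> carrier Q" "y \<notin> A" "\<And>w. w \<in> ?T \<Longrightarrow> y \<otimes> w \<in> A"
    using ex_socle_element[OF T one] by metis
  \<comment> \<open>\<open>z \<otimes> j\<close> lies in \<open>?T\<close>, which \<open>y\<close>
    maps into \<open>A\<close>. So \<open>y\<close> preserves \<open>Jinv\<close>, and with it
    \<open>?T\<close>.\<close>
  have "y \<otimes> z \<in> Jinv" if z: "z \<in> Jinv" for z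
  proof -
    have "y \<otimes> z \<otimes> j \<in> A" if j: "j \<in> J" for j
    proof -
      have "y \<otimes> z \<otimes> j = y \<otimes> (z \<otimes> j)" using y z j by (simp add: m_assoc Jinv_closed J_closed)
      then show ?thesis using y(3) lin_span_term[OF Jic Jc z j] by simp
    qed
    then show ?thesis using y(1) Jinv_closed[OF z] by (intro JinvI) simp_all
  qed
  then have yT: "y \<otimes> u \<in> ?T" if "u \<in> ?T" for u using stable[OF y(1) _ that] by blast
  \<comment> \<open>The module criterion needs finitely many generators over \<open>K\<close>:
    either \<open>?T\<close> is \<open>J\<close>, spanned by \<open>E\<close>, or it is a line above
    \<open>J\<close>, spanned by \<open>E\<close> and one more element. The unit of \<open>Q\<close>
    in the module will be \<open>t\<close>.\<close>
  have "\<exists>G. finite G \<and> G \<subseteq> ?T \<and> ?T \<subseteq> lin_span Q K G"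
  proof (cases "?T \<subseteq> J")
    case True
    then show ?thesis using E JT by blast
  next
    case False
    then obtain u where u: "u \<in> ?T" "u \<notin> J" by blast
    have str: "\<And>w. w \<in> ?T \<Longrightarrow> \<exists>m\<in>M. \<exists>s\<in>K. w = m \<oplus> s \<otimes> u"
      using proper_ideal_structure[OF T one u] by metis
    let ?G = "insert u E"
    have Gc: "?G \<subseteq> carrier Q" using E u \<open>?T \<subseteq> A\<close> by blast
    have "w \<in> lin_span Q K ?G" if "w \<in> ?T" for w
    proof -
      obtain m s where ms: "m \<in> M" "s \<in> K" "w = m \<oplus> s \<otimes> u" using str[OF \<open>w \<in> ?T\<close>] by blast
      have "m \<in> lin_span Q K E" using E(3) M_in_J ms by blast
      then have "m \<in> lin_span Q K ?G" using lin_span_mono[of K K E ?G] by blast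
      moreover have "s \<otimes> u \<in> lin_span Q K ?G" by (rule lin_span_term[OF KE(1) Gc ms(2)]) simp
      ultimately show ?thesis unfolding ms(3) by (rule lin_span_add[OF KE(1) Gc])
    qed
    then show ?thesis using E u JT by (intro exI[of _ ?G]) blast
  qed
  then obtain G where G: "finite G" "G \<subseteq> ?T" "?T \<subseteq> lin_span Q K G" by blast
  have "y \<in> A"
  proof (rule integ[OF y(1) G(1) _ _ _ t(2)])
    show "G \<subseteq> carrier Q" using G(2) \<open>?T \<subseteq> A\<close> by blast
    show "\<And>g. g \<in> G \<Longrightarrow> y \<otimes> g \<in> lin_span Q K G" using yT G by blast
    show "t \<in> lin_span Q K G" using G(3) JT M_in_J t(1) by blast
  qed
  then show False using y(2) by simp
qed

section \<open>Finding a generator of \<open>J\<close> inside \<open>M\<close>\<close>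

definition mJinv_ideal :: "'a \<Rightarrow> 'a set" where "mJinv_ideal m = {m \<otimes> y \<oplus> j | y j. y \<in> Jinv \<and> j \<in> J}"

lemma mJinv_in_A: "m \<in> M \<Longrightarrow> y \<in> Jinv \<Longrightarrow> m \<otimes> y \<in> A"
  using JinvD[OF _ M_in_J] m_comm[OF M_closed Jinv_closed] by metis

lemma Jinv_zero: "\<zero> \<in> Jinv" using AE(2) by (intro JinvI) (simp_all add: J_closed)

lemma mJinv_ideal_mem: assumes "m \<in> M" "y \<in> Jinv" shows "m \<otimes> y \<in> mJinv_ideal m"
proof -
  have "m \<otimes> y = m \<otimes> y \<oplus> \<zero>" using assms by auto
  then show ?thesis unfolding mJinv_ideal_def using assms J_zero by blast
qed

lemma mJinv_ideal_ideal: assumes m: "m \<in> M" shows "ideal_of_A (mJinv_ideal m)"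
  unfolding ideal_of_A_def
proof (intro conjI ballI subsetI)
  fix w assume "w \<in> mJinv_ideal m"
  then show "w \<in> A" unfolding mJinv_ideal_def using mJinv_in_A[OF m] AE(7) J_in_A by blast
next
  fix j assume j: "j \<in> J"
  then have "j = m \<otimes> \<zero> \<oplus> j" using m by auto
  then show "j \<in> mJinv_ideal m" unfolding mJinv_ideal_def using Jinv_zero j by blast
next
  fix u v assume "u \<in> mJinv_ideal m" "v \<in> mJinv_ideal m"
  then obtain y j z i where *: "y \<in> Jinv" "j \<in> J" "u = m \<otimes> y \<oplus> j" "z \<in> Jinv" "i \<in> J" "v = m \<otimes> z \<oplus> i"
    unfolding mJinv_ideal_def by blast
  have car: "y \<in> carrier Q" "j \<in> carrier Q" "z \<in> carrier Q" "i \<in> carrier Q" "m \<in> carrier Q"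
    using * m by auto
  have "u \<oplus> v = m \<otimes> (y \<oplus> z) \<oplus> (j \<oplus> i)" unfolding *(3,6) using car by algebra
  then show "u \<oplus> v \<in> mJinv_ideal m" unfolding mJinv_ideal_def using Jinv_add J_add * by blast
next
  fix a u assume "a \<in> A" "u \<in> mJinv_ideal m"
  then obtain y j where *: "a \<in> A" "y \<in> Jinv" "j \<in> J" "u = m \<otimes> y \<oplus> j" unfolding mJinv_ideal_def by blast
  have car: "y \<in> carrier Q" "j \<in> carrier Q" "a \<in> carrier Q" "m \<in> carrier Q" using * m by auto
  have "a \<otimes> u = m \<otimes> (a \<otimes> y) \<oplus> a \<otimes> j" unfolding *(4) using car by algebra
  then show "a \<otimes> u \<in> mJinv_ideal m" unfolding mJinv_ideal_def using Jinv_mult_A J_mult * by blast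
qed

text \<open>By Nakayama's lemma already \<open>m J\<^sup>-\<^sup>1\<close> is all of
  \<open>A\<close>, so \<open>\<one> = m \<otimes> y\<close> with \<open>y\<close> in
  \<open>Jinv\<close>, and \<open>j = m \<otimes> (y \<otimes> j)\<close>.\<close>

lemma mJinv_ideal_one:
  assumes m: "m \<in> M" and one: "\<one> \<in> mJinv_ideal m" and j: "j \<in> J"
  shows "\<exists>a\<in>A. j = m \<otimes> a"
proof -
  let ?I = "{m \<otimes> y | y. y \<in> Jinv}"
  have mc: "m \<in> carrier Q" using m by auto
  have "A \<subseteq> ?I"
  proof (rule nakayama)
    show "?I \<subseteq> carrier Q" using mc by auto
    fix a assume a: "a \<in> A"
    obtain y i where yi: "y \<in> Jinv" "i \<in> J" "\<one> = m \<otimes> y \<oplus> i" using one unfolding mJinv_ideal_def by blast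
    have car: "y \<in> carrier Q" "i \<in> carrier Q" "a \<in> carrier Q" using yi a by auto
    have "a \<otimes> (m \<otimes> y \<oplus> i) = m \<otimes> (a \<otimes> y) \<oplus> a \<otimes> i" using car mc by algebra
    then have "a = m \<otimes> (a \<otimes> y) \<oplus> a \<otimes> i" using car by (simp add: yi(3)[symmetric])
    then show "\<exists>i\<in>?I. \<exists>j\<in>J. a = i \<oplus> j" using Jinv_mult_A[OF a yi(1)] J_mult[OF a yi(2)] by blast
  next
    fix u v assume "u \<in> ?I" "v \<in> ?I"
    then obtain y z where yz: "u = m \<otimes> y" "v = m \<otimes> z" "y \<in> Jinv" "z \<in> Jinv" by blast
    then have "u \<oplus> v = m \<otimes> (y \<oplus> z)" using mc by (simp add: r_distr Jinv_closed)
    then show "u \<oplus> v \<in> ?I" using Jinv_add yz by blast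
  next
    fix r u assume "r \<in> K" "u \<in> ?I"
    then obtain y where y: "r \<in> K" "u = m \<otimes> y" "y \<in> Jinv" by blast
    then have "r \<otimes> u = m \<otimes> (r \<otimes> y)" using mc m_lcomm[of r m y] by auto
    then show "r \<otimes> u \<in> ?I" using Jinv_mult_A[OF K_in_A] y by blast
  qed
  then obtain y where y: "y \<in> Jinv" "\<one> = m \<otimes> y" using AE(3) by blast
  have "j = (m \<otimes> y) \<otimes> j" unfolding y(2)[symmetric] using j by auto
  also have "\<dots> = m \<otimes> (y \<otimes> j)" using mc y j by (simp add: m_assoc Jinv_closed J_closed)
  finally show ?thesis using JinvD[OF y(1) j] by blast
qed

text \<open>\<open>J\<close> is generated by \<open>M\<close> over \<open>A\<close>, so the sets
  \<open>m J\<^sup>-\<^sup>1\<close> together generate \<open>J\<^sup>-\<^sup>1 J\<close>, which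
  contains \<open>\<one>\<close> by invertibility. Hence a proper ideal above \<open>J\<close>
  always misses some \<open>m \<otimes> y\<close>.\<close>

lemma ideal_containing_all_mJinv:
  assumes N: "ideal_of_A N" and "\<And>m y. m \<in> M \<Longrightarrow> y \<in> Jinv \<Longrightarrow> m \<otimes> y \<in> N"
  shows "\<one> \<in> N"
proof -
  note ND = ideal_of_AD[OF N]
  have Jc: "J \<subseteq> carrier Q" and Jic: "Jinv \<subseteq> carrier Q" by auto
  have "lin_span Q Jinv J \<subseteq> N"
  proof (rule lin_span_subset[OF Jic Jc])
    show "\<zero> \<in> N" using ND(2) J_zero by blast
    fix c g assume c: "c \<in> Jinv" "g \<in> J"
    then obtain r s where rs: "r \<in> M" "s \<in> M" "g = r \<otimes> \<alpha> \<oplus> s \<otimes> \<beta>" unfolding J_def by blast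
    have "r \<in> carrier Q" "s \<in> carrier Q" "c \<in> carrier Q" "\<alpha> \<in> carrier Q" "\<beta> \<in> carrier Q"
      using rs c \<alpha>\<beta> by auto
    then have "c \<otimes> g = \<alpha> \<otimes> (r \<otimes> c) \<oplus> \<beta> \<otimes> (s \<otimes> c)" unfolding rs(3) by algebra
    then show "c \<otimes> g \<in> N" using ND(3,4) \<alpha>\<beta> assms(2) rs(1,2) c(1) by simp
  qed (use ND(3) in blast)
  then show ?thesis using J_invertible by blast
qed

text \<open>Otherwise every ideal \<open>m J\<^sup>-\<^sup>1 + J\<close> is proper; then \<open>A / J\<close> has exactly two maximal ideals,
  each of them is of this form, say for \<open>m1\<close> and \<open>m2\<close>, and the ideal for \<open>m1 + m2\<close> lies in neither.\<close>

lemma J_principal: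
  obtains x where "x \<in> M" "\<And>j. j \<in> J \<Longrightarrow> \<exists>a\<in>A. j = x \<otimes> a"
proof (cases "\<exists>m\<in>M. \<one> \<in> mJinv_ideal m")
  case True
  then show thesis using that mJinv_ideal_one by blast
next
  case False
  then have proper: "\<And>m. m \<in> M \<Longrightarrow> \<one> \<notin> mJinv_ideal m" by blast
  have J_id: "ideal_of_A J" unfolding ideal_of_A_def using J_in_A J_add J_mult by blast
  \<comment> \<open>\<open>m1\<close> exists because \<open>J\<close> is proper; in the same way
    \<open>m2\<close> will exist because \<open>?K1\<close> is proper.\<close>
  obtain m1 y1 where 1: "m1 \<in> M" "y1 \<in> Jinv" "m1 \<otimes> y1 \<notin> J"
    using ideal_containing_all_mJinv[OF J_id] one_notin_J by blast
  let ?K1 = "mJinv_ideal m1"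
  note I1 = mJinv_ideal_ideal[OF 1(1)]
  note K1 = ideal_of_AD[OF I1]
  define u where "u = m1 \<otimes> y1"
  have u: "u \<in> ?K1" "u \<notin> J" using mJinv_ideal_mem[OF 1(1,2)] 1(3) by (auto simp: u_def)
  obtain c where gen1: "\<And>a. a \<in> A \<Longrightarrow> \<exists>r\<in>K. \<exists>s\<in>K. a = r \<oplus> s \<otimes> u"
    and c: "c \<in> K" "u \<otimes> (u \<ominus> c) \<in> J"
    and str1: "\<And>w. w \<in> ?K1 \<Longrightarrow> \<exists>m\<in>M. \<exists>s\<in>K. w = m \<oplus> s \<otimes> u"
    using proper_ideal_structure[OF I1 proper[OF 1(1)] u] by metis
  obtain m2 y2 where 2: "m2 \<in> M" "y2 \<in> Jinv" "m2 \<otimes> y2 \<notin> ?K1"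
    using ideal_containing_all_mJinv[OF I1] proper[OF 1(1)] by blast
  let ?K2 = "mJinv_ideal m2"
  note I2 = mJinv_ideal_ideal[OF 2(1)]
  note K2 = ideal_of_AD[OF I2]
  define v where "v = m2 \<otimes> y2"
  have v: "v \<in> ?K2" "v \<notin> J" using mJinv_ideal_mem[OF 2(1,2)] 2(3) K1(2) by (auto simp: v_def)
  have uA: "u \<in> A" and vA: "v \<in> A" using u v K1 K2 by auto
  \<comment> \<open>The complementary factor: \<open>u \<otimes> w \<in> J\<close> and
    \<open>u \<ominus> w = c\<close>. The aim is that \<open>c\<close> is a unit and that
    \<open>v\<close> is a unit multiple of \<open>w\<close> modulo \<open>J\<close>.\<close>
  define w where "w = u \<ominus> c"
  have wA: "w \<in> A" using uA c K_in_A AE(5,7) by (simp add: minus_eq w_def)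
  have uw: "u \<otimes> w \<in> J" using c(2) by (simp add: w_def)
  have car: "u \<in> carrier Q" "v \<in> carrier Q" "w \<in> carrier Q" "c \<in> carrier Q"
    using uA vA wA c by auto
  have uwc: "u = w \<oplus> c" unfolding w_def using car diff_add_cancel by simp
  obtain a b where ab: "a \<in> K" "b \<in> K" "v = a \<oplus> b \<otimes> u" using gen1[OF vA] by blast
  have abc: "a \<in> carrier Q" "b \<in> carrier Q" using ab by auto
  define e where "e = a \<oplus> b \<otimes> c"
  have eK: "e \<in> K" using ab c KE(6,7) by (simp add: e_def)
  have ec: "e \<in> carrier Q" using eK by auto
  have vw: "v = e \<oplus> b \<otimes> w"
  proof -
    have "a \<oplus> b \<otimes> (w \<oplus> c) = (a \<oplus> b \<otimes> c) \<oplus> b \<otimes> w" using abc car by algebra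
    then show ?thesis unfolding ab(3) e_def using uwc by simp
  qed
  have aM: "a \<notin> M"
  proof
    assume "a \<in> M"
    then have "a \<in> ?K1" using M_in_J K1(2) by blast
    moreover have "b \<otimes> u \<in> ?K1" using K1(4) K_in_A ab(2) u(1) by blast
    ultimately have "a \<oplus> b \<otimes> u \<in> ?K1" by (rule K1(3))
    then show False using 2(3) ab(3) by (simp add: v_def)
  qed
  \<comment> \<open>In \<open>a e + b w v = a v + b\<^sup>2 u w\<close> every term except
    \<open>a e\<close> visibly lies in \<open>?K2\<close>; so \<open>a e\<close> lies in
    \<open>?K2 \<inter> K\<close>, hence in \<open>M\<close>, and \<open>a\<close> is a unit. Thus
    \<open>v\<close> is \<open>b \<otimes> w\<close> modulo \<open>J\<close>.\<close>
  have eM: "e \<in> M"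
  proof (rule M_prime[OF ab(1) aM eK], rule proper_ideal_K[OF I2 proper[OF 2(1)]])
    show "a \<otimes> e \<in> K" using ab(1) eK KE(6) by blast
    have "a \<otimes> e \<oplus> (b \<otimes> w) \<otimes> v = a \<otimes> e \<oplus> (b \<otimes> w) \<otimes> (a \<oplus> b \<otimes> u)" using ab(3) by simp
    also have "\<dots> = a \<otimes> (e \<oplus> b \<otimes> w) \<oplus> (b \<otimes> b) \<otimes> (u \<otimes> w)" using abc car ec by algebra
    also have "\<dots> = a \<otimes> v \<oplus> (b \<otimes> b) \<otimes> (u \<otimes> w)" using vw by simp
    finally have eq: "a \<otimes> e \<oplus> (b \<otimes> w) \<otimes> v = a \<otimes> v \<oplus> (b \<otimes> b) \<otimes> (u \<otimes> w)" .
    have bwA: "b \<otimes> w \<in> A" using ab(2) wA K_in_A AE(6) by blast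
    have "a \<otimes> v \<in> ?K2" using K2(4)[OF K_in_A[OF ab(1)] v(1)] .
    moreover have "(b \<otimes> b) \<otimes> (u \<otimes> w) \<in> ?K2"
      using K2(2) J_mult[OF K_in_A[OF KE(6)[OF ab(2) ab(2)]] uw] by blast
    ultimately have "a \<otimes> v \<oplus> (b \<otimes> b) \<otimes> (u \<otimes> w) \<in> ?K2" by (rule K2(3))
    then have "(a \<otimes> e \<oplus> (b \<otimes> w) \<otimes> v) \<ominus> (b \<otimes> w) \<otimes> v \<in> ?K2" unfolding eq
      using K2(5) K2(4)[OF bwA v(1)] by blast
    moreover have "(a \<otimes> e \<oplus> (b \<otimes> w) \<otimes> v) \<ominus> (b \<otimes> w) \<otimes> v = a \<otimes> e"
      using abc car ec by (simp add: minus_eq a_assoc r_neg)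
    ultimately show "a \<otimes> e \<in> ?K2" by simp
  qed
  \<comment> \<open>As \<open>e\<close> is in \<open>M\<close> and \<open>a\<close> is not, their
    difference \<open>b \<otimes> c\<close> is a unit of \<open>K\<close>, and so are
    \<open>b\<close> and \<open>c\<close>.\<close>
  have bcM: "b \<otimes> c \<notin> M"
  proof
    assume "b \<otimes> c \<in> M"
    then have "e \<ominus> b \<otimes> c \<in> M" using eM M_diff by blast
    moreover have "e \<ominus> b \<otimes> c = a" unfolding e_def using abc car by (simp add: minus_eq a_assoc r_neg)
    ultimately show False using aM by simp
  qed
  have bM: "b \<notin> M" using bcM M_mult[of c b] c(1) abc car by (auto simp: m_comm)
  have cM: "c \<notin> M" using bcM M_mult[of b c] ab(2) by auto
  obtain b' where b': "b' \<in> K" "b \<otimes> b' = \<one>" using M_unit[OF ab(2) bM] by blast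
  obtain c' where c': "c' \<in> K" "c \<otimes> c' = \<one>" using M_unit[OF c(1) cM] by blast
  have cancel: "z \<in> N" if N: "ideal_of_A N" and q: "q \<in> K" "q' \<in> K" "q \<otimes> q' = \<one>"
    and z: "z \<in> carrier Q" "q \<otimes> z \<in> N" for N q q' z
  proof -
    have "q' \<otimes> (q \<otimes> z) \<in> N" using ideal_of_AD(4)[OF N K_in_A[OF q(2)] z(2)] .
    moreover have "q \<in> carrier Q" "q' \<in> carrier Q" using q by auto
    then have "q' \<otimes> (q \<otimes> z) = (q \<otimes> q') \<otimes> z" using z(1) by (simp add: m_ac)
    ultimately show ?thesis using q(3) z(1) by simp
  qed
  have wK1: "w \<otimes> z \<in> J" if z: "z \<in> ?K1" for z
  proof -
    obtain m s where ms: "m \<in> M" "s \<in> K" "z = m \<oplus> s \<otimes> u" using str1[OF z] by blast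
    have "m \<in> carrier Q" "s \<in> carrier Q" using ms(1,2) by auto
    then have "w \<otimes> z = m \<otimes> w \<oplus> s \<otimes> (u \<otimes> w)" unfolding ms(3) using car by algebra
    then show ?thesis using J_add[OF MA_in_J[OF ms(1) wA] J_mult[OF K_in_A[OF ms(2)] uw]] by simp
  qed
  have uv: "u \<otimes> v \<in> J"
  proof -
    have "u \<otimes> v = e \<otimes> u \<oplus> b \<otimes> (u \<otimes> w)" unfolding vw using car abc ec by algebra
    then show ?thesis using J_add[OF MA_in_J[OF eM uA] J_mult[OF K_in_A[OF ab(2)] uw]] by simp
  qed
  have uK2: "u \<otimes> z \<in> J" if z: "z \<in> ?K2" for z
  proof -
    obtain m s where ms: "m \<in> M" "s \<in> K" "z = m \<oplus> s \<otimes> v"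
      using proper_ideal_structure[OF I2 proper[OF 2(1)] v] z by metis
    have "m \<in> carrier Q" "s \<in> carrier Q" using ms(1,2) by auto
    then have "u \<otimes> z = m \<otimes> u \<oplus> s \<otimes> (u \<otimes> v)" unfolding ms(3) using car by algebra
    then show ?thesis using J_add[OF MA_in_J[OF ms(1) uA] J_mult[OF K_in_A[OF ms(2)] uv]] by simp
  qed
  define m3 where "m3 = m1 \<oplus> m2"
  have m3: "m3 \<in> M" using M_add 1(1) 2(1) by (simp add: m3_def)
  let ?K3 = "mJinv_ideal m3"
  note I3 = mJinv_ideal_ideal[OF m3]
  note K3 = ideal_of_AD[OF I3]
  have m3y: "m3 \<otimes> y = m1 \<otimes> y \<oplus> m2 \<otimes> y" if "y \<in> Jinv" for y
    unfolding m3_def using that 1(1) 2(1) by (simp add: l_distr Jinv_closed M_closed)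
  \<comment> \<open>\<open>m3 \<otimes> y1 = u \<oplus> m2 \<otimes> y1\<close>; multiplication by
    \<open>u\<close> sends the second summand into \<open>J\<close> and the first to
    \<open>c \<otimes> u\<close> modulo \<open>J\<close>.\<close>
  have "u \<in> ?K3"
  proof -
    let ?z = "m2 \<otimes> y1"
    have z: "?z \<in> ?K2" by (rule mJinv_ideal_mem[OF 2(1) 1(2)])
    have zc: "?z \<in> carrier Q" using z K2(1) by blast
    have "u \<oplus> ?z \<in> ?K3" using mJinv_ideal_mem[OF m3 1(2)] m3y[OF 1(2)] by (simp add: u_def)
    then have "u \<otimes> (u \<oplus> ?z) \<in> ?K3" by (rule K3(4)[OF uA])
    then have "u \<otimes> (u \<oplus> ?z) \<ominus> (u \<otimes> w \<oplus> u \<otimes> ?z) \<in> ?K3"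
      using K3(5) K3(2) J_add[OF uw uK2[OF z]] by blast
    moreover have "u \<otimes> (u \<oplus> ?z) \<ominus> (u \<otimes> w \<oplus> u \<otimes> ?z) = c \<otimes> u"
    proof -
      have "u \<otimes> (u \<oplus> ?z) = u \<otimes> ((w \<oplus> c) \<oplus> ?z)" using uwc by simp
      also have "\<dots> = c \<otimes> u \<oplus> (u \<otimes> w \<oplus> u \<otimes> ?z)" using car zc by algebra
      finally show ?thesis using car zc by (simp add: minus_eq a_assoc r_neg)
    qed
    ultimately show ?thesis using cancel[OF I3 c(1) c' car(1)] by simp
  qed
  \<comment> \<open>Symmetrically, \<open>m3 \<otimes> y2 = m1 \<otimes> y2 \<oplus> v\<close>;
    multiplication by \<open>w\<close> sends the first summand into \<open>J\<close> and the second
    to minus \<open>(b \<otimes> c) \<otimes> w\<close> modulo \<open>J\<close>.\<close>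
  moreover have "w \<in> ?K3"
  proof -
    let ?z = "m1 \<otimes> y2"
    have z: "?z \<in> ?K1" by (rule mJinv_ideal_mem[OF 1(1) 2(2)])
    have zc: "?z \<in> carrier Q" using z K1(1) by blast
    have "?z \<oplus> v \<in> ?K3" using mJinv_ideal_mem[OF m3 2(2)] m3y[OF 2(2)] by (simp add: v_def)
    then have "w \<otimes> (?z \<oplus> v) \<in> ?K3" by (rule K3(4)[OF wA])
    moreover define i where "i = w \<otimes> ?z \<oplus> (e \<otimes> w \<oplus> b \<otimes> (u \<otimes> w))"
    have "i \<in> J" unfolding i_def
      using J_add[OF wK1[OF z] J_add[OF MA_in_J[OF eM wA] J_mult[OF K_in_A[OF ab(2)] uw]]] .
    ultimately have "i \<ominus> w \<otimes> (?z \<oplus> v) \<in> ?K3" using K3(5) K3(2) by blast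
    moreover have "i \<ominus> w \<otimes> (?z \<oplus> v) = (b \<otimes> c) \<otimes> w"
    proof -
      have "i = w \<otimes> ?z \<oplus> (e \<otimes> w \<oplus> b \<otimes> ((w \<oplus> c) \<otimes> w))" unfolding i_def using uwc by simp
      also have "\<dots> = (b \<otimes> c) \<otimes> w \<oplus> w \<otimes> (?z \<oplus> (e \<oplus> b \<otimes> w))" using car zc abc ec by algebra
      also have "\<dots> = (b \<otimes> c) \<otimes> w \<oplus> w \<otimes> (?z \<oplus> v)" using vw by simp
      finally show ?thesis using car zc abc by (simp add: minus_eq a_assoc r_neg)
    qed
    ultimately have bcw: "b \<otimes> (c \<otimes> w) \<in> ?K3" using abc car by (simp add: m_assoc)
    have "c \<otimes> w \<in> ?K3" using cancel[OF I3 ab(2) b' _ bcw] car by simp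
    then show ?thesis using cancel[OF I3 c(1) c' car(3)] by simp
  qed
  \<comment> \<open>This difference is the unit \<open>c\<close>, which cannot lie in a proper
    ideal.\<close>
  ultimately have "u \<ominus> w \<in> ?K3" by (rule K3(5))
  moreover have "u \<ominus> w = c"
  proof -
    have "u \<ominus> w = (c \<oplus> w) \<ominus> w" using uwc car by (simp add: a_comm)
    then show ?thesis using car by (simp add: minus_eq a_assoc r_neg)
  qed
  ultimately have "c \<in> M" using proper_ideal_K[OF I3 proper[OF m3] c(1)] by simp
  then show thesis using cM by simp
qed

subsection \<open>Submodules of the extension\<close>

definition submod :: "'a set \<Rightarrow> bool" where
  "submod N \<longleftrightarrow> N \<subseteq> A \<and> \<zero> \<in> N \<and> (\<forall>u\<in>N. \<forall>v\<in>N. u \<oplus> v \<in> N) \<and> (\<forall>a\<in>K. \<forall>u\<in>N. a \<otimes> u \<in> N)"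

lemma submodD:
  assumes "submod N"
  shows "N \<subseteq> A" "\<zero> \<in> N" "\<And>u v. u \<in> N \<Longrightarrow> v \<in> N \<Longrightarrow> u \<oplus> v \<in> N"
    "\<And>a u. a \<in> K \<Longrightarrow> u \<in> N \<Longrightarrow> a \<otimes> u \<in> N" "\<And>u v. u \<in> N \<Longrightarrow> v \<in> N \<Longrightarrow> u \<ominus> v \<in> N"
proof -
  show "N \<subseteq> A" "\<zero> \<in> N" and add: "\<And>u v. u \<in> N \<Longrightarrow> v \<in> N \<Longrightarrow> u \<oplus> v \<in> N"
    and mult: "\<And>a u. a \<in> K \<Longrightarrow> u \<in> N \<Longrightarrow> a \<otimes> u \<in> N"
    using assms unfolding submod_def by auto
  fix u v assume "u \<in> N" "v \<in> N"
  moreover have "v \<in> carrier Q" using \<open>v \<in> N\<close> \<open>N \<subseteq> A\<close> by blast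
  ultimately show "u \<ominus> v \<in> N"
    using add[OF _ mult[of "\<ominus> \<one>" v]] KE(3,5) by (simp add: minus_eq l_minus)
qed

context
  fixes x
  assumes x: "x \<in> M" and xJ: "\<And>j. j \<in> J \<Longrightarrow> \<exists>a\<in>A. j = x \<otimes> a"
begin

lemma x_closed [simp, intro]: "x \<in> carrier Q" using x by (rule M_closed)

lemma x_unit [simp, intro]: "x \<in> Units Q"
proof -
  obtain a where a: "a \<in> A" "t = x \<otimes> a" using xJ M_in_J t(1) by blast
  have ac: "a \<in> carrier Q" using a by auto
  then have "x \<otimes> (a \<otimes> inv t) = t \<otimes> inv t" using t by (simp add: a(2)[symmetric] m_assoc[symmetric])
  then have r: "x \<otimes> (a \<otimes> inv t) = \<one>" using t(2) by simp
  have c: "a \<otimes> inv t \<in> carrier Q" using ac t(2) by simp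
  then have "(a \<otimes> inv t) \<otimes> x = \<one>" using r m_comm[of x "a \<otimes> inv t"] by simp
  then show ?thesis unfolding Units_def using r c x_closed by blast
qed

lemma x_pow_unit [simp, intro]: "x [^] (n::nat) \<in> Units Q"
  by (induction n) auto

lemma x_pow_K: "x [^] (n::nat) \<in> K"
  by (induction n) (use KE(3,6) M_in_K[OF x] in auto)

text \<open>By \<open>rad\<close> some power of \<open>x\<close> is a multiple of \<open>t\<close>,
  so divisibility by all powers of \<open>x\<close> implies divisibility by all powers of
  \<open>t\<close>.\<close>

lemma sep_x:
  assumes "a \<in> A" "\<And>n::nat. \<exists>b\<in>A. a = x [^] n \<otimes> b"
  shows "a = \<zero>"
proof (rule sepA[OF assms(1)])
  fix n :: nat
  obtain k :: nat and c where c: "c \<in> A" "x [^] k = c \<otimes> t"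
    using rad[OF M_in_J[OF x], of t] t M_in_K by blast
  obtain b where b: "b \<in> A" "a = x [^] (k * n) \<otimes> b" using assms(2) by blast
  have car: "c \<in> carrier Q" "b \<in> carrier Q" "t \<in> carrier Q" using c b t by auto
  have "x [^] (k * n) = (c \<otimes> t) [^] n" using c(2) by (simp add: nat_pow_pow[symmetric])
  also have "\<dots> = c [^] n \<otimes> t [^] n" using car by (simp add: nat_pow_distrib)
  finally have "a = t [^] n \<otimes> (c [^] n \<otimes> b)" using b(2) car by (simp add: m_ac)
  moreover have "c [^] n \<otimes> b \<in> A" using A_pow[OF c(1)] b(1) AE(6) by blast
  ultimately show "\<exists>b\<in>A. a = t [^] n \<otimes> b" by blast
qed

text \<open>\<open>n\<close> is the largest exponent with \<open>N \<subseteq> x\<^sup>n A\<close>;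
  it exists because \<open>z\<close> is not divisible by every power of \<open>x\<close>. As every
  element of \<open>J\<close> is divisible by \<open>x\<close>, maximality of \<open>n\<close>
  prevents the divided module from lying inside \<open>J\<close>.\<close>

lemma submod_scale:
  assumes N: "submod N" and z: "z \<in> N" "z \<noteq> \<zero>"
  obtains n :: nat and N' where "submod N'" "\<not> N' \<subseteq> J" "N = (\<lambda>b. x [^] n \<otimes> b) ` N'"
proof -
  let ?P = "\<lambda>n::nat. \<forall>w\<in>N. \<exists>b\<in>A. w = x [^] n \<otimes> b"
  have zA: "z \<in> A" using submodD(1)[OF N] z by blast
  have ex: "\<exists>n. \<not> ?P n" using sep_x[OF zA] z by blast
  define m where "m = (LEAST n. \<not> ?P n)"
  have m: "\<not> ?P m" unfolding m_def using ex by (rule LeastI_ex)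
  have P0: "?P 0"
  proof
    fix w assume "w \<in> N"
    then have "w \<in> A" using submodD(1)[OF N] by blast
    moreover from this have "w = x [^] (0::nat) \<otimes> w" by simp
    ultimately show "\<exists>b\<in>A. w = x [^] (0::nat) \<otimes> b" by blast
  qed
  then have "m \<noteq> 0" using m by metis
  then obtain n where n: "m = Suc n" using not0_implies_Suc by blast
  have Pn: "?P n" using not_less_Least[of n "\<lambda>n. \<not> ?P n"] n unfolding m_def[symmetric] by simp
  define N' where "N' = {b \<in> A. x [^] n \<otimes> b \<in> N}"
  have NN: "N = (\<lambda>b. x [^] n \<otimes> b) ` N'"
  proof (intro equalityI subsetI)
    fix w assume w: "w \<in> N"
    then obtain b where "b \<in> A" "w = x [^] n \<otimes> b" using Pn by meson
    then show "w \<in> (\<lambda>b. x [^] n \<otimes> b) ` N'" using w by (simp add: N'_def)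
  qed (auto simp: N'_def)
  have sub: "submod N'"
    unfolding submod_def
  proof (intro conjI ballI)
    show "N' \<subseteq> A" by (auto simp: N'_def)
    show "\<zero> \<in> N'" using AE(2) submodD(2)[OF N] by (simp add: N'_def)
    fix u assume u: "u \<in> N'"
    then have uc: "u \<in> carrier Q" "u \<in> A" by (auto simp: N'_def)
    { fix v assume v: "v \<in> N'"
      then have vc: "v \<in> carrier Q" "v \<in> A" by (auto simp: N'_def)
      have "x [^] n \<otimes> u \<oplus> x [^] n \<otimes> v \<in> N" using submodD(3)[OF N] u v by (simp add: N'_def)
      then show "u \<oplus> v \<in> N'" using uc vc AE(7) by (simp add: N'_def r_distr) }
    { fix a assume a: "a \<in> K"
      then have ac: "a \<in> carrier Q" by auto
      have "a \<otimes> (x [^] n \<otimes> u) \<in> N" using submodD(4)[OF N a] u by (simp add: N'_def)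
      moreover have "a \<otimes> (x [^] n \<otimes> u) = x [^] n \<otimes> (a \<otimes> u)" using ac uc by (simp add: m_lcomm)
      ultimately show "a \<otimes> u \<in> N'" using AE(6)[OF K_in_A[OF a] uc(2)] by (simp add: N'_def) }
  qed
  have "\<not> N' \<subseteq> J"
  proof
    assume NJ: "N' \<subseteq> J"
    have "?P m"
    proof
      fix w assume "w \<in> N"
      then obtain b where b: "b \<in> N'" "w = x [^] n \<otimes> b" using NN by blast
      then obtain a where a: "a \<in> A" "b = x \<otimes> a" using NJ xJ by blast
      have "w = x [^] m \<otimes> a" unfolding b(2) a(2) n using a(1) by (simp add: m_assoc A_closed)
      then show "\<exists>b\<in>A. w = x [^] m \<otimes> b" using a(1) by blast
    qed
    then show False using m by blast
  qed
  then show thesis using that sub NN by blast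
qed

text \<open>While \<open>x [^] i \<otimes> b\<close> is outside \<open>N\<close>, its coefficient
  \<open>s\<close> cannot be a unit. Hence \<open>s \<otimes> b\<close> is in \<open>J\<close>, so
  \<open>s \<otimes> b = x \<otimes> a\<close>, and expanding \<open>a\<close> in terms of
  \<open>n\<close> and \<open>b\<close> gains one more factor \<open>x\<close>.\<close>

lemma reduce_mod:
  assumes N: "submod N" and n: "n \<in> N" and b: "b \<in> A"
    and gen': "\<And>a. a \<in> A \<Longrightarrow> \<exists>r\<in>K. \<exists>s\<in>K. a = r \<otimes> n \<oplus> s \<otimes> b"
    and v: "v \<in> K" "v \<otimes> b \<in> N"
    and less: "\<And>k::nat. k < i \<Longrightarrow> x [^] k \<otimes> b \<notin> N"
  shows "\<exists>r\<in>K. \<exists>s\<in>K. v \<otimes> b = r \<otimes> n \<oplus> s \<otimes> (x [^] i \<otimes> b)"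
  using less
proof (induction i)
  case 0
  have "n \<in> A" using n submodD(1)[OF N] by blast
  then have "v \<otimes> b = \<zero> \<otimes> n \<oplus> v \<otimes> (x [^] (0::nat) \<otimes> b)" using b v(1) by auto
  then show ?case using KE(2) v(1) by blast
next
  case (Suc i)
  then obtain r s where rs: "r \<in> K" "s \<in> K" "v \<otimes> b = r \<otimes> n \<oplus> s \<otimes> (x [^] i \<otimes> b)"
    by (metis less_SucI)
  have nA: "n \<in> A" using n submodD(1)[OF N] by blast
  define X where "X = x [^] i"
  have XK: "X \<in> K" unfolding X_def by (rule x_pow_K)
  have car: "r \<in> carrier Q" "s \<in> carrier Q" "n \<in> carrier Q" "b \<in> carrier Q" "X \<in> carrier Q"
    using rs(1,2) nA b XK by auto
  have "v \<otimes> b \<ominus> r \<otimes> n = s \<otimes> (X \<otimes> b)"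
  proof -
    have "v \<otimes> b = s \<otimes> (X \<otimes> b) \<oplus> r \<otimes> n" using rs(3) car by (simp add: X_def a_comm)
    then show ?thesis using car by (simp add: minus_eq a_assoc r_neg)
  qed
  moreover have "v \<otimes> b \<ominus> r \<otimes> n \<in> N" using submodD(5)[OF N v(2) submodD(4)[OF N rs(1) n]] .
  ultimately have sX: "s \<otimes> (X \<otimes> b) \<in> N" by simp
  have "s \<in> M"
  proof (rule ccontr)
    assume "s \<notin> M"
    then obtain s' where s': "s' \<in> K" "s \<otimes> s' = \<one>" using M_unit[OF rs(2)] by blast
    have "s' \<otimes> (s \<otimes> (X \<otimes> b)) = (s \<otimes> s') \<otimes> (X \<otimes> b)" using car s'(1) by (simp add: m_ac)
    then have "X \<otimes> b \<in> N" using submodD(4)[OF N s'(1) sX] s'(2) car by simp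
    then show False using Suc(2)[of i] by (simp add: X_def)
  qed
  then obtain a where a: "a \<in> A" "s \<otimes> b = x \<otimes> a" using xJ[OF MA_in_J[OF _ b]] by blast
  obtain p q where pq: "p \<in> K" "q \<in> K" "a = p \<otimes> n \<oplus> q \<otimes> b" using gen'[OF a(1)] by blast
  have car2: "p \<in> carrier Q" "q \<in> carrier Q" "a \<in> carrier Q" using pq(1,2) a(1) by auto
  have "v \<otimes> b = r \<otimes> n \<oplus> X \<otimes> (s \<otimes> b)" using rs(3) car m_lcomm[of s X b] by (simp add: X_def)
  also have "\<dots> = r \<otimes> n \<oplus> X \<otimes> (x \<otimes> (p \<otimes> n \<oplus> q \<otimes> b))" unfolding a(2) pq(3) ..
  also have "\<dots> = (r \<oplus> (X \<otimes> x) \<otimes> p) \<otimes> n \<oplus> q \<otimes> ((X \<otimes> x) \<otimes> b)"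
    using car car2 x_closed by algebra
  finally have "v \<otimes> b = (r \<oplus> (X \<otimes> x) \<otimes> p) \<otimes> n \<oplus> q \<otimes> (x [^] Suc i \<otimes> b)" by (simp add: X_def)
  moreover have "r \<oplus> (X \<otimes> x) \<otimes> p \<in> K" using rs pq XK M_in_K[OF x] KE(6,7) by simp
  ultimately show ?case using pq(2) by blast
qed

text \<open>The annihilator of \<open>n\<close> in \<open>A\<close> is a nonzero
  \<open>K\<close>-submodule, and its elements still annihilate \<open>n\<close> after division by a
  power of the unit \<open>x\<close>. So \<open>submod_scale\<close> provides one outside
  \<open>J\<close>.\<close>

lemma zero_divisor_of_nonunit:
  assumes "n \<in> A" "n \<notin> Units Q"
  obtains z where "z \<in> A" "z \<notin> J" "z \<otimes> n = \<zero>"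
proof -
  have nc: "n \<in> carrier Q" using assms by auto
  obtain z0 where z0: "z0 \<in> carrier Q" "z0 \<noteq> \<zero>" "z0 \<otimes> n = \<zero>" using nonunit[OF nc assms(2)] by blast
  obtain s where s: "s \<in> K" "s \<in> Units Q" "s \<otimes> z0 \<in> K" using frac[OF z0(1)] by blast
  have sc: "s \<in> carrier Q" using s by auto
  have nz: "s \<otimes> z0 \<noteq> \<zero>" using z0 s(2) Units_l_cancel[of s z0 \<zero>] sc by auto
  have sub: "submod {a \<in> A. a \<otimes> n = \<zero>}"
    unfolding submod_def
  proof (intro conjI ballI)
    show "{a \<in> A. a \<otimes> n = \<zero>} \<subseteq> A" by blast
    show "\<zero> \<in> {a \<in> A. a \<otimes> n = \<zero>}" using AE(2) nc by simp
    fix u assume u: "u \<in> {a \<in> A. a \<otimes> n = \<zero>}"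
    { fix v assume v: "v \<in> {a \<in> A. a \<otimes> n = \<zero>}"
      then show "u \<oplus> v \<in> {a \<in> A. a \<otimes> n = \<zero>}" using u AE(7) nc by (simp add: l_distr A_closed) }
    { fix a assume a: "a \<in> K"
      then have "a \<otimes> u \<otimes> n = a \<otimes> (u \<otimes> n)" using u nc by (simp add: m_assoc A_closed K_closed)
      then show "a \<otimes> u \<in> {a \<in> A. a \<otimes> n = \<zero>}" using u a AE(6) K_in_A by simp }
  qed
  have mem: "s \<otimes> z0 \<in> {a \<in> A. a \<otimes> n = \<zero>}" using s z0 K_in_A sc nc by (simp add: m_assoc)
  obtain k :: nat and N' where N': "submod N'" "\<not> N' \<subseteq> J"
    "{a \<in> A. a \<otimes> n = \<zero>} = (\<lambda>b. x [^] k \<otimes> b) ` N'" by (rule submod_scale[OF sub mem nz])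
  from N'(2) obtain z where z: "z \<in> N'" "z \<notin> J" by blast
  have zA: "z \<in> A" using z submodD(1)[OF N'(1)] by blast
  then have zc: "z \<in> carrier Q" by auto
  have "x [^] k \<otimes> z \<in> {a \<in> A. a \<otimes> n = \<zero>}" using N'(3) z(1) by blast
  then have "x [^] k \<otimes> (z \<otimes> n) = \<zero>" using zc nc by (simp add: m_assoc)
  then have "z \<otimes> n = \<zero>" using Units_l_cancel[OF x_pow_unit[of k], of "z \<otimes> n" \<zero>] zc nc by simp
  then show thesis using that z(2) zA by blast
qed

lemma submod_two_gen_nonzero:
  assumes N: "submod N" and n: "n \<in> N" "n \<notin> J"
  shows "\<exists>b\<in>N. \<forall>w\<in>N. \<exists>r\<in>K. \<exists>s\<in>K. w = r \<otimes> n \<oplus> s \<otimes> b"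
proof -
  note ND = submodD[OF N]
  have nA: "n \<in> A" using n ND by blast
  obtain b where b: "b \<in> A" and g: "\<And>a. a \<in> A \<Longrightarrow> \<exists>r\<in>K. \<exists>s\<in>K. a = r \<otimes> n \<oplus> s \<otimes> b"
    using basis_extension[OF nA n(2)] by metis
  have nc: "n \<in> carrier Q" and bc: "b \<in> carrier Q" using nA b by auto
  have split: "\<exists>r\<in>K. \<exists>s\<in>K. w = r \<otimes> n \<oplus> s \<otimes> b \<and> s \<otimes> b \<in> N" if w: "w \<in> N" for w
  proof -
    obtain r s where rs: "r \<in> K" "s \<in> K" "w = r \<otimes> n \<oplus> s \<otimes> b" using g w ND(1) by blast
    have "r \<in> carrier Q" "s \<in> carrier Q" using rs(1,2) by auto
    then have "w \<ominus> r \<otimes> n = s \<otimes> b" unfolding rs(3) using nc bc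
      by (simp add: a_comm[of "r \<otimes> n"] minus_eq a_assoc r_neg)
    moreover have "w \<ominus> r \<otimes> n \<in> N" using ND(5)[OF w ND(4)[OF rs(1) n(1)]] .
    ultimately show ?thesis using rs by auto
  qed
  show ?thesis
  proof (cases "\<exists>j::nat. x [^] j \<otimes> b \<in> N")
    case True
    define j where "j = (LEAST j::nat. x [^] j \<otimes> b \<in> N)"
    have j: "x [^] j \<otimes> b \<in> N" unfolding j_def using True by (rule LeastI_ex)
    have less: "x [^] k \<otimes> b \<notin> N" if "k < j" for k
      using that unfolding j_def by (rule not_less_Least)
    show ?thesis
    proof (rule bexI[OF _ j], rule ballI)
      fix w assume "w \<in> N"
      then obtain r s where rs: "r \<in> K" "s \<in> K" "w = r \<otimes> n \<oplus> s \<otimes> b" "s \<otimes> b \<in> N" using split by blast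
      obtain r' s' where rs': "r' \<in> K" "s' \<in> K" "s \<otimes> b = r' \<otimes> n \<oplus> s' \<otimes> (x [^] j \<otimes> b)"
        using reduce_mod[OF N n(1) b g rs(2,4) less] by blast
      have "r \<in> carrier Q" "r' \<in> carrier Q" "s' \<in> carrier Q" using rs(1) rs'(1,2) by auto
      then have "w = (r \<oplus> r') \<otimes> n \<oplus> s' \<otimes> (x [^] j \<otimes> b)"
        unfolding rs(3) rs'(3) using nc bc by (simp add: l_distr a_assoc)
      then show "\<exists>r\<in>K. \<exists>s\<in>K. w = r \<otimes> n \<oplus> s \<otimes> (x [^] j \<otimes> b)" using rs(1) rs'(1,2) KE(7) by blast
    qed
  next
    case False
    \<comment> \<open>If \<open>n\<close> were a unit, \<open>rad\<close> would give
      \<open>x [^] k = a \<otimes> (d \<otimes> (d \<otimes> n))\<close>; since \<open>d\<close>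
      maps \<open>A\<close> into \<open>K\<close>, this makes \<open>x [^] k \<otimes> b\<close> a
      \<open>K\<close>-multiple of \<open>n\<close>.\<close>
    have "n \<notin> Units Q"
    proof
      assume nu: "n \<in> Units Q"
      obtain d where d: "d \<in> K" "d \<in> Units Q" "\<And>a. a \<in> A \<Longrightarrow> d \<otimes> a \<in> K" using common_denominator by metis
      have dc: "d \<in> carrier Q" using d by auto
      have "d \<otimes> (d \<otimes> n) \<in> K \<inter> Units Q" using d nu nA KE(6) by auto
      from rad[OF M_in_J[OF x] this]
      obtain k :: nat and a where a: "a \<in> A" "x [^] k = a \<otimes> (d \<otimes> (d \<otimes> n))" by blast
      have ac: "a \<in> carrier Q" using a by auto
      have "x [^] k \<otimes> b = (d \<otimes> (d \<otimes> (a \<otimes> b))) \<otimes> n" unfolding a(2) using ac bc nc dc by (simp add: m_ac)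
      moreover have "d \<otimes> (d \<otimes> (a \<otimes> b)) \<in> K" using d AE(6)[OF a(1) b] KE(6) by blast
      ultimately have "x [^] k \<otimes> b \<in> N" using ND(4)[OF _ n(1)] by simp
      then show False using False by blast
    qed
    then obtain z where z: "z \<in> A" "z \<notin> J" "z \<otimes> n = \<zero>" using zero_divisor_of_nonunit[OF nA] by metis
    have zc: "z \<in> carrier Q" using z by auto
    obtain p q where pq: "p \<in> K" "q \<in> K" "\<one> = p \<otimes> n \<oplus> q \<otimes> b" using g[OF AE(3)] by blast
    have pqc: "p \<in> carrier Q" "q \<in> carrier Q" using pq(1,2) by auto
    \<comment> \<open>Multiplying \<open>\<one> = p \<otimes> n \<oplus> q \<otimes> b\<close> by
      \<open>z\<close> leaves \<open>z = q \<otimes> (z \<otimes> b)\<close>, which is not in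
      \<open>J\<close>.\<close>
    have "q \<notin> M"
    proof
      assume "q \<in> M"
      then have "q \<otimes> (z \<otimes> b) \<in> J" using MA_in_J AE(6) z b by blast
      moreover have "q \<otimes> (z \<otimes> b) = z"
      proof -
        have "z \<otimes> (p \<otimes> n \<oplus> q \<otimes> b) = p \<otimes> (z \<otimes> n) \<oplus> q \<otimes> (z \<otimes> b)" using zc pqc nc bc by algebra
        then show ?thesis unfolding pq(3)[symmetric] z(3) using zc pqc bc by simp
      qed
      ultimately show False using z(2) by simp
    qed
    then obtain q' where q': "q' \<in> K" "q \<otimes> q' = \<one>" using M_unit[OF pq(2)] by blast
    have q'c: "q' \<in> carrier Q" using q' by auto
    have b_eq: "q' = (q' \<otimes> p) \<otimes> n \<oplus> b"
    proof -
      have "q' \<otimes> (p \<otimes> n \<oplus> q \<otimes> b) = (q' \<otimes> p) \<otimes> n \<oplus> (q \<otimes> q') \<otimes> b" using pqc q'c nc bc by algebra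
      then show ?thesis unfolding pq(3)[symmetric] q'(2) using q'c bc by simp
    qed
    obtain k l where kl: "k \<in> K" "l \<in> K" "z = k \<otimes> n \<oplus> l \<otimes> b" using g[OF z(1)] by blast
    have klc: "k \<in> carrier Q" "l \<in> carrier Q" using kl(1,2) by auto
    \<comment> \<open>With \<open>q\<close> invertible, \<open>b\<close> can be exchanged for
      \<open>\<one>\<close>: \<open>a\<close> and \<open>u\<close> are the coordinates of
      \<open>z\<close> with respect to \<open>\<one>\<close> and \<open>n\<close>. Then
      \<open>z \<otimes> n = \<zero>\<close> becomes a quadratic equation for
      \<open>n\<close>.\<close>
    define a where "a = l \<otimes> q'"
    define u where "u = k \<ominus> l \<otimes> (q' \<otimes> p)"
    have au: "a \<in> K" "u \<in> K" using kl(1,2) q'(1) pq(1) KE(6) K_diff by (simp_all add: a_def u_def)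
    have auc: "a \<in> carrier Q" "u \<in> carrier Q" using au by auto
    have z_eq: "z = a \<oplus> u \<otimes> n"
    proof -
      have k_eq: "k = u \<oplus> l \<otimes> (q' \<otimes> p)" unfolding u_def using diff_add_cancel klc q'c pqc by simp
      have "l \<otimes> ((q' \<otimes> p) \<otimes> n \<oplus> b) \<oplus> u \<otimes> n = (u \<oplus> l \<otimes> (q' \<otimes> p)) \<otimes> n \<oplus> l \<otimes> b"
        using klc q'c pqc auc nc bc by algebra
      then show ?thesis unfolding kl(3) a_def by (simp add: b_eq[symmetric] k_eq[symmetric])
    qed
    have unn: "a \<otimes> n \<oplus> u \<otimes> (n \<otimes> n) = \<zero>"
    proof -
      have "a \<otimes> n \<oplus> u \<otimes> (n \<otimes> n) = (a \<oplus> u \<otimes> n) \<otimes> n" using auc nc by algebra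
      then show ?thesis using z_eq z(3) by simp
    qed
    \<comment> \<open>If \<open>u\<close> were in \<open>M\<close>, then \<open>a\<close> would be a
      unit because \<open>z \<notin> J\<close>, and the quadratic equation would express
      \<open>n\<close> as an \<open>A\<close>-multiple of
      \<open>u \<otimes> (n \<otimes> n)\<close>, hence put it into \<open>J\<close>.\<close>
    have "u \<notin> M"
    proof
      assume uM: "u \<in> M"
      have "a \<notin> M" using z(2) J_add[OF M_in_J MA_in_J[OF uM nA]] z_eq by blast
      then obtain a' where a': "a' \<in> K" "a \<otimes> a' = \<one>" using M_unit[OF au(1)] by blast
      have a'c: "a' \<in> carrier Q" using a' by auto
      have "a' \<otimes> (a \<otimes> n \<oplus> u \<otimes> (n \<otimes> n)) = (a \<otimes> a') \<otimes> n \<oplus> a' \<otimes> (u \<otimes> (n \<otimes> n))"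
        using auc a'c nc by algebra
      then have "n \<oplus> a' \<otimes> (u \<otimes> (n \<otimes> n)) = \<zero>" unfolding unn a'(2) using a'c nc by simp
      then have "n = \<ominus> (a' \<otimes> (u \<otimes> (n \<otimes> n)))" using a'c auc nc by (intro minus_equality[symmetric]) (auto simp: a_comm)
      also have "\<dots> = (\<ominus> a') \<otimes> (u \<otimes> (n \<otimes> n))" using a'c auc nc by (simp add: l_minus)
      also have "\<dots> \<in> J" using J_mult[OF K_in_A[OF KE(5)[OF a'(1)]] MA_in_J[OF uM AE(6)[OF nA nA]]] .
      finally show False using n(2) by simp
    qed
    then obtain u' where u': "u' \<in> K" "u \<otimes> u' = \<one>" using M_unit[OF au(2)] by blast
    have u'c: "u' \<in> carrier Q" using u' by auto
    define h where "h = \<ominus> (u' \<otimes> a)"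
    have hK: "h \<in> K" using u'(1) au(1) KE(5,6) by (simp add: h_def)
    have hc: "h \<in> carrier Q" using hK by auto
    have nn: "n \<otimes> n = h \<otimes> n"
    proof -
      have "u' \<otimes> (a \<otimes> n \<oplus> u \<otimes> (n \<otimes> n)) = (u' \<otimes> a) \<otimes> n \<oplus> (u \<otimes> u') \<otimes> (n \<otimes> n)"
        using auc u'c nc by algebra
      then have "(u' \<otimes> a) \<otimes> n \<oplus> n \<otimes> n = \<zero>" unfolding unn u'(2) using u'c nc by simp
      then have "n \<otimes> n = \<ominus> ((u' \<otimes> a) \<otimes> n)"
        using u'c auc nc by (intro minus_equality[symmetric]) (auto simp: a_comm)
      then show ?thesis unfolding h_def using u'c auc nc by (simp add: l_minus)
    qed
    \<comment> \<open>Otherwise \<open>h = x \<otimes> c\<close>, and \<open>y = n / x\<close>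
      satisfies \<open>y \<otimes> y = c \<otimes> y\<close>. Multiplication by \<open>y\<close>
      then preserves the module \<open>A + A y\<close>, so \<open>y\<close> is in \<open>A\<close>
      and \<open>n = x \<otimes> y\<close> is in \<open>J\<close>.\<close>
    have "h \<notin> M"
    proof
      assume "h \<in> M"
      then obtain c where c: "c \<in> A" "h = x \<otimes> c" using xJ M_in_J by blast
      define y where "y = inv x \<otimes> n"
      have ix: "inv x \<in> carrier Q" by auto
      have cc: "c \<in> carrier Q" and yc: "y \<in> carrier Q" using c ix nc by (auto simp: y_def)
      have xy: "x \<otimes> y = n" unfolding y_def using ix nc by (simp add: m_assoc[symmetric])
      have yy: "y \<otimes> y = c \<otimes> y"
      proof -
        have "y \<otimes> y = (inv x \<otimes> inv x) \<otimes> (n \<otimes> n)" unfolding y_def using ix nc by (simp add: m_ac)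
        also have "\<dots> = (inv x \<otimes> x) \<otimes> (c \<otimes> (inv x \<otimes> n))" unfolding nn c(2) using ix nc cc x_closed by (simp add: m_ac del: Units_l_inv Units_r_inv)
        finally show ?thesis using cc yc by (simp add: y_def[symmetric])
      qed
      let ?G = "{\<alpha>, \<beta>, \<alpha> \<otimes> y, \<beta> \<otimes> y}"
      have \<alpha>\<beta>c: "\<alpha> \<in> carrier Q" "\<beta> \<in> carrier Q" using \<alpha>\<beta> by auto
      have Gc: "?G \<subseteq> carrier Q" using \<alpha>\<beta>c yc by auto
      have base: "\<And>g. g \<in> ?G \<Longrightarrow> g \<in> lin_span Q K ?G" by (rule lin_span_base[OF K Gc])
      have comb: "r \<otimes> g \<oplus> s \<otimes> g' \<in> lin_span Q K ?G" if "r \<in> K" "s \<in> K" "g \<in> ?G" "g' \<in> ?G" for r s g g'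
        by (rule lin_span_add[OF KE(1) Gc]; rule lin_span_term[OF KE(1) Gc]) (use that in auto)
      have spA: "w \<in> lin_span Q K ?G" if w: "w \<in> A" for w
      proof -
        obtain r s where "r \<in> K" "s \<in> K" "w = r \<otimes> \<alpha> \<oplus> s \<otimes> \<beta>" using gen[OF w] by blast
        then show ?thesis using comb[of r s \<alpha> \<beta>] by simp
      qed
      have spAy: "w \<otimes> y \<in> lin_span Q K ?G" if w: "w \<in> A" for w
      proof -
        obtain r s where rs: "r \<in> K" "s \<in> K" "w = r \<otimes> \<alpha> \<oplus> s \<otimes> \<beta>" using gen[OF w] by blast
        have "r \<in> carrier Q" "s \<in> carrier Q" using rs(1,2) by auto
        then have "w \<otimes> y = r \<otimes> (\<alpha> \<otimes> y) \<oplus> s \<otimes> (\<beta> \<otimes> y)" unfolding rs(3) using \<alpha>\<beta>c yc by algebra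
        then show ?thesis using comb[of r s "\<alpha> \<otimes> y" "\<beta> \<otimes> y"] rs(1,2) by simp
      qed
      have "y \<in> A"
      proof (rule integ[OF yc _ Gc _ spA[OF AE(3)] Units_one_closed])
        show "finite ?G" by simp
        have yg: "y \<otimes> (g \<otimes> y) = (c \<otimes> g) \<otimes> y" if gc: "g \<in> carrier Q" for g
        proof -
          have "y \<otimes> (g \<otimes> y) = g \<otimes> (y \<otimes> y)" using gc yc by (simp add: m_ac)
          also have "\<dots> = (c \<otimes> g) \<otimes> y" unfolding yy using gc yc cc by (simp add: m_ac)
          finally show ?thesis .
        qed
        fix g assume "g \<in> ?G"
        then consider "g = \<alpha>" | "g = \<beta>" | "g = \<alpha> \<otimes> y" | "g = \<beta> \<otimes> y" by blast
        then show "y \<otimes> g \<in> lin_span Q K ?G"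
        proof cases
          case 1
          then show ?thesis using spAy[OF \<alpha>\<beta>(1)] m_comm[OF yc \<alpha>\<beta>c(1)] by simp
        next
          case 2
          then show ?thesis using spAy[OF \<alpha>\<beta>(2)] m_comm[OF yc \<alpha>\<beta>c(2)] by simp
        next
          case 3
          then show ?thesis using spAy[OF AE(6)[OF c(1) \<alpha>\<beta>(1)]] yg[OF \<alpha>\<beta>c(1)] by simp
        next
          case 4
          then show ?thesis using spAy[OF AE(6)[OF c(1) \<alpha>\<beta>(2)]] yg[OF \<alpha>\<beta>c(2)] by simp
        qed
      qed
      then have "x \<otimes> y \<in> J" by (rule MA_in_J[OF x])
      then show False using n(2) xy by simp
    qed
    then obtain h' where h': "h' \<in> K" "h \<otimes> h' = \<one>" using M_unit[OF hK] by blast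
    have h'c: "h' \<in> carrier Q" using h' by auto
    text \<open>The idempotent \<open>f\<close> generates the ideal \<open>A n\<close>.\<close>
    define f where "f = h' \<otimes> n"
    have fA: "f \<in> A" and fc: "f \<in> carrier Q" using AE(6)[OF K_in_A[OF h'(1)] nA] by (auto simp: f_def)
    have fn: "f \<otimes> n = n"
    proof -
      have "f \<otimes> n = h' \<otimes> (n \<otimes> n)" unfolding f_def using h'c nc by (simp add: m_assoc)
      also have "\<dots> = (h \<otimes> h') \<otimes> n" unfolding nn using h'c hc nc by (simp add: m_ac)
      finally show ?thesis using h'(2) nc by simp
    qed
    \<comment> \<open>\<open>b\<close> is a \<open>K\<close>-combination of \<open>\<one>\<close>
      and \<open>n\<close>, and \<open>n \<otimes> n = h \<otimes> n\<close>; so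
      \<open>n \<otimes> b\<close> is a \<open>K\<close>-multiple of \<open>n\<close>.\<close>
    have fb: "\<exists>r\<in>K. f \<otimes> (s \<otimes> b) = r \<otimes> n" if s: "s \<in> K" for s
    proof -
      have sc: "s \<in> carrier Q" using s by auto
      have nb: "n \<otimes> b = (q' \<ominus> (q' \<otimes> p) \<otimes> h) \<otimes> n"
      proof -
        have b2: "b = q' \<ominus> (q' \<otimes> p) \<otimes> n"
        proof -
          have "q' = b \<oplus> (q' \<otimes> p) \<otimes> n" using b_eq pqc q'c nc bc by (simp add: a_comm)
          then have "q' \<ominus> (q' \<otimes> p) \<otimes> n = (b \<oplus> (q' \<otimes> p) \<otimes> n) \<ominus> (q' \<otimes> p) \<otimes> n" by simp
          then show ?thesis using pqc q'c nc bc by (simp add: minus_eq a_assoc r_neg)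
        qed
        have "n \<otimes> b = q' \<otimes> n \<ominus> (q' \<otimes> p) \<otimes> (n \<otimes> n)" unfolding b2 using pqc q'c nc by algebra
        also have "\<dots> = (q' \<ominus> (q' \<otimes> p) \<otimes> h) \<otimes> n" unfolding nn using pqc q'c nc hc by algebra
        finally show ?thesis .
      qed
      define r where "r = q' \<ominus> (q' \<otimes> p) \<otimes> h"
      have rK: "r \<in> K" using q'(1) pq(1) hK KE(6) K_diff by (simp add: r_def)
      have rc: "r \<in> carrier Q" using rK by auto
      have "f \<otimes> (s \<otimes> b) = (h' \<otimes> s) \<otimes> (n \<otimes> b)" unfolding f_def using h'c nc sc bc by (simp add: m_ac)
      also have "\<dots> = (h' \<otimes> s) \<otimes> (r \<otimes> n)" unfolding nb r_def ..
      also have "\<dots> = (h' \<otimes> s \<otimes> r) \<otimes> n" using h'c sc rc nc by (simp add: m_assoc)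
      finally show ?thesis using KE(6) h'(1) s rK by blast
    qed
    show ?thesis
    \<comment> \<open>In this case \<open>N = K n\<close>, and \<open>n\<close> itself is offered as
      the second generator.\<close>
    proof (rule bexI[OF _ n(1)], rule ballI)
      fix w assume "w \<in> N"
      then obtain r s where rs: "r \<in> K" "s \<in> K" "w = r \<otimes> n \<oplus> s \<otimes> b" "s \<otimes> b \<in> N" using split by blast
      have rsc: "r \<in> carrier Q" "s \<in> carrier Q" using rs(1,2) by auto
      \<comment> \<open>The component of \<open>s \<otimes> b\<close> complementary to
        \<open>f\<close>. No \<open>x [^] i \<otimes> b\<close> lies in \<open>N\<close>, so
        \<open>reduce_mod\<close> holds for every \<open>i\<close>; its term in \<open>n\<close> is
        removed by \<open>\<one> \<ominus> f\<close>, and what is left is divisible by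
        \<open>x [^] i\<close>.\<close>
      define m where "m = s \<otimes> b \<ominus> f \<otimes> (s \<otimes> b)"
      have sbA: "s \<otimes> b \<in> A" using AE(6) K_in_A rs(2) b by blast
      have mA: "m \<in> A" using AE(5,7) AE(6)[OF fA sbA] sbA by (simp add: m_def minus_eq)
      have "m = \<zero>"
      proof (rule sep_x[OF mA])
        fix i :: nat
        obtain r' s' where rs': "r' \<in> K" "s' \<in> K" "s \<otimes> b = r' \<otimes> n \<oplus> s' \<otimes> (x [^] i \<otimes> b)"
          using reduce_mod[OF N n(1) b g rs(2,4), of i] False by blast
        have rsc': "r' \<in> carrier Q" "s' \<in> carrier Q" using rs'(1,2) by auto
        define X where "X = x [^] i"
        have Xc: "X \<in> carrier Q" by (simp add: X_def)
        have "f \<otimes> (s \<otimes> b) = r' \<otimes> (f \<otimes> n) \<oplus> X \<otimes> (f \<otimes> (s' \<otimes> b))"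
          unfolding rs'(3) X_def[symmetric] using rsc' fc nc bc Xc by algebra
        then have fsb: "f \<otimes> (s \<otimes> b) = r' \<otimes> n \<oplus> X \<otimes> (f \<otimes> (s' \<otimes> b))" using fn by simp
        have "m = (r' \<otimes> n \<oplus> s' \<otimes> (X \<otimes> b)) \<ominus> (r' \<otimes> n \<oplus> X \<otimes> (f \<otimes> (s' \<otimes> b)))"
          unfolding m_def fsb unfolding rs'(3) X_def ..
        also have "\<dots> = X \<otimes> (s' \<otimes> b \<ominus> f \<otimes> (s' \<otimes> b))"
        proof -
          { fix c d e assume cde: "c \<in> carrier Q" "d \<in> carrier Q" "e \<in> carrier Q"
            then have "(c \<oplus> d) \<ominus> (c \<oplus> e) = d \<oplus> (c \<oplus> (\<ominus> c \<oplus> \<ominus> e))"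
              by (simp add: minus_eq minus_add a_ac)
            then have "(c \<oplus> d) \<ominus> (c \<oplus> e) = d \<ominus> e" using cde by (simp add: r_neg2 minus_eq) }
          from this[of "r' \<otimes> n" "s' \<otimes> (X \<otimes> b)" "X \<otimes> (f \<otimes> (s' \<otimes> b))"]
          have "(r' \<otimes> n \<oplus> s' \<otimes> (X \<otimes> b)) \<ominus> (r' \<otimes> n \<oplus> X \<otimes> (f \<otimes> (s' \<otimes> b)))
            = s' \<otimes> (X \<otimes> b) \<ominus> X \<otimes> (f \<otimes> (s' \<otimes> b))" using rsc' nc bc Xc fc by simp
          also have "\<dots> = X \<otimes> (s' \<otimes> b \<ominus> f \<otimes> (s' \<otimes> b))"
            using rsc' bc Xc fc m_lcomm[of s' X b] by (simp add: minus_eq r_distr r_minus)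
          finally show ?thesis .
        qed
        finally have "m = X \<otimes> (s' \<otimes> b \<ominus> f \<otimes> (s' \<otimes> b))" .
        moreover have "s' \<otimes> b \<ominus> f \<otimes> (s' \<otimes> b) \<in> A"
          using AE(5,6,7) fA K_in_A rs'(2) b by (simp add: minus_eq)
        ultimately show "\<exists>b\<in>A. m = x [^] i \<otimes> b" unfolding X_def by blast
      qed
      then have "s \<otimes> b = f \<otimes> (s \<otimes> b)" using rsc fc bc unfolding m_def by simp
      then obtain r1 where r1: "r1 \<in> K" "s \<otimes> b = r1 \<otimes> n" using fb[OF rs(2)] by auto
      have "w = r \<otimes> n \<oplus> r1 \<otimes> n" unfolding rs(3) r1(2) ..
      then show "\<exists>r\<in>K. \<exists>s\<in>K. w = r \<otimes> n \<oplus> s \<otimes> n" using rs(1) r1(1) by blast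
    qed
  qed
qed

lemma submod_two_gen:
  assumes N: "submod N"
  obtains a b where "a \<in> N" "b \<in> N" "\<And>w. w \<in> N \<Longrightarrow> \<exists>r\<in>K. \<exists>s\<in>K. w = r \<otimes> a \<oplus> s \<otimes> b"
proof (cases "N \<subseteq> {\<zero>}")
  case True
  have "\<exists>r\<in>K. \<exists>s\<in>K. w = r \<otimes> \<zero> \<oplus> s \<otimes> \<zero>" if "w \<in> N" for w
    using that True KE(3) by (intro bexI[of _ \<one>]) auto
  then show thesis using that submodD(2)[OF N] by blast
next
  case False
  then obtain z where z: "z \<in> N" "z \<noteq> \<zero>" by blast
  obtain k :: nat and N' where N': "submod N'" "\<not> N' \<subseteq> J" "N = (\<lambda>b. x [^] k \<otimes> b) ` N'"
    by (rule submod_scale[OF N z])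
  from N'(2) obtain n where n: "n \<in> N'" "n \<notin> J" by blast
  obtain b where b: "b \<in> N'" "\<And>w. w \<in> N' \<Longrightarrow> \<exists>r\<in>K. \<exists>s\<in>K. w = r \<otimes> n \<oplus> s \<otimes> b"
    using submod_two_gen_nonzero[OF N'(1) n] by blast
  have c: "n \<in> carrier Q" "b \<in> carrier Q" using n b(1) submodD(1)[OF N'(1)] by auto
  show thesis
  proof (rule that[of "x [^] k \<otimes> n" "x [^] k \<otimes> b"])
    show "x [^] k \<otimes> n \<in> N" "x [^] k \<otimes> b \<in> N" using N'(3) n b by auto
    fix w assume "w \<in> N"
    then obtain w' where w': "w' \<in> N'" "w = x [^] k \<otimes> w'" using N'(3) by blast
    obtain r s where rs: "r \<in> K" "s \<in> K" "w' = r \<otimes> n \<oplus> s \<otimes> b" using b(2)[OF w'(1)] by blast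
    have "r \<in> carrier Q" "s \<in> carrier Q" "x [^] k \<in> carrier Q" using rs(1,2) by auto
    then have "w = r \<otimes> (x [^] k \<otimes> n) \<oplus> s \<otimes> (x [^] k \<otimes> b)" unfolding w'(2) rs(3) using c by algebra
    then show "\<exists>r\<in>K. \<exists>s\<in>K. w = r \<otimes> (x [^] k \<otimes> n) \<oplus> s \<otimes> (x [^] k \<otimes> b)" using rs by blast
  qed
qed

end

end

section \<open>The total ring of quotients\<close>

context cring
begin

abbreviation "Q \<equiv> Frac_ring R"

lemma nzdD: "s \<in> nzd R \<Longrightarrow> s \<in> carrier R" "s \<in> nzd R \<Longrightarrow> x \<in> carrier R \<Longrightarrow> s \<otimes> x = \<zero> \<Longrightarrow> x = \<zero>"
  by (auto simp: nzd_def)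

lemma nzd_cancel:
  assumes "s \<in> nzd R" "x \<in> carrier R" "y \<in> carrier R" "s \<otimes> x = s \<otimes> y"
  shows "x = y"
proof -
  have sc: "s \<in> carrier R" using nzdD assms by blast
  have "s \<otimes> (x \<ominus> y) = s \<otimes> x \<ominus> s \<otimes> y" using sc assms(2,3) by algebra
  also have "\<dots> = \<zero>" using sc assms by simp
  finally have "x \<ominus> y = \<zero>" using nzdD(2)[OF assms(1)] assms(2,3) by simp
  then show ?thesis using assms(2,3) by simp
qed

lemma nzd_one: "\<one> \<in> nzd R" by (auto simp: nzd_def)

lemma nzd_mult: assumes "s \<in> nzd R" "t \<in> nzd R" shows "s \<otimes> t \<in> nzd R"
proof -
  have c: "s \<in> carrier R" "t \<in> carrier R" using nzdD assms by auto
  have "x = \<zero>" if x: "x \<in> carrier R" "s \<otimes> t \<otimes> x = \<zero>" for x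
  proof -
    have "s \<otimes> (t \<otimes> x) = \<zero>" using x c by (simp add: m_assoc)
    then have "t \<otimes> x = \<zero>" using nzdD(2)[OF assms(1)] x(1) c by simp
    then show ?thesis using nzdD(2)[OF assms(2)] x(1) by simp
  qed
  then show ?thesis using c by (simp add: nzd_def)
qed

text \<open>Transitivity cancels the middle denominator; here it matters that denominators are
  nonzerodivisors.\<close>

lemma equiv_frac_rel: "equiv (carrier R \<times> nzd R) (frac_rel R)"
proof (rule equivI)
  show "frac_rel R \<subseteq> (carrier R \<times> nzd R) \<times> (carrier R \<times> nzd R)" by (auto simp: frac_rel_def)
  show "refl_on (carrier R \<times> nzd R) (frac_rel R)" by (auto simp: frac_rel_def refl_on_def)
  show "sym (frac_rel R)" by (auto simp: frac_rel_def sym_def)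
  show "trans (frac_rel R)"
  proof (rule transI)
    fix p q r assume pq: "(p, q) \<in> frac_rel R" and qr: "(q, r) \<in> frac_rel R"
    obtain a s b t c u where eq: "p = (a, s)" "q = (b, t)" "r = (c, u)" by (metis surj_pair)
    have h: "a \<in> carrier R" "s \<in> nzd R" "b \<in> carrier R" "t \<in> nzd R" "c \<in> carrier R" "u \<in> nzd R"
      "a \<otimes> t = b \<otimes> s" "b \<otimes> u = c \<otimes> t" using pq qr by (auto simp: eq frac_rel_def)
    have n: "s \<in> carrier R" "t \<in> carrier R" "u \<in> carrier R" using h nzdD by auto
    have "t \<otimes> (a \<otimes> u) = (a \<otimes> t) \<otimes> u" using h(1) n by (simp add: m_ac)
    also have "\<dots> = (b \<otimes> u) \<otimes> s" unfolding h(7) using h(3) n by (simp add: m_ac)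
    also have "\<dots> = t \<otimes> (c \<otimes> s)" unfolding h(8) using h(5) n by (simp add: m_ac)
    finally have "a \<otimes> u = c \<otimes> s" using nzd_cancel[OF h(4)] h n by simp
    then show "(p, r) \<in> frac_rel R" using h by (simp add: eq frac_rel_def)
  qed
qed

lemma frac_eq_iff:
  assumes "a \<in> carrier R" "s \<in> nzd R" "b \<in> carrier R" "t \<in> nzd R"
  shows "frac R a s = frac R b t \<longleftrightarrow> a \<otimes> t = b \<otimes> s"
proof -
  have "frac R a s = frac R b t \<longleftrightarrow> ((a, s), (b, t)) \<in> frac_rel R"
    unfolding frac_def using assms by (intro eq_equiv_class_iff[OF equiv_frac_rel]) auto
  then show ?thesis using assms by (simp add: frac_rel_def)
qed

lemma mem_frac_iff:
  assumes "a \<in> carrier R" "s \<in> nzd R"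
  shows "(b, t) \<in> frac R a s \<longleftrightarrow> b \<in> carrier R \<and> t \<in> nzd R \<and> a \<otimes> t = b \<otimes> s"
  using assms by (auto simp: frac_def frac_rel_def)

lemma Frac_carrier: "q \<in> carrier Q \<longleftrightarrow> (\<exists>a\<in>carrier R. \<exists>s\<in>nzd R. q = frac R a s)"
  by (auto simp: Frac_ring_def quotient_def frac_def)

lemma frac_closed [simp]: "a \<in> carrier R \<Longrightarrow> s \<in> nzd R \<Longrightarrow> frac R a s \<in> carrier Q"
  using Frac_carrier by blast

lemma Frac_one: "\<one>\<^bsub>Q\<^esub> = frac R \<one> \<one>" and Frac_zero: "\<zero>\<^bsub>Q\<^esub> = frac R \<zero> \<one>"
  by (simp_all add: Frac_ring_def)

text \<open>The operations of \<open>Frac_ring\<close> are unions over all representatives. If every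
  choice gives the same class, the union over these nonempty sets is that class, so independence of
  representatives is all that remains to be checked.\<close>

lemma Frac_op:
  assumes as: "a \<in> carrier R" "s \<in> nzd R" and bt: "b \<in> carrier R" "t \<in> nzd R"
    and const: "\<And>a' s' b' t'. (a', s') \<in> frac R a s \<Longrightarrow> (b', t') \<in> frac R b t \<Longrightarrow>
      F a' s' b' t' = F a s b t"
  shows "(\<Union>(a, s) \<in> frac R a s. \<Union>(b, t) \<in> frac R b t. F a s b t) = F a s b t"
proof -
  have ne: "frac R a s \<noteq> {}" "frac R b t \<noteq> {}" using as bt mem_frac_iff by blast+
  have "(\<Union>(a, s) \<in> frac R a s. \<Union>(b, t) \<in> frac R b t. F a s b t)
    = (\<Union>p \<in> frac R a s. \<Union>q \<in> frac R b t. F a s b t)"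
    using const by (intro SUP_cong refl) (auto split: prod.splits intro!: SUP_cong)
  then show ?thesis using ne by simp
qed

lemma Frac_mult:
  assumes "a \<in> carrier R" "s \<in> nzd R" "b \<in> carrier R" "t \<in> nzd R"
  shows "frac R a s \<otimes>\<^bsub>Q\<^esub> frac R b t = frac R (a \<otimes> b) (s \<otimes> t)"
proof -
  have "(\<Union>(a, s) \<in> frac R a s. \<Union>(b, t) \<in> frac R b t. frac R (a \<otimes> b) (s \<otimes> t)) = frac R (a \<otimes> b) (s \<otimes> t)"
  proof (rule Frac_op[OF assms])
    fix a' s' b' t' assume "(a', s') \<in> frac R a s" "(b', t') \<in> frac R b t"
    then have h: "a' \<in> carrier R" "s' \<in> nzd R" "a \<otimes> s' = a' \<otimes> s" "b' \<in> carrier R" "t' \<in> nzd R"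
      "b \<otimes> t' = b' \<otimes> t" using mem_frac_iff assms by auto
    have n: "s \<in> carrier R" "t \<in> carrier R" "s' \<in> carrier R" "t' \<in> carrier R" using h assms nzdD by auto
    have "(a' \<otimes> b') \<otimes> (s \<otimes> t) = (a' \<otimes> s) \<otimes> (b' \<otimes> t)" using h(1,4) n by (simp add: m_ac)
    also have "\<dots> = (a \<otimes> b) \<otimes> (s' \<otimes> t')" unfolding h(3)[symmetric] h(6)[symmetric]
      using assms(1,3) n by (simp add: m_ac)
    finally show "frac R (a' \<otimes> b') (s' \<otimes> t') = frac R (a \<otimes> b) (s \<otimes> t)"
      using assms h by (subst frac_eq_iff) (auto intro: nzd_mult)
  qed
  then show ?thesis by (simp add: Frac_ring_def)
qed

lemma Frac_add:
  assumes "a \<in> carrier R" "s \<in> nzd R" "b \<in> carrier R" "t \<in> nzd R"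
  shows "frac R a s \<oplus>\<^bsub>Q\<^esub> frac R b t = frac R (a \<otimes> t \<oplus> b \<otimes> s) (s \<otimes> t)"
proof -
  have "(\<Union>(a, s) \<in> frac R a s. \<Union>(b, t) \<in> frac R b t. frac R (a \<otimes> t \<oplus> b \<otimes> s) (s \<otimes> t))
    = frac R (a \<otimes> t \<oplus> b \<otimes> s) (s \<otimes> t)"
  proof (rule Frac_op[OF assms])
    fix a' s' b' t' assume "(a', s') \<in> frac R a s" "(b', t') \<in> frac R b t"
    then have h: "a' \<in> carrier R" "s' \<in> nzd R" "a \<otimes> s' = a' \<otimes> s" "b' \<in> carrier R" "t' \<in> nzd R"
      "b \<otimes> t' = b' \<otimes> t" using mem_frac_iff assms by auto
    have n: "s \<in> carrier R" "t \<in> carrier R" "s' \<in> carrier R" "t' \<in> carrier R" using h assms nzdD by auto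
    have "(a' \<otimes> t' \<oplus> b' \<otimes> s') \<otimes> (s \<otimes> t) = (a' \<otimes> s) \<otimes> (t \<otimes> t') \<oplus> (b' \<otimes> t) \<otimes> (s \<otimes> s')"
      using h(1,4) n by algebra
    also have "\<dots> = (a \<otimes> t \<oplus> b \<otimes> s) \<otimes> (s' \<otimes> t')" unfolding h(3)[symmetric] h(6)[symmetric]
      using assms(1,3) n by algebra
    finally show "frac R (a' \<otimes> t' \<oplus> b' \<otimes> s') (s' \<otimes> t') = frac R (a \<otimes> t \<oplus> b \<otimes> s) (s \<otimes> t)"
      using assms h n by (subst frac_eq_iff) (auto intro: nzd_mult)
  qed
  then show ?thesis by (simp add: Frac_ring_def)
qed

lemma Frac_cring: "cring Q"
proof -
  have repr: "\<exists>a s. a \<in> carrier R \<and> s \<in> nzd R \<and> s \<in> carrier R \<and> q = frac R a s" if "q \<in> carrier Q" for q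
    using that nzdD(1) unfolding Frac_carrier by blast
  show ?thesis
  proof (rule cringI)
    show "abelian_group Q"
    proof (rule abelian_groupI)
      fix x y assume "x \<in> carrier Q" "y \<in> carrier Q"
      then obtain a s b t where h: "a \<in> carrier R" "s \<in> nzd R" "s \<in> carrier R" "x = frac R a s"
        "b \<in> carrier R" "t \<in> nzd R" "t \<in> carrier R" "y = frac R b t" using repr by meson
      show "x \<oplus>\<^bsub>Q\<^esub> y \<in> carrier Q" using h by (simp add: Frac_add nzd_mult)
      show "x \<oplus>\<^bsub>Q\<^esub> y = y \<oplus>\<^bsub>Q\<^esub> x" using h by (simp add: Frac_add a_comm m_comm)
      fix z assume "z \<in> carrier Q"
      then obtain c u where h': "c \<in> carrier R" "u \<in> nzd R" "u \<in> carrier R" "z = frac R c u"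
        using repr by meson
      have "(a \<otimes> t \<oplus> b \<otimes> s) \<otimes> u \<oplus> c \<otimes> (s \<otimes> t) = a \<otimes> (t \<otimes> u) \<oplus> (b \<otimes> u \<oplus> c \<otimes> t) \<otimes> s"
        using h(1,3,5,7) h'(1,3) by algebra
      then show "x \<oplus>\<^bsub>Q\<^esub> y \<oplus>\<^bsub>Q\<^esub> z = x \<oplus>\<^bsub>Q\<^esub> (y \<oplus>\<^bsub>Q\<^esub> z)"
        using h h' by (simp add: Frac_add nzd_mult m_assoc)
    next
      show "\<zero>\<^bsub>Q\<^esub> \<in> carrier Q" by (simp add: Frac_zero nzd_one)
    next
      fix x assume "x \<in> carrier Q"
      then obtain a s where h: "a \<in> carrier R" "s \<in> nzd R" "s \<in> carrier R" "x = frac R a s"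
        using repr by meson
      show "\<zero>\<^bsub>Q\<^esub> \<oplus>\<^bsub>Q\<^esub> x = x" using h by (simp add: Frac_zero Frac_add nzd_one)
      have "frac R (\<ominus> a) s \<oplus>\<^bsub>Q\<^esub> x = frac R (\<ominus> a \<otimes> s \<oplus> a \<otimes> s) (s \<otimes> s)"
        using h by (simp add: Frac_add)
      also have "\<dots> = \<zero>\<^bsub>Q\<^esub>" unfolding Frac_zero using h nzd_mult nzd_one
        by (subst frac_eq_iff) (auto simp: l_minus l_neg)
      finally show "\<exists>y\<in>carrier Q. y \<oplus>\<^bsub>Q\<^esub> x = \<zero>\<^bsub>Q\<^esub>"
        using h by (intro bexI[of _ "frac R (\<ominus> a) s"]) auto
    qed
    show "Group.comm_monoid Q"
    proof (rule comm_monoidI)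
      fix x y assume "x \<in> carrier Q" "y \<in> carrier Q"
      then obtain a s b t where h: "a \<in> carrier R" "s \<in> nzd R" "s \<in> carrier R" "x = frac R a s"
        "b \<in> carrier R" "t \<in> nzd R" "t \<in> carrier R" "y = frac R b t" using repr by meson
      show "x \<otimes>\<^bsub>Q\<^esub> y \<in> carrier Q" using h by (simp add: Frac_mult nzd_mult)
      show "x \<otimes>\<^bsub>Q\<^esub> y = y \<otimes>\<^bsub>Q\<^esub> x" using h by (simp add: Frac_mult m_comm)
      fix z assume "z \<in> carrier Q"
      then obtain c u where h': "c \<in> carrier R" "u \<in> nzd R" "u \<in> carrier R" "z = frac R c u"
        using repr by meson
      show "x \<otimes>\<^bsub>Q\<^esub> y \<otimes>\<^bsub>Q\<^esub> z = x \<otimes>\<^bsub>Q\<^esub> (y \<otimes>\<^bsub>Q\<^esub> z)"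
        using h h' by (simp add: Frac_mult nzd_mult m_assoc)
    next
      show "\<one>\<^bsub>Q\<^esub> \<in> carrier Q" by (simp add: Frac_one nzd_one)
    next
      fix x assume "x \<in> carrier Q"
      then obtain a s where h: "a \<in> carrier R" "s \<in> nzd R" "s \<in> carrier R" "x = frac R a s"
        using repr by meson
      show "\<one>\<^bsub>Q\<^esub> \<otimes>\<^bsub>Q\<^esub> x = x" using h by (simp add: Frac_one Frac_mult nzd_one)
    qed
    fix x y z assume "x \<in> carrier Q" "y \<in> carrier Q" "z \<in> carrier Q"
    then obtain a s b t c u where h: "a \<in> carrier R" "s \<in> nzd R" "s \<in> carrier R" "x = frac R a s"
        "b \<in> carrier R" "t \<in> nzd R" "t \<in> carrier R" "y = frac R b t"
        "c \<in> carrier R" "u \<in> nzd R" "u \<in> carrier R" "z = frac R c u" using repr by meson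
    have "((a \<otimes> t \<oplus> b \<otimes> s) \<otimes> c) \<otimes> ((s \<otimes> u) \<otimes> (t \<otimes> u))
      = (a \<otimes> c \<otimes> (t \<otimes> u) \<oplus> b \<otimes> c \<otimes> (s \<otimes> u)) \<otimes> ((s \<otimes> t) \<otimes> u)"
      using h(1,3,5,7,9,11) by algebra
    then show "(x \<oplus>\<^bsub>Q\<^esub> y) \<otimes>\<^bsub>Q\<^esub> z = x \<otimes>\<^bsub>Q\<^esub> z \<oplus>\<^bsub>Q\<^esub> y \<otimes>\<^bsub>Q\<^esub> z"
      using h by (simp add: Frac_add Frac_mult nzd_mult frac_eq_iff)
  qed
qed

section \<open>The embedding into the total ring of quotients\<close>

lemma emb_hom: "ring_hom_ring R Q (frac_emb R)"
proof (rule ring_hom_ringI)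
  show "ring R" "ring Q" using ring_axioms Frac_cring by (auto simp: cring_def)
qed (auto simp: frac_emb_def Frac_add Frac_mult Frac_one nzd_one)

lemma emb_inj:
  assumes "a \<in> carrier R" "b \<in> carrier R" "frac_emb R a = frac_emb R b"
  shows "a = b"
  using assms by (simp add: frac_emb_def frac_eq_iff nzd_one)

lemma emb_unit:
  assumes "s \<in> nzd R"
  shows "frac_emb R s \<in> Units Q"
proof -
  interpret Q: cring Q by (rule Frac_cring)
  have sc: "s \<in> carrier R" using nzdD assms by blast
  have c: "frac_emb R s \<in> carrier Q" "frac R \<one> s \<in> carrier Q"
    using sc assms nzd_one by (simp_all add: frac_emb_def)
  have "frac_emb R s \<otimes>\<^bsub>Q\<^esub> frac R \<one> s = \<one>\<^bsub>Q\<^esub>"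
    using sc assms nzd_one by (simp add: frac_emb_def Frac_mult Frac_one frac_eq_iff)
  then show ?thesis using c Q.m_comm[OF c] unfolding Units_def by auto
qed

lemma emb_unit_nzd:
  assumes "r \<in> carrier R" "frac_emb R r \<in> Units Q"
  shows "r \<in> nzd R"
proof -
  interpret Q: cring Q by (rule Frac_cring)
  interpret h: ring_hom_ring R Q "frac_emb R" by (rule emb_hom)
  have "x = \<zero>" if x: "x \<in> carrier R" "r \<otimes> x = \<zero>" for x
  proof -
    have "frac_emb R r \<otimes>\<^bsub>Q\<^esub> frac_emb R x = frac_emb R r \<otimes>\<^bsub>Q\<^esub> \<zero>\<^bsub>Q\<^esub>"
      using x assms h.hom_mult[of r x] h.hom_zero Q.r_null[OF Q.Units_closed[OF assms(2)]] by metis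
    then have "frac_emb R x = \<zero>\<^bsub>Q\<^esub>"
      using Q.Units_l_cancel[OF assms(2), of "frac_emb R x" "\<zero>\<^bsub>Q\<^esub>"]
        h.hom_closed[OF x(1)] Q.zero_closed by blast
    then have "frac_emb R x = frac_emb R \<zero>" using h.hom_zero by simp
    then show ?thesis using emb_inj x(1) by blast
  qed
  then show ?thesis using assms(1) by (simp add: nzd_def)
qed

lemma emb_clear_denominator:
  assumes "q \<in> carrier Q"
  obtains a s where "a \<in> carrier R" "s \<in> nzd R" "frac_emb R s \<otimes>\<^bsub>Q\<^esub> q = frac_emb R a"
proof -
  obtain a s where as: "a \<in> carrier R" "s \<in> nzd R" "q = frac R a s" using assms Frac_carrier by blast
  have "s \<in> carrier R" using nzdD as by blast
  then have "frac_emb R s \<otimes>\<^bsub>Q\<^esub> q = frac_emb R a"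
    using as nzd_one by (simp add: frac_emb_def Frac_mult frac_eq_iff m_comm)
  then show thesis using that as by blast
qed

text \<open>The numerator of a nonunit must be a zero divisor, for otherwise the inverted fraction
  would be an inverse; an annihilator of the numerator in \<open>R\<close> also annihilates the
  fraction.\<close>

lemma Frac_zero_divisor:
  assumes "q \<in> carrier Q" "q \<notin> Units Q"
  shows "\<exists>z\<in>carrier Q. z \<noteq> \<zero>\<^bsub>Q\<^esub> \<and> z \<otimes>\<^bsub>Q\<^esub> q = \<zero>\<^bsub>Q\<^esub>"
proof -
  interpret Q: cring Q by (rule Frac_cring)
  interpret h: ring_hom_ring R Q "frac_emb R" by (rule emb_hom)
  obtain a s where as: "a \<in> carrier R" "s \<in> nzd R" "frac_emb R s \<otimes>\<^bsub>Q\<^esub> q = frac_emb R a"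
    using emb_clear_denominator[OF assms(1)] by metis
  have su: "frac_emb R s \<in> Units Q" by (rule emb_unit[OF as(2)])
  have sc: "frac_emb R s \<in> carrier Q" using su by auto
  have q: "q = inv\<^bsub>Q\<^esub> (frac_emb R s) \<otimes>\<^bsub>Q\<^esub> frac_emb R a"
    unfolding as(3)[symmetric] using su assms(1) sc by (simp add: Q.m_assoc[symmetric])
  have "a \<notin> nzd R"
  proof
    assume "a \<in> nzd R"
    then have "q \<in> Units Q" unfolding q using su emb_unit by (intro Q.Units_m_closed) auto
    then show False using assms(2) by simp
  qed
  then obtain x where x: "x \<in> carrier R" "a \<otimes> x = \<zero>" "x \<noteq> \<zero>" using as(1) by (auto simp: nzd_def)
  have ax: "frac_emb R a \<otimes>\<^bsub>Q\<^esub> frac_emb R x = \<zero>\<^bsub>Q\<^esub>"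
    using x as(1) by (metis h.hom_mult h.hom_zero)
  have "frac_emb R x \<noteq> \<zero>\<^bsub>Q\<^esub>" using emb_inj[OF x(1) zero_closed] x(3) h.hom_zero by metis
  moreover have "frac_emb R x \<otimes>\<^bsub>Q\<^esub> q = inv\<^bsub>Q\<^esub> (frac_emb R s) \<otimes>\<^bsub>Q\<^esub> (frac_emb R a \<otimes>\<^bsub>Q\<^esub> frac_emb R x)"
    unfolding q using su sc x(1) as(1) by (simp add: Q.m_ac)
  ultimately show ?thesis using x(1) su ax by (intro bexI[of _ "frac_emb R x"]) auto
qed

end

section \<open>The integral closure of a one-dimensional local ring\<close>

context cring
begin

lemma lin_span_finsum:
  assumes "finite S" "S \<subseteq> carrier R" "C \<subseteq> carrier R" "\<And>y. y \<in> S \<Longrightarrow> c y \<in> C"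
  shows "(\<Oplus>y\<in>S. c y \<otimes> y) \<in> lin_span R C S"
  using assms
proof (induction S rule: finite_induct)
  case empty
  then show ?case by (simp add: lin_span.zero)
next
  case (insert y S)
  have "(\<Oplus>y\<in>insert y S. c y \<otimes> y) = c y \<otimes> y \<oplus> (\<Oplus>y\<in>S. c y \<otimes> y)"
    using insert by (intro add.finprod_insert) blast+
  moreover have "(\<Oplus>y\<in>S. c y \<otimes> y) \<in> lin_span R C (insert y S)"
    using insert lin_span_mono[of C C S "insert y S"] by blast
  moreover have "c y \<in> C" using insert(6) by blast
  ultimately show ?case using lin_span.step[OF _ insertI1, where c = "c y" and C = C and Q = R] by simp
qed

lemma lin_span_pair:
  assumes K: "subring K R" and "g \<in> carrier R" "h \<in> carrier R" "s \<in> lin_span R K {g, h}"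
  obtains c d where "c \<in> K" "d \<in> K" "s = c \<otimes> g \<oplus> d \<otimes> h"
proof -
  note KE = subringE[OF K]
  have gh: "insert g {h} \<subseteq> carrier R" "insert h {} \<subseteq> carrier R" using assms by auto
  obtain c t where c: "c \<in> K" "t \<in> lin_span R K {h}" "s = c \<otimes> g \<oplus> t"
    by (rule lin_span_insertE[OF KE(1) gh(1) KE(2,7) assms(4)])
  obtain d r where d: "d \<in> K" "r \<in> lin_span R K {}" "t = d \<otimes> h \<oplus> r"
    by (rule lin_span_insertE[OF KE(1) gh(2) KE(2,7) c(2)])
  have "r = \<zero>" using d(2) by cases auto
  moreover have "d \<in> carrier R" using d(1) KE(1) by blast
  ultimately have "t = d \<otimes> h" using d(3) assms(3) by simp
  then show thesis using that c(1,3) d(1) by blast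
qed

end

text \<open>\<open>z\<close> is the filler for empty \<open>S\<close>; the element of a singleton is
  repeated.\<close>

lemma subset_pair:
  assumes "finite S" "card S \<le> 2" "S \<subseteq> A" "z \<in> A"
  obtains g h where "g \<in> A" "h \<in> A" "S \<subseteq> {g, h}"
proof -
  consider "card S = 0" | "card S = 1" | "card S = 2" using assms(2) by linarith
  then show thesis
  proof cases
    case 1
    then show ?thesis using that[of z z] assms by simp
  next
    case 2
    then obtain g where "S = {g}" by (auto simp: card_1_singleton_iff)
    then show ?thesis using that[of g g] assms by simp
  next
    case 3
    then obtain g h where "S = {g, h}" by (auto simp: card_2_iff)
    then show ?thesis using that[of g h] assms by simp
  qed
qed

locale dim_one_local = cring R for R (structure) +
  fixes M
  assumes loc: "local_ring R" and dim: "krull_dim_one R" and max: "maximalideal M R"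
    and regular: "M \<inter> nzd R \<noteq> {}"
begin

abbreviation "\<iota> \<equiv> frac_emb R"
abbreviation "K \<equiv> \<iota> ` carrier R"
abbreviation "A \<equiv> int_closure R"
abbreviation "MK \<equiv> \<iota> ` M"

sublocale Q: cring Q by (rule Frac_cring)
sublocale h: ring_hom_ring R Q \<iota> by (rule emb_hom)

lemma M_ideal: "ideal M R" using max by (rule maximalideal.axioms(1))

lemma pow_ideal: "ideal (ideal_pow R M i) R"
  by (induction i) (auto simp: oneideal intro: ideal_prod_is_ideal[OF M_ideal])

lemma M_carrier: "M \<subseteq> carrier R" by (rule idealE(1)[OF M_ideal])

lemma one_notin_M: "\<one> \<notin> M"
  using ideal.one_imp_carrier[OF M_ideal] maximalideal.I_notcarr[OF max] by metis

lemma K_subring: "subring K Q" by (rule h.img_is_subring[OF carrier_is_subring])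

lemma A_eq: "A = integral_elems Q K"
proof (intro equalityI subsetI)
  fix x assume "x \<in> A"
  then obtain n :: nat and c where x: "x \<in> carrier Q" and c: "\<And>i. i < n \<Longrightarrow> c i \<in> carrier R"
    and eq: "x [^]\<^bsub>Q\<^esub> n \<oplus>\<^bsub>Q\<^esub> finsum Q (\<lambda>i. \<iota> (c i) \<otimes>\<^bsub>Q\<^esub> x [^]\<^bsub>Q\<^esub> i) {..<n} = \<zero>\<^bsub>Q\<^esub>"
    unfolding int_closure_def by blast
  have "\<forall>i<n. \<iota> (c i) \<in> K" using c by blast
  then show "x \<in> integral_elems Q K" unfolding integral_elems_def using x eq
    by (intro CollectI conjI exI[of _ n] exI[of _ "\<lambda>i. \<iota> (c i)"])
next
  fix x assume "x \<in> integral_elems Q K"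
  then obtain n :: nat and c where x: "x \<in> carrier Q" and c: "\<And>i. i < n \<Longrightarrow> c i \<in> K"
    and eq: "x [^]\<^bsub>Q\<^esub> n \<oplus>\<^bsub>Q\<^esub> finsum Q (\<lambda>i. c i \<otimes>\<^bsub>Q\<^esub> x [^]\<^bsub>Q\<^esub> i) {..<n} = \<zero>\<^bsub>Q\<^esub>"
    unfolding integral_elems_def by blast
  have "\<forall>i. \<exists>d. i < n \<longrightarrow> d \<in> carrier R \<and> c i = \<iota> d" using c by blast
  then obtain d where d: "\<And>i. i < n \<Longrightarrow> d i \<in> carrier R \<and> c i = \<iota> (d i)" by metis
  have "finsum Q (\<lambda>i. c i \<otimes>\<^bsub>Q\<^esub> x [^]\<^bsub>Q\<^esub> i) {..<n}
    = finsum Q (\<lambda>i. \<iota> (d i) \<otimes>\<^bsub>Q\<^esub> x [^]\<^bsub>Q\<^esub> i) {..<n}"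
    using d x by (intro Q.add.finprod_cong') auto
  then show "x \<in> A" unfolding int_closure_def using x eq d
    by (intro CollectI conjI exI[of _ n] exI[of _ d]) auto
qed

lemma A_subring: "subring A Q" and K_sub_A: "K \<subseteq> A"
  unfolding A_eq by (rule Q.subring_integral_elems[OF K_subring])+

lemma A_cring: "cring (int_closure_ring R)"
  unfolding int_closure_ring_def
  using Q.subcring_iff[OF subringE(1)[OF A_subring]] Q.subcringI'[OF A_subring] by blast

lemma int_closure_ring_simps [simp]:
  "carrier (int_closure_ring R) = A" "mult (int_closure_ring R) = mult Q"
  "add (int_closure_ring R) = add Q" "zero (int_closure_ring R) = zero Q"
  "one (int_closure_ring R) = one Q"
  by (simp_all add: int_closure_ring_def)

lemma pow_int_closure_ring: "x [^]\<^bsub>int_closure_ring R\<^esub> (n::nat) = x [^]\<^bsub>Q\<^esub> n"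
  unfolding int_closure_ring_def by (rule Q.nat_pow_consistent[symmetric])

lemma generated_in_lin_span:
  assumes "generates_int_closure R S"
  shows "finite S" "S \<subseteq> A" "A \<subseteq> lin_span Q K S"
proof -
  show fin: "finite S" and sub: "S \<subseteq> A" using assms by (simp_all add: generates_int_closure_def)
  have Sc: "S \<subseteq> carrier Q" using sub subringE(1)[OF A_subring] by blast
  show "A \<subseteq> lin_span Q K S"
  proof
    fix x assume x: "x \<in> A"
    have "\<forall>x\<in>A. \<exists>f. (\<forall>y\<in>S. f y \<in> carrier R) \<and> x = finsum Q (\<lambda>y. \<iota> (f y) \<otimes>\<^bsub>Q\<^esub> y) S"
      using assms unfolding generates_int_closure_def by (elim conjE)
    from bspec[OF this x] obtain f where f: "\<forall>y\<in>S. f y \<in> carrier R"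
      "x = finsum Q (\<lambda>y. \<iota> (f y) \<otimes>\<^bsub>Q\<^esub> y) S" by (elim exE conjE)
    show "x \<in> lin_span Q K S" unfolding f(2)
      by (rule Q.lin_span_finsum[OF fin Sc subringE(1)[OF K_subring]]) (use f(1) in blast)
  qed
qed

lemma two_gen_pair:
  assumes "int_closure_two_gen R"
  obtains \<alpha> \<beta> where "\<alpha> \<in> A" "\<beta> \<in> A"
    "\<And>a. a \<in> A \<Longrightarrow> \<exists>r\<in>K. \<exists>s\<in>K. a = r \<otimes>\<^bsub>Q\<^esub> \<alpha> \<oplus>\<^bsub>Q\<^esub> s \<otimes>\<^bsub>Q\<^esub> \<beta>"
proof -
  obtain S where S: "generates_int_closure R S" "card S \<le> 2"
    using assms unfolding int_closure_two_gen_def by blast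
  note Sp = generated_in_lin_span[OF S(1)]
  obtain g h where gh: "g \<in> A" "h \<in> A" "S \<subseteq> {g, h}"
    using subset_pair[OF Sp(1) S(2) Sp(2) subringE(2)[OF A_subring]] by metis
  have c: "g \<in> carrier Q" "h \<in> carrier Q" using gh subringE(1)[OF A_subring] by auto
  have "\<exists>r\<in>K. \<exists>s\<in>K. a = r \<otimes>\<^bsub>Q\<^esub> g \<oplus>\<^bsub>Q\<^esub> s \<otimes>\<^bsub>Q\<^esub> h" if "a \<in> A" for a
  proof -
    have "a \<in> lin_span Q K {g, h}" using Sp(3) that Q.lin_span_mono[OF order_refl gh(3)] by blast
    from Q.lin_span_pair[OF K_subring c this] show ?thesis by blast
  qed
  then show thesis using that gh(1,2) by blast
qed

lemma is_local_two_gen: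
  assumes "\<alpha> \<in> A" "\<beta> \<in> A"
    "\<And>a. a \<in> A \<Longrightarrow> \<exists>r\<in>K. \<exists>s\<in>K. a = r \<otimes>\<^bsub>Q\<^esub> \<alpha> \<oplus>\<^bsub>Q\<^esub> s \<otimes>\<^bsub>Q\<^esub> \<beta>"
  shows "local_two_gen Q K A MK \<alpha> \<beta>"
proof (rule local_two_gen.intro[OF Frac_cring local_two_gen_axioms.intro])
  note MI = idealE[OF M_ideal]
  show "subring K Q" "subring A Q" "K \<subseteq> A" by (rule K_subring A_subring K_sub_A)+
  show "MK \<subseteq> K" using M_carrier by blast
  show "\<zero>\<^bsub>Q\<^esub> \<in> MK" using MI(2) h.hom_zero by (metis imageI)
  show "\<one>\<^bsub>Q\<^esub> \<notin> MK"
  proof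
    assume "\<one>\<^bsub>Q\<^esub> \<in> MK"
    then obtain m where m: "m \<in> M" "\<iota> m = \<iota> \<one>" using h.hom_one by auto
    then have "m = \<one>" using emb_inj M_carrier by blast
    then show False using m(1) one_notin_M by simp
  qed
  fix a b
  { assume "a \<in> MK" "b \<in> MK"
    then obtain m n where mn: "m \<in> M" "n \<in> M" "a = \<iota> m" "b = \<iota> n" by blast
    then have "m \<in> carrier R" "n \<in> carrier R" using M_carrier by blast+
    then have "a \<oplus>\<^bsub>Q\<^esub> b = \<iota> (m \<oplus> n)" unfolding mn by simp
    then show "a \<oplus>\<^bsub>Q\<^esub> b \<in> MK" using MI(3) mn by blast }
  { assume "a \<in> K" "b \<in> MK"
    then obtain m n where mn: "m \<in> carrier R" "n \<in> M" "a = \<iota> m" "b = \<iota> n" by blast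
    then have "n \<in> carrier R" using M_carrier by blast
    then have "a \<otimes>\<^bsub>Q\<^esub> b = \<iota> (m \<otimes> n)" unfolding mn using mn(1) by simp
    then show "a \<otimes>\<^bsub>Q\<^esub> b \<in> MK" using MI(4) mn by blast }
  { assume "a \<in> K" "a \<notin> MK"
    then obtain m where m: "m \<in> carrier R" "m \<notin> M" "a = \<iota> m" by blast
    obtain n where "n \<in> carrier R" "m \<otimes> n = \<one>" using local_ring_unit[OF loc max m(1,2)] by metis
    then have "a \<otimes>\<^bsub>Q\<^esub> \<iota> n = \<one>\<^bsub>Q\<^esub>" unfolding m(3) using m(1) by (metis h.hom_mult h.hom_one)
    then show "\<exists>b\<in>K. a \<otimes>\<^bsub>Q\<^esub> b = \<one>\<^bsub>Q\<^esub>" using \<open>n \<in> carrier R\<close> by blast }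
qed (use assms in auto)

lemma emb_hom_int_closure: "ring_hom_ring R (int_closure_ring R) \<iota>"
proof (rule ring_hom_ringI)
  show "ring R" "ring (int_closure_ring R)" using ring_axioms A_cring by (auto simp: cring_def)
qed (use K_sub_A in auto)

text \<open>The contraction of \<open>P\<close> to \<open>R\<close> is a prime ideal containing a
  nonzerodivisor, so by dimension one it is \<open>M\<close>.\<close>

lemma primeideal_int_closure_contains_M:
  assumes P: "primeideal P (int_closure_ring R)" and r: "r \<in> P" "r \<in> K \<inter> Units Q"
  shows "MK \<subseteq> P"
proof -
  obtain r0 where r0: "r0 \<in> carrier R" "r = \<iota> r0" using r(2) by blast
  then have "r0 \<in> nzd R" using emb_unit_nzd r(2) by blast
  moreover have "primeideal {a \<in> carrier R. \<iota> a \<in> P} R"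
    by (rule ring_hom_ring.primeideal_vimage[OF emb_hom_int_closure is_cring P])
  ultimately have "{a \<in> carrier R. \<iota> a \<in> P} = M"
    using dim_one_primeideal_eq[OF loc dim max] r(1) r0 by blast
  then show ?thesis by blast
qed

lemma is_two_gen_extension:
  assumes base: "local_two_gen Q K A MK \<alpha> \<beta>"
    and t: "t \<in> M" "t \<in> nzd R"
    and sep: "\<And>x. x \<in> K \<Longrightarrow> (\<And>n::nat. \<exists>b\<in>K. x = \<iota> t [^]\<^bsub>Q\<^esub> n \<otimes>\<^bsub>Q\<^esub> b) \<Longrightarrow> x = \<zero>\<^bsub>Q\<^esub>"
    and E: "finite E" "E \<subseteq> local_two_gen.J Q MK \<alpha> \<beta>" "local_two_gen.J Q MK \<alpha> \<beta> \<subseteq> lin_span Q K E"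
  shows "two_gen_extension Q K A MK \<alpha> \<beta> (\<iota> t) E"
proof -
  interpret B: local_two_gen Q K A MK \<alpha> \<beta> by (rule base)
  show ?thesis
  proof (rule two_gen_extension.intro[OF base two_gen_extension_axioms.intro])
    show "\<iota> t \<in> MK" "\<iota> t \<in> Units Q" using t emb_unit by auto
    show "finite E" "E \<subseteq> B.J" "B.J \<subseteq> lin_span Q K E" by (rule E)+
    show "\<And>q. q \<in> carrier Q \<Longrightarrow> q \<notin> Units Q \<Longrightarrow> \<exists>z\<in>carrier Q. z \<noteq> \<zero>\<^bsub>Q\<^esub> \<and> z \<otimes>\<^bsub>Q\<^esub> q = \<zero>\<^bsub>Q\<^esub>"
      by (rule Frac_zero_divisor)
    show "\<And>x. x \<in> K \<Longrightarrow> (\<And>n::nat. \<exists>b\<in>K. x = \<iota> t [^]\<^bsub>Q\<^esub> n \<otimes>\<^bsub>Q\<^esub> b) \<Longrightarrow> x = \<zero>\<^bsub>Q\<^esub>" by (rule sep)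
    show "\<exists>s\<in>K \<inter> Units Q. s \<otimes>\<^bsub>Q\<^esub> q \<in> K" if q: "q \<in> carrier Q" for q
    proof -
      obtain a s where "a \<in> carrier R" "s \<in> nzd R" "\<iota> s \<otimes>\<^bsub>Q\<^esub> q = \<iota> a"
        using emb_clear_denominator[OF q] by metis
      then show ?thesis using emb_unit nzdD(1) by (intro bexI[of _ "\<iota> s"]) auto
    qed
    show "y \<in> A" if "y \<in> carrier Q" "finite G" "G \<subseteq> carrier Q"
      "\<And>g. g \<in> G \<Longrightarrow> y \<otimes>\<^bsub>Q\<^esub> g \<in> lin_span Q K G" "u \<in> lin_span Q K G" "u \<in> Units Q" for y G u
      unfolding A_eq by (rule Q.integralI_module[OF K_subring that])
    fix v r assume v: "v \<in> B.J" and r: "r \<in> K \<inter> Units Q"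
    interpret A: cring "int_closure_ring R" by (rule A_cring)
    have rA: "r \<in> carrier (int_closure_ring R)" "v \<in> carrier (int_closure_ring R)"
      using r K_sub_A v B.J_in_A by auto
    \<comment> \<open>Every prime ideal of \<open>A\<close> above \<open>r\<close> contains
      \<open>M\<close>, hence \<open>J\<close>. So \<open>v\<close> lies in all of them, and some
      power of \<open>v\<close> is a multiple of \<open>r\<close>.\<close>
    have inP: "v \<in> P" if P: "primeideal P (int_closure_ring R)" "r \<in> P" for P
    proof -
      have MP: "MK \<subseteq> P" by (rule primeideal_int_closure_contains_M[OF P r])
      note PI = idealE[OF primeideal.axioms(1)[OF P(1)], simplified]
      obtain a b where ab: "a \<in> MK" "b \<in> MK" "v = a \<otimes>\<^bsub>Q\<^esub> \<alpha> \<oplus>\<^bsub>Q\<^esub> b \<otimes>\<^bsub>Q\<^esub> \<beta>"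
        using v unfolding B.J_def by blast
      have "\<alpha> \<otimes>\<^bsub>Q\<^esub> a \<oplus>\<^bsub>Q\<^esub> \<beta> \<otimes>\<^bsub>Q\<^esub> b \<in> P"
        by (rule PI(3)[OF PI(4)[OF subsetD[OF MP ab(1)] B.\<alpha>\<beta>(1)] PI(4)[OF subsetD[OF MP ab(2)] B.\<alpha>\<beta>(2)]])
      moreover have "\<alpha> \<otimes>\<^bsub>Q\<^esub> a \<oplus>\<^bsub>Q\<^esub> \<beta> \<otimes>\<^bsub>Q\<^esub> b = v"
        unfolding ab(3) using B.\<alpha>\<beta> B.M_closed[OF ab(1)] B.M_closed[OF ab(2)]
        by (simp add: Q.m_comm[of \<alpha>] Q.m_comm[of \<beta>] B.A_closed)
      ultimately show ?thesis by simp
    qed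
    obtain n :: nat and b where nb: "b \<in> carrier (int_closure_ring R)"
      "v [^]\<^bsub>int_closure_ring R\<^esub> n = b \<otimes>\<^bsub>int_closure_ring R\<^esub> r"
      by (rule A.in_all_primeideals_imp_power[OF rA inP])
    then show "\<exists>n::nat. \<exists>b\<in>A. v [^]\<^bsub>Q\<^esub> n = b \<otimes>\<^bsub>Q\<^esub> r"
      unfolding pow_int_closure_ring int_closure_ring_simps by (intro exI[of _ n] bexI[of _ b])
  qed
qed

section \<open>From the extension axioms to the Bass property\<close>

lemma bass_of_extension:
  assumes "int_closure_two_gen R" and ext: "two_gen_extension Q K A MK \<alpha> \<beta> (\<iota> t) E" and t: "t \<in> M"
  shows "bass_ring R" "generalized_local_ring R"
proof -
  interpret X: two_gen_extension Q K A MK \<alpha> \<beta> "\<iota> t" E by (rule ext)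
  obtain x where x: "x \<in> MK" "\<And>j. j \<in> X.J \<Longrightarrow> \<exists>a\<in>A. j = x \<otimes>\<^bsub>Q\<^esub> a" using X.J_principal by metis
  have reduced: "reduced_ring R"
    unfolding reduced_ring_def
  proof (intro ballI allI impI)
    fix y and n :: nat assume y: "y \<in> carrier R" "y [^] n = \<zero>"
    have yc: "\<iota> y \<in> carrier Q" using y by simp
    have yn: "\<iota> y [^]\<^bsub>Q\<^esub> n = \<zero>\<^bsub>Q\<^esub>" using h.hom_nat_pow[OF y(1), of n] y(2) by simp
    \<comment> \<open>For every \<open>i\<close> the quotient \<open>y / t\<^sup>i\<close> is
      nilpotent too, hence a root of a monic polynomial with zero coefficients and so in
      \<open>A\<close>. Thus a nilpotent \<open>y\<close> is divisible by all powers of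
      \<open>t\<close>.\<close>
    have "\<iota> y = \<zero>\<^bsub>Q\<^esub>"
    proof (rule X.sepA)
      show "\<iota> y \<in> A" using y(1) K_sub_A by blast
      fix i :: nat
      define T where "T = \<iota> t [^]\<^bsub>Q\<^esub> i"
      have "T \<in> Units Q" unfolding T_def using X.t(2) by (induction i) auto
      then have T: "T \<in> carrier Q" "inv\<^bsub>Q\<^esub> T \<in> carrier Q" "T \<otimes>\<^bsub>Q\<^esub> inv\<^bsub>Q\<^esub> T = \<one>\<^bsub>Q\<^esub>" by auto
      define z where "z = inv\<^bsub>Q\<^esub> T \<otimes>\<^bsub>Q\<^esub> \<iota> y"
      have zc: "z \<in> carrier Q" using T yc by (simp add: z_def)
      have "z [^]\<^bsub>Q\<^esub> n = \<zero>\<^bsub>Q\<^esub>" unfolding z_def using T yc yn by (simp add: Q.nat_pow_distrib)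
      moreover have "finsum Q (\<lambda>i. \<zero>\<^bsub>Q\<^esub> \<otimes>\<^bsub>Q\<^esub> z [^]\<^bsub>Q\<^esub> i) {..<n} = \<zero>\<^bsub>Q\<^esub>"
        using zc by (intro Q.add.finprod_one_eqI) auto
      ultimately have "z \<in> A" unfolding A_eq integral_elems_def using zc subringE(2)[OF K_subring]
        by (intro CollectI conjI exI[of _ n] exI[of _ "\<lambda>_. \<zero>\<^bsub>Q\<^esub>"]) auto
      moreover have "\<iota> y = T \<otimes>\<^bsub>Q\<^esub> z" unfolding z_def using T yc by (simp add: Q.m_assoc[symmetric])
      ultimately show "\<exists>b\<in>A. \<iota> y = \<iota> t [^]\<^bsub>Q\<^esub> i \<otimes>\<^bsub>Q\<^esub> b" unfolding T_def by blast
    qed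
    then have "\<iota> y = \<iota> \<zero>" by simp
    then show "y = \<zero>" using emb_inj y(1) by blast
  qed
  have two: "\<exists>S\<subseteq>carrier R. finite S \<and> card S \<le> 2 \<and> I = Idl S" if I: "ideal I R" for I
  proof -
    note II = idealE[OF I]
    have "X.submod (\<iota> ` I)"
      unfolding X.submod_def
    proof (intro conjI ballI)
      show "\<iota> ` I \<subseteq> A" using II(1) K_sub_A by blast
      show "\<zero>\<^bsub>Q\<^esub> \<in> \<iota> ` I" using II(2) h.hom_zero by (metis imageI)
      fix u assume "u \<in> \<iota> ` I"
      then obtain i where i: "i \<in> I" "u = \<iota> i" by blast
      have ic: "i \<in> carrier R" using i II(1) by blast
      { fix v assume "v \<in> \<iota> ` I"
        then obtain j where j: "j \<in> I" "v = \<iota> j" by blast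
        then have "j \<in> carrier R" using II(1) by blast
        then have "u \<oplus>\<^bsub>Q\<^esub> v = \<iota> (i \<oplus> j)" unfolding i j using ic by simp
        then show "u \<oplus>\<^bsub>Q\<^esub> v \<in> \<iota> ` I" using II(3)[OF i(1) j(1)] by blast }
      { fix a assume "a \<in> K"
        then obtain r where r: "r \<in> carrier R" "a = \<iota> r" by blast
        then have "a \<otimes>\<^bsub>Q\<^esub> u = \<iota> (r \<otimes> i)" using ic i by (simp add: h.hom_mult)
        then show "a \<otimes>\<^bsub>Q\<^esub> u \<in> \<iota> ` I" using II(4)[OF i(1) r(1)] by blast }
    qed
    from X.submod_two_gen[OF x this]
    obtain u v where uv: "u \<in> \<iota> ` I" "v \<in> \<iota> ` I"
      "\<And>w. w \<in> \<iota> ` I \<Longrightarrow> \<exists>r\<in>K. \<exists>s\<in>K. w = r \<otimes>\<^bsub>Q\<^esub> u \<oplus>\<^bsub>Q\<^esub> s \<otimes>\<^bsub>Q\<^esub> v" by metis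
    obtain a b where ab: "a \<in> I" "u = \<iota> a" "b \<in> I" "v = \<iota> b" using uv(1,2) by blast
    have abc: "a \<in> carrier R" "b \<in> carrier R" using ab II(1) by auto
    have sub: "{a, b} \<subseteq> carrier R" using abc by simp
    note GI = idealE[OF genideal_ideal[OF sub]]
    have gs: "a \<in> Idl {a, b}" "b \<in> Idl {a, b}" using genideal_self[OF sub] by auto
    have "I = Idl {a, b}"
    proof
      show "Idl {a, b} \<subseteq> I" using ab by (intro genideal_minimal[OF I]) simp
      show "I \<subseteq> Idl {a, b}"
      proof
        fix i assume i: "i \<in> I"
        then obtain r s where rs: "r \<in> carrier R" "s \<in> carrier R"
          "\<iota> i = \<iota> r \<otimes>\<^bsub>Q\<^esub> \<iota> a \<oplus>\<^bsub>Q\<^esub> \<iota> s \<otimes>\<^bsub>Q\<^esub> \<iota> b" using uv(3)[of "\<iota> i"] ab by blast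
        then have "\<iota> i = \<iota> (r \<otimes> a \<oplus> s \<otimes> b)" using abc by (simp add: h.hom_mult h.hom_add)
        then have "i = r \<otimes> a \<oplus> s \<otimes> b" using emb_inj[of i "r \<otimes> a \<oplus> s \<otimes> b"] i II(1) rs abc by auto
        then show "i \<in> Idl {a, b}" using GI(3,4) gs rs by simp
      qed
    qed
    moreover have "card {a, b} \<le> 2" by (simp add: card_insert_if)
    ultimately show ?thesis using sub by blast
  qed
  have noeth: "noetherian_ring R" by (rule noetherian_ringI) (use two in blast)
  show "bass_ring R"
    unfolding bass_ring_def ideals_two_gen_def
    using reduced noeth loc two assms(1) unfolding int_closure_fin_gen_def int_closure_two_gen_def
    by blast
  have pow: "m \<in> ideal_pow R M i \<Longrightarrow> \<exists>a\<in>A. \<iota> m = x [^]\<^bsub>Q\<^esub> i \<otimes>\<^bsub>Q\<^esub> a" for i m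
  proof (induction i arbitrary: m)
    case 0
    then have "\<iota> m \<in> A" using K_sub_A by auto
    moreover from this have "\<iota> m = x [^]\<^bsub>Q\<^esub> (0::nat) \<otimes>\<^bsub>Q\<^esub> \<iota> m" by (simp add: X.A_closed)
    ultimately show ?case by blast
  next
    case (Suc i)
    have xc: "x \<in> carrier Q" using X.M_closed x(1) by blast
    have pc: "\<And>i. ideal_pow R M i \<subseteq> carrier R" using idealE(1)[OF pow_ideal] by blast
    from Suc(2) have "m \<in> M \<cdot> ideal_pow R M i" by simp
    \<comment> \<open>Membership in \<open>carrier R\<close> is carried along because the additive
      case of the induction over \<open>ideal_prod\<close> needs it to apply the
      homomorphism.\<close>
    then have "m \<in> carrier R \<and> (\<exists>a\<in>A. \<iota> m = x [^]\<^bsub>Q\<^esub> Suc i \<otimes>\<^bsub>Q\<^esub> a)"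
    proof induction
      case (prod k l)
      have kl: "k \<in> carrier R" "l \<in> carrier R" using prod M_carrier pc by auto
      obtain a where a: "a \<in> A" "\<iota> k = x \<otimes>\<^bsub>Q\<^esub> a" using x(2)[OF X.M_in_J] prod(1) by blast
      obtain b where b: "b \<in> A" "\<iota> l = x [^]\<^bsub>Q\<^esub> i \<otimes>\<^bsub>Q\<^esub> b" using Suc.IH[OF prod(2)] by blast
      have abc: "a \<in> carrier Q" "b \<in> carrier Q" using a(1) b(1) by auto
      have "\<iota> (k \<otimes> l) = (x \<otimes>\<^bsub>Q\<^esub> a) \<otimes>\<^bsub>Q\<^esub> (x [^]\<^bsub>Q\<^esub> i \<otimes>\<^bsub>Q\<^esub> b)"
        using kl a(2) b(2) by (simp add: h.hom_mult)
      also have "\<dots> = x [^]\<^bsub>Q\<^esub> Suc i \<otimes>\<^bsub>Q\<^esub> (a \<otimes>\<^bsub>Q\<^esub> b)" using xc abc by (simp add: Q.m_ac)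
      finally show ?case using X.AE(6)[OF a(1) b(1)] kl by blast
    next
      case (sum k l)
      then obtain a b where ab: "a \<in> A" "\<iota> k = x [^]\<^bsub>Q\<^esub> Suc i \<otimes>\<^bsub>Q\<^esub> a"
        "b \<in> A" "\<iota> l = x [^]\<^bsub>Q\<^esub> Suc i \<otimes>\<^bsub>Q\<^esub> b" and kl: "k \<in> carrier R" "l \<in> carrier R" by blast
      have abc: "a \<in> carrier Q" "b \<in> carrier Q" "x [^]\<^bsub>Q\<^esub> Suc i \<in> carrier Q" using ab(1,3) xc by auto
      have "\<iota> (k \<oplus> l) = x [^]\<^bsub>Q\<^esub> Suc i \<otimes>\<^bsub>Q\<^esub> (a \<oplus>\<^bsub>Q\<^esub> b)"
        using h.hom_add[OF kl] ab(2,4) Q.r_distr[OF abc] by simp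
      then show ?case using X.AE(7)[OF ab(1,3)] kl by blast
    qed
    then show ?case by blast
  qed
  have inter: "(\<Inter>i\<in>{1..}. ideal_pow R M i) = {\<zero>}"
  proof
    show "{\<zero>} \<subseteq> (\<Inter>i\<in>{1..}. ideal_pow R M i)" using idealE(2)[OF pow_ideal] by blast
    show "(\<Inter>i\<in>{1..}. ideal_pow R M i) \<subseteq> {\<zero>}"
    proof
      fix m assume m: "m \<in> (\<Inter>i\<in>{1..}. ideal_pow R M i)"
      then have "m \<in> ideal_pow R M 1" by blast
      then have mc: "m \<in> carrier R" using idealE(1)[OF pow_ideal] by blast
      have "\<iota> m = \<zero>\<^bsub>Q\<^esub>"
      proof (rule X.sep_x[OF x])
        show mA: "\<iota> m \<in> A" using mc K_sub_A by blast
        fix n :: nat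
        show "\<exists>b\<in>A. \<iota> m = x [^]\<^bsub>Q\<^esub> n \<otimes>\<^bsub>Q\<^esub> b"
        proof (rule pow)
          have "m \<in> ideal_pow R M n" if "n \<in> {1..}" using m that by blast
          then show "m \<in> ideal_pow R M n" using mc by (cases "n = 0") simp_all
        qed
      qed
      then have "\<iota> m = \<iota> \<zero>" by simp
      then show "m \<in> {\<zero>}" using emb_inj mc by blast
    qed
  qed
  show "generalized_local_ring R"
    unfolding generalized_local_ring_def
  proof (intro conjI allI impI)
    fix N assume "maximalideal N R"
    then have N: "N = M" using loc max by (auto simp: local_ring_def)
    show "\<exists>S\<subseteq>carrier R. finite S \<and> N = Idl S" using two[OF M_ideal] N by blast
    show "(\<Inter>i\<in>{1..}. ideal_pow R N i) = {\<zero>}" using inter N by simp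
  qed (rule loc)
qed

section \<open>From the Bass property to the integral closure\<close>

lemma finite_common_denominator:
  assumes "finite S" "S \<subseteq> carrier Q"
  shows "\<exists>d\<in>nzd R. \<forall>s\<in>S. \<iota> d \<otimes>\<^bsub>Q\<^esub> s \<in> K"
  using assms
proof (induction S rule: finite_induct)
  case empty
  then show ?case using nzd_one by blast
next
  case (insert q S)
  then obtain d where d: "d \<in> nzd R" "\<And>s. s \<in> S \<Longrightarrow> \<iota> d \<otimes>\<^bsub>Q\<^esub> s \<in> K" by auto
  have qc: "q \<in> carrier Q" using insert by blast
  obtain a e where ae: "a \<in> carrier R" "e \<in> nzd R" "\<iota> e \<otimes>\<^bsub>Q\<^esub> q = \<iota> a"
    using emb_clear_denominator[OF qc] by metis
  have dec: "d \<in> carrier R" "e \<in> carrier R" using nzdD d(1) ae(2) by auto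
  have dK: "\<iota> d \<in> K" "\<iota> e \<in> K" using dec by auto
  have mult: "\<iota> (d \<otimes> e) \<otimes>\<^bsub>Q\<^esub> s = \<iota> d \<otimes>\<^bsub>Q\<^esub> (\<iota> e \<otimes>\<^bsub>Q\<^esub> s)" "\<iota> (d \<otimes> e) \<otimes>\<^bsub>Q\<^esub> s = \<iota> e \<otimes>\<^bsub>Q\<^esub> (\<iota> d \<otimes>\<^bsub>Q\<^esub> s)"
    if "s \<in> carrier Q" for s using that dec by (simp_all add: Q.m_ac)
  have "\<iota> (d \<otimes> e) \<otimes>\<^bsub>Q\<^esub> s \<in> K" if s: "s \<in> insert q S" for s
  proof (cases "s = q")
    case True
    have "\<iota> a \<in> K" using ae(1) by blast
    then have "\<iota> d \<otimes>\<^bsub>Q\<^esub> \<iota> a \<in> K" by (rule subringE(6)[OF K_subring dK(1)])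
    then show ?thesis unfolding True mult(1)[OF qc] ae(3) .
  next
    case False
    then have sS: "s \<in> S" "s \<in> carrier Q" using s insert by auto
    show ?thesis unfolding mult(2)[OF sS(2)] by (rule subringE(6)[OF K_subring dK(2) d(2)[OF sS(1)]])
  qed
  then show ?case using nzd_mult[OF d(1) ae(2)] by blast
qed

text \<open>Multiplication by \<open>d\<close> identifies \<open>N\<close> with the ideal
  \<open>I\<close> of \<open>R\<close>; its two generators are divided by the unit \<open>d\<close>
  again. The lemma serves twice: for the ideals of \<open>A\<close>, which makes \<open>A\<close>
  Noetherian, and for \<open>A\<close> itself.\<close>

lemma bass_submodule_two_gen:
  assumes two: "ideals_two_gen R" and d: "d \<in> nzd R" "\<And>a. a \<in> A \<Longrightarrow> \<iota> d \<otimes>\<^bsub>Q\<^esub> a \<in> K"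
    and N: "N \<subseteq> A" "\<zero>\<^bsub>Q\<^esub> \<in> N" "\<And>u v. u \<in> N \<Longrightarrow> v \<in> N \<Longrightarrow> u \<oplus>\<^bsub>Q\<^esub> v \<in> N"
      "\<And>r u. r \<in> K \<Longrightarrow> u \<in> N \<Longrightarrow> r \<otimes>\<^bsub>Q\<^esub> u \<in> N"
  obtains u v where "u \<in> N" "v \<in> N"
    "\<And>w. w \<in> N \<Longrightarrow> \<exists>r\<in>carrier R. \<exists>s\<in>carrier R. w = \<iota> r \<otimes>\<^bsub>Q\<^esub> u \<oplus>\<^bsub>Q\<^esub> \<iota> s \<otimes>\<^bsub>Q\<^esub> v"
proof -
  have dc: "d \<in> carrier R" "\<iota> d \<in> carrier Q" "\<iota> d \<in> Units Q" using nzdD d(1) emb_unit by auto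
  have Nc: "\<And>w. w \<in> N \<Longrightarrow> w \<in> carrier Q" using N(1) subringE(1)[OF A_subring] by blast
  define I where "I = {i \<in> carrier R. \<exists>w\<in>N. \<iota> i = \<iota> d \<otimes>\<^bsub>Q\<^esub> w}"
  have "ideal I R"
  proof (rule idealI_cring)
    show "I \<subseteq> carrier R" by (auto simp: I_def)
    have "\<iota> \<zero> = \<iota> d \<otimes>\<^bsub>Q\<^esub> \<zero>\<^bsub>Q\<^esub>" using dc by simp
    then show "\<zero> \<in> I" using N(2) unfolding I_def by blast
    fix i assume "i \<in> I"
    then obtain w where w: "i \<in> carrier R" "w \<in> N" "\<iota> i = \<iota> d \<otimes>\<^bsub>Q\<^esub> w" by (auto simp: I_def)
    { fix j assume "j \<in> I"
      then obtain v where v: "j \<in> carrier R" "v \<in> N" "\<iota> j = \<iota> d \<otimes>\<^bsub>Q\<^esub> v" by (auto simp: I_def)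
      have "\<iota> (i \<oplus> j) = \<iota> d \<otimes>\<^bsub>Q\<^esub> (w \<oplus>\<^bsub>Q\<^esub> v)"
        using w(1) v(1) dc Nc[OF w(2)] Nc[OF v(2)] by (simp add: w(3) v(3) Q.r_distr)
      then show "i \<oplus> j \<in> I" using N(3)[OF w(2) v(2)] w(1) v(1) unfolding I_def by blast }
    { fix r assume r: "r \<in> carrier R"
      have "\<iota> (r \<otimes> i) = \<iota> d \<otimes>\<^bsub>Q\<^esub> (\<iota> r \<otimes>\<^bsub>Q\<^esub> w)"
        using w(1) r dc Nc[OF w(2)] by (simp add: w(3) Q.m_lcomm)
      then show "r \<otimes> i \<in> I" using N(4)[of "\<iota> r" w] w(1,2) r unfolding I_def by blast }
  qed
  note II = idealE[OF this]
  obtain T where T: "T \<subseteq> carrier R" "finite T" "card T \<le> 2" "I = Idl T"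
    using two \<open>ideal I R\<close> unfolding ideals_two_gen_def by metis
  have "T \<subseteq> I" using genideal_self[OF T(1)] T(4) by simp
  obtain a b where ab: "a \<in> I" "b \<in> I" "T \<subseteq> {a, b}"
    by (rule subset_pair[OF T(2,3) \<open>T \<subseteq> I\<close> II(2)])
  have abc: "a \<in> carrier R" "b \<in> carrier R" using ab II(1) by auto
  obtain u v where uv: "u \<in> N" "\<iota> a = \<iota> d \<otimes>\<^bsub>Q\<^esub> u" "v \<in> N" "\<iota> b = \<iota> d \<otimes>\<^bsub>Q\<^esub> v"
    using ab(1,2) unfolding I_def by blast
  \<comment> \<open>\<open>Idl T\<close> is given as the least ideal containing \<open>T\<close>;
    comparison with the explicit ideal \<open>R a + R b\<close> makes coefficients
    available.\<close>
  let ?P = "{p \<oplus> x \<otimes> b | p x. p \<in> PIdl a \<and> x \<in> carrier R}"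
  have P: "ideal ?P R" by (rule ideal_add_principal[OF cgenideal_ideal[OF abc(1)] abc(2)])
  have "a \<in> ?P"
  proof -
    have "a = a \<oplus> \<zero> \<otimes> b" using abc by simp
    then show ?thesis using cgenideal_self[OF abc(1)] zero_closed by blast
  qed
  moreover have "b \<in> ?P"
  proof -
    have "b = \<zero> \<oplus> \<one> \<otimes> b" using abc by simp
    then show ?thesis using idealE(2)[OF cgenideal_ideal[OF abc(1)]] one_closed by blast
  qed
  ultimately have "T \<subseteq> ?P" using ab(3) by blast
  then have IP: "I \<subseteq> ?P" unfolding T(4) by (rule genideal_minimal[OF P])
  have "\<exists>r\<in>carrier R. \<exists>s\<in>carrier R. w = \<iota> r \<otimes>\<^bsub>Q\<^esub> u \<oplus>\<^bsub>Q\<^esub> \<iota> s \<otimes>\<^bsub>Q\<^esub> v" if w: "w \<in> N" for w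
  proof -
    obtain i where i: "i \<in> carrier R" "\<iota> i = \<iota> d \<otimes>\<^bsub>Q\<^esub> w" using d(2) w N(1) by (metis imageE subsetD)
    then have "i \<in> ?P" using IP w unfolding I_def by blast
    then obtain r s where rs: "r \<in> carrier R" "s \<in> carrier R" "i = r \<otimes> a \<oplus> s \<otimes> b"
      unfolding cgenideal_def by blast
    have rsc: "\<iota> r \<in> carrier Q" "\<iota> s \<in> carrier Q" "u \<in> carrier Q" "v \<in> carrier Q" "w \<in> carrier Q"
      using rs uv Nc w by auto
    have "\<iota> d \<otimes>\<^bsub>Q\<^esub> w = \<iota> r \<otimes>\<^bsub>Q\<^esub> (\<iota> d \<otimes>\<^bsub>Q\<^esub> u) \<oplus>\<^bsub>Q\<^esub> \<iota> s \<otimes>\<^bsub>Q\<^esub> (\<iota> d \<otimes>\<^bsub>Q\<^esub> v)"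
      unfolding i(2)[symmetric] rs(3) using rs(1,2) abc by (simp add: uv)
    also have "\<dots> = \<iota> d \<otimes>\<^bsub>Q\<^esub> (\<iota> r \<otimes>\<^bsub>Q\<^esub> u \<oplus>\<^bsub>Q\<^esub> \<iota> s \<otimes>\<^bsub>Q\<^esub> v)"
      using rsc dc(2) by (simp add: Q.r_distr Q.m_lcomm)
    finally have "w = \<iota> r \<otimes>\<^bsub>Q\<^esub> u \<oplus>\<^bsub>Q\<^esub> \<iota> s \<otimes>\<^bsub>Q\<^esub> v"
      using Q.Units_l_cancel[OF dc(3)] rsc by simp
    then show ?thesis using rs(1,2) by blast
  qed
  then show thesis using that uv(1,3) by blast
qed

lemma noetherian_two_gen_of_bass:
  assumes "bass_ring R"
  shows "noetherian_ring (int_closure_ring R)" "int_closure_two_gen R"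
proof -
  interpret A: cring "int_closure_ring R" by (rule A_cring)
  note AE = subringE[OF A_subring]
  have two: "ideals_two_gen R" using assms by (simp add: bass_ring_def)
  obtain S where S: "generates_int_closure R S"
    using assms unfolding bass_ring_def int_closure_fin_gen_def by blast
  note Sp = generated_in_lin_span[OF S]
  have Sc: "S \<subseteq> carrier Q" using Sp(2) AE(1) by blast
  obtain d where d: "d \<in> nzd R" "\<And>s. s \<in> S \<Longrightarrow> \<iota> d \<otimes>\<^bsub>Q\<^esub> s \<in> K"
    using finite_common_denominator[OF Sp(1) Sc] by blast
  have dc: "\<iota> d \<in> carrier Q" using d(1) nzdD by auto
  note KE = subringE[OF K_subring]
  have dA: "\<iota> d \<otimes>\<^bsub>Q\<^esub> a \<in> K" if a: "a \<in> A" for a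
  proof (rule Q.lin_span_mult_mem[OF KE(1) Sc dc subsetD[OF Sp(3) a] KE(2,7)])
    fix c g assume c: "c \<in> K" "g \<in> S"
    then have "c \<in> carrier Q" "g \<in> carrier Q" using KE(1) Sc by auto
    then have "\<iota> d \<otimes>\<^bsub>Q\<^esub> (c \<otimes>\<^bsub>Q\<^esub> g) = c \<otimes>\<^bsub>Q\<^esub> (\<iota> d \<otimes>\<^bsub>Q\<^esub> g)" using dc by (simp add: Q.m_lcomm)
    then show "\<iota> d \<otimes>\<^bsub>Q\<^esub> (c \<otimes>\<^bsub>Q\<^esub> g) \<in> K" using KE(6)[OF c(1) d(2)[OF c(2)]] by simp
  qed
  have "\<exists>S\<subseteq>carrier (int_closure_ring R). finite S \<and> N = Idl\<^bsub>int_closure_ring R\<^esub> S"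
    if N: "ideal N (int_closure_ring R)" for N
  proof -
    note NI = idealE[OF N, simplified]
    obtain u v where uv: "u \<in> N" "v \<in> N"
      "\<And>w. w \<in> N \<Longrightarrow> \<exists>r\<in>carrier R. \<exists>s\<in>carrier R. w = \<iota> r \<otimes>\<^bsub>Q\<^esub> u \<oplus>\<^bsub>Q\<^esub> \<iota> s \<otimes>\<^bsub>Q\<^esub> v"
      by (rule bass_submodule_two_gen[OF two d(1) dA NI(1,2,3)]) (use NI(4) K_sub_A in auto)
    have sub: "{u, v} \<subseteq> carrier (int_closure_ring R)" using subsetD[OF NI(1)] uv(1,2) by simp
    note GI = idealE[OF A.genideal_ideal[OF sub], simplified]
    have g: "u \<in> Idl\<^bsub>int_closure_ring R\<^esub> {u, v}" "v \<in> Idl\<^bsub>int_closure_ring R\<^esub> {u, v}"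
      using A.genideal_self[OF sub] by auto
    have "N \<subseteq> Idl\<^bsub>int_closure_ring R\<^esub> {u, v}"
    proof
      fix w assume "w \<in> N"
      then obtain r s where rs: "\<iota> r \<in> A" "\<iota> s \<in> A" "w = \<iota> r \<otimes>\<^bsub>Q\<^esub> u \<oplus>\<^bsub>Q\<^esub> \<iota> s \<otimes>\<^bsub>Q\<^esub> v"
        using uv(3) K_sub_A by (meson imageI subsetD)
      show "w \<in> Idl\<^bsub>int_closure_ring R\<^esub> {u, v}" unfolding rs(3)
        by (rule GI(3)[OF GI(4)[OF g(1) rs(1)] GI(4)[OF g(2) rs(2)]])
    qed
    moreover have "Idl\<^bsub>int_closure_ring R\<^esub> {u, v} \<subseteq> N"
      by (rule A.genideal_minimal[OF N]) (use uv in simp)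
    ultimately show ?thesis using sub by (intro exI[of _ "{u, v}"]) auto
  qed
  then show "noetherian_ring (int_closure_ring R)" by (rule A.noetherian_ringI)
  obtain u v where uv: "u \<in> A" "v \<in> A"
    "\<And>w. w \<in> A \<Longrightarrow> \<exists>r\<in>carrier R. \<exists>s\<in>carrier R. w = \<iota> r \<otimes>\<^bsub>Q\<^esub> u \<oplus>\<^bsub>Q\<^esub> \<iota> s \<otimes>\<^bsub>Q\<^esub> v"
    by (rule bass_submodule_two_gen[OF two d(1) dA order_refl AE(2,7)]) (use AE(6) K_sub_A in auto)
  have uvc: "u \<in> carrier Q" "v \<in> carrier Q" using uv(1,2) AE(1) by auto
  have "\<exists>f. (\<forall>y\<in>{u, v}. f y \<in> carrier R) \<and> w = finsum Q (\<lambda>y. \<iota> (f y) \<otimes>\<^bsub>Q\<^esub> y) {u, v}"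
    if w: "w \<in> A" for w
  proof -
    obtain r s where rs: "r \<in> carrier R" "s \<in> carrier R" "w = \<iota> r \<otimes>\<^bsub>Q\<^esub> u \<oplus>\<^bsub>Q\<^esub> \<iota> s \<otimes>\<^bsub>Q\<^esub> v"
      using uv(3)[OF w] by blast
    show ?thesis
    \<comment> \<open>Generators form a set, so for \<open>u = v\<close> the sum has a single term
      and the two coefficients must be added.\<close>
    proof (cases "u = v")
      case True
      have "finsum Q (\<lambda>y. \<iota> (r \<oplus> s) \<otimes>\<^bsub>Q\<^esub> y) {v} = \<iota> (r \<oplus> s) \<otimes>\<^bsub>Q\<^esub> v"
        using Q.add.finprod_insert[of "{}" v "\<lambda>y. \<iota> (r \<oplus> s) \<otimes>\<^bsub>Q\<^esub> y"] uvc rs by simp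
      also have "\<dots> = w" unfolding rs(3) True using rs(1,2) uvc by (simp add: Q.l_distr)
      finally show ?thesis using rs True by (intro exI[of _ "\<lambda>_. r \<oplus> s"]) simp
    next
      case False
      define f where "f = (\<lambda>y. if y = u then r else s)"
      have fv: "finsum Q (\<lambda>y. \<iota> (f y) \<otimes>\<^bsub>Q\<^esub> y) {v} = \<iota> s \<otimes>\<^bsub>Q\<^esub> v"
        using Q.add.finprod_insert[of "{}" v "\<lambda>y. \<iota> (f y) \<otimes>\<^bsub>Q\<^esub> y"] uvc rs False by (simp add: f_def)
      have "finsum Q (\<lambda>y. \<iota> (f y) \<otimes>\<^bsub>Q\<^esub> y) (insert u {v})
        = \<iota> (f u) \<otimes>\<^bsub>Q\<^esub> u \<oplus>\<^bsub>Q\<^esub> finsum Q (\<lambda>y. \<iota> (f y) \<otimes>\<^bsub>Q\<^esub> y) {v}"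
        using uvc rs False by (intro Q.add.finprod_insert) (auto simp: f_def)
      then have "w = finsum Q (\<lambda>y. \<iota> (f y) \<otimes>\<^bsub>Q\<^esub> y) {u, v}" unfolding fv rs(3) by (simp add: f_def)
      then show ?thesis using rs by (intro exI[of _ f]) (simp add: f_def)
    qed
  qed
  then have "generates_int_closure R {u, v}" using uv(1,2) unfolding generates_int_closure_def by simp
  moreover have "card {u, v} \<le> 2" by (simp add: card_insert_if)
  ultimately show "int_closure_two_gen R" unfolding int_closure_two_gen_def by blast
qed

section \<open>The extension axioms from either finiteness hypothesis\<close>

text \<open>Separatedness holds because \<open>t [^] n\<close> lies in the \<open>n\<close>-th power
  of \<open>M\<close>. Products of a finite generating set of \<open>M\<close> with
  \<open>\<alpha>\<close> and \<open>\<beta>\<close> generate \<open>J\<close> over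
  \<open>K\<close>.\<close>

lemma extension_of_generalized_local:
  assumes glr: "generalized_local_ring R" and two: "int_closure_two_gen R"
  obtains \<alpha> \<beta> t E where "t \<in> M" "two_gen_extension Q K A MK \<alpha> \<beta> (\<iota> t) E"
proof -
  obtain \<alpha> \<beta> where ab: "\<alpha> \<in> A" "\<beta> \<in> A"
    "\<And>a. a \<in> A \<Longrightarrow> \<exists>r\<in>K. \<exists>s\<in>K. a = r \<otimes>\<^bsub>Q\<^esub> \<alpha> \<oplus>\<^bsub>Q\<^esub> s \<otimes>\<^bsub>Q\<^esub> \<beta>"
    using two_gen_pair[OF two] by metis
  have base: "local_two_gen Q K A MK \<alpha> \<beta>" by (rule is_local_two_gen[OF ab])
  interpret B: local_two_gen Q K A MK \<alpha> \<beta> by (rule base)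
  obtain t where t: "t \<in> M" "t \<in> nzd R" using regular by blast
  have tc: "t \<in> carrier R" using t M_carrier by blast
  obtain S where S: "S \<subseteq> carrier R" "finite S" "M = Idl S"
    using glr max unfolding generalized_local_ring_def by blast
  have inter: "(\<Inter>i\<in>{1..}. ideal_pow R M i) = {\<zero>}"
    using glr max unfolding generalized_local_ring_def by blast
  have tpow: "t [^] i \<in> ideal_pow R M i" for i :: nat
  proof (induction i)
    case (Suc i)
    have "t \<otimes> t [^] i \<in> M \<cdot> ideal_pow R M i" by (rule ideal_prod.prod[OF t(1) Suc])
    then show ?case using m_comm[of t "t [^] i"] tc by simp
  qed simp
  have sep: "x = \<zero>\<^bsub>Q\<^esub>" if x: "x \<in> K" "\<And>n::nat. \<exists>b\<in>K. x = \<iota> t [^]\<^bsub>Q\<^esub> n \<otimes>\<^bsub>Q\<^esub> b" for x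
  proof -
    obtain y where y: "y \<in> carrier R" "x = \<iota> y" using x(1) by blast
    have "y \<in> ideal_pow R M n" for n :: nat
    proof -
      obtain b where b: "b \<in> carrier R" "x = \<iota> t [^]\<^bsub>Q\<^esub> n \<otimes>\<^bsub>Q\<^esub> \<iota> b" using x(2)[of n] by blast
      have "\<iota> y = \<iota> (b \<otimes> t [^] n)"
        using b y tc by (simp add: h.hom_nat_pow Q.m_comm)
      then have "y = b \<otimes> t [^] n" using emb_inj y(1) b(1) tc by simp
      then show ?thesis using idealE(4)[OF pow_ideal tpow b(1)] by simp
    qed
    then have "y \<in> {\<zero>}" unfolding inter[symmetric] by blast
    then show ?thesis using y by simp
  qed
  define E where "E = (\<lambda>m. \<iota> m \<otimes>\<^bsub>Q\<^esub> \<alpha>) ` S \<union> (\<lambda>m. \<iota> m \<otimes>\<^bsub>Q\<^esub> \<beta>) ` S"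
  have SM: "S \<subseteq> M" using genideal_self[OF S(1)] S(3) by simp
  have EJ: "E \<subseteq> B.J"
    unfolding E_def using SM B.MA_in_J[OF _ ab(1)] B.MA_in_J[OF _ ab(2)] by blast
  have Ec: "E \<subseteq> carrier Q" using EJ B.J_closed by blast
  let ?L = "lin_span Q K E"
  have span: "\<iota> m \<otimes>\<^bsub>Q\<^esub> g \<in> ?L" if g: "g \<in> carrier Q" "\<And>m. m \<in> S \<Longrightarrow> \<iota> m \<otimes>\<^bsub>Q\<^esub> g \<in> E" and m: "m \<in> M" for m g
  proof -
    \<comment> \<open>The elements that multiply \<open>g\<close> into the span form an ideal of
      \<open>R\<close>; it contains the generators \<open>S\<close> of \<open>M\<close>, hence all
      of \<open>M\<close>.\<close>
    let ?I = "{m \<in> carrier R. \<iota> m \<otimes>\<^bsub>Q\<^esub> g \<in> ?L}"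
    have "ideal ?I R"
    proof (rule idealI_cring)
      show "?I \<subseteq> carrier R" by blast
      show "\<zero> \<in> ?I" using g(1) lin_span.zero by simp
      fix a assume a: "a \<in> ?I"
      { fix b assume b: "b \<in> ?I"
        have "\<iota> (a \<oplus> b) \<otimes>\<^bsub>Q\<^esub> g = \<iota> a \<otimes>\<^bsub>Q\<^esub> g \<oplus>\<^bsub>Q\<^esub> \<iota> b \<otimes>\<^bsub>Q\<^esub> g"
          using a b g(1) by (simp add: Q.l_distr)
        then show "a \<oplus> b \<in> ?I" using Q.lin_span_add[OF B.KE(1) Ec] a b by simp }
      { fix r assume r: "r \<in> carrier R"
        have "\<iota> (r \<otimes> a) \<otimes>\<^bsub>Q\<^esub> g = \<iota> r \<otimes>\<^bsub>Q\<^esub> (\<iota> a \<otimes>\<^bsub>Q\<^esub> g)" using a r g(1) by (simp add: Q.m_assoc)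
        then show "r \<otimes> a \<in> ?I" using Q.lin_span_smult[OF K_subring Ec] a r by simp }
    qed
    moreover have "S \<subseteq> ?I" using S(1) g(2) Q.lin_span_base[OF K_subring Ec] by blast
    ultimately have "M \<subseteq> ?I" unfolding S(3) by (rule genideal_minimal)
    then show ?thesis using m by blast
  qed
  have JL: "B.J \<subseteq> ?L"
  proof
    fix j assume "j \<in> B.J"
    then obtain r s where rs: "r \<in> M" "s \<in> M" "j = \<iota> r \<otimes>\<^bsub>Q\<^esub> \<alpha> \<oplus>\<^bsub>Q\<^esub> \<iota> s \<otimes>\<^bsub>Q\<^esub> \<beta>"
      unfolding B.J_def by blast
    have "\<iota> r \<otimes>\<^bsub>Q\<^esub> \<alpha> \<in> ?L" by (rule span[OF B.A_closed[OF ab(1)] _ rs(1)]) (simp add: E_def)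
    moreover have "\<iota> s \<otimes>\<^bsub>Q\<^esub> \<beta> \<in> ?L" by (rule span[OF B.A_closed[OF ab(2)] _ rs(2)]) (simp add: E_def)
    ultimately show "j \<in> ?L" unfolding rs(3) by (rule Q.lin_span_add[OF B.KE(1) Ec])
  qed
  have "finite E" unfolding E_def using S(2) by simp
  from is_two_gen_extension[OF base t sep this EJ JL] t(1) show thesis using that by blast
qed

text \<open>For separatedness write \<open>x = t\<^sup>n y\<^sub>n\<close>. Then
  \<open>y\<^sub>n\<close> is \<open>t\<close> times its successor, so the principal ideals of
  \<open>A\<close> generated by the \<open>y\<^sub>n\<close> ascend and become stationary. There
  some \<open>z\<close> satisfies \<open>z = j \<otimes> z\<close> with \<open>j\<close> in
  \<open>J\<close>, which forces \<open>z = \<zero>\<close>. Generators of the ideal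
  \<open>J\<close> of \<open>A\<close>, multiplied by \<open>\<alpha>\<close> and
  \<open>\<beta>\<close>, generate it over \<open>K\<close>.\<close>

lemma extension_of_noetherian:
  assumes noeth: "noetherian_ring (int_closure_ring R)" and two: "int_closure_two_gen R"
  obtains \<alpha> \<beta> t E where "t \<in> M" "two_gen_extension Q K A MK \<alpha> \<beta> (\<iota> t) E"
proof -
  obtain \<alpha> \<beta> where ab: "\<alpha> \<in> A" "\<beta> \<in> A"
    "\<And>a. a \<in> A \<Longrightarrow> \<exists>r\<in>K. \<exists>s\<in>K. a = r \<otimes>\<^bsub>Q\<^esub> \<alpha> \<oplus>\<^bsub>Q\<^esub> s \<otimes>\<^bsub>Q\<^esub> \<beta>"
    using two_gen_pair[OF two] by metis
  have base: "local_two_gen Q K A MK \<alpha> \<beta>" by (rule is_local_two_gen[OF ab])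
  interpret B: local_two_gen Q K A MK \<alpha> \<beta> by (rule base)
  interpret A: cring "int_closure_ring R" by (rule A_cring)
  obtain t where t: "t \<in> M" "t \<in> nzd R" using regular by blast
  have tc: "\<iota> t \<in> carrier Q" and tu: "\<iota> t \<in> Units Q" and tM: "\<iota> t \<in> MK"
    using t M_carrier emb_unit by auto
  have sep: "x = \<zero>\<^bsub>Q\<^esub>" if x: "x \<in> K" "\<And>n::nat. \<exists>b\<in>K. x = \<iota> t [^]\<^bsub>Q\<^esub> n \<otimes>\<^bsub>Q\<^esub> b" for x
  proof -
    obtain y where y: "\<And>n::nat. y n \<in> K \<and> x = \<iota> t [^]\<^bsub>Q\<^esub> n \<otimes>\<^bsub>Q\<^esub> y n" using x(2) by metis
    have yA: "y n \<in> A" and yc: "y n \<in> carrier Q" for n using y[of n] K_sub_A B.A_closed by auto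
    have pu: "\<iota> t [^]\<^bsub>Q\<^esub> n \<in> Units Q" for n :: nat using tu by (induction n) auto
    have step: "y n = \<iota> t \<otimes>\<^bsub>Q\<^esub> y (Suc n)" for n
    proof -
      have "\<iota> t [^]\<^bsub>Q\<^esub> n \<otimes>\<^bsub>Q\<^esub> y n = \<iota> t [^]\<^bsub>Q\<^esub> Suc n \<otimes>\<^bsub>Q\<^esub> y (Suc n)" using y by metis
      also have "\<dots> = \<iota> t [^]\<^bsub>Q\<^esub> n \<otimes>\<^bsub>Q\<^esub> (\<iota> t \<otimes>\<^bsub>Q\<^esub> y (Suc n))" using tc yc by (simp add: Q.m_assoc)
      finally show ?thesis using Q.Units_l_cancel[OF pu[of n]] yc tc by simp
    qed
    let ?I = "\<lambda>n. PIdl\<^bsub>int_closure_ring R\<^esub> (y n)"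
    have id: "ideal (?I n) (int_closure_ring R)" for n by (rule A.cgenideal_ideal) (simp add: yA)
    have self: "y n \<in> ?I n" for n by (rule A.cgenideal_self) (simp add: yA)
    have "?I n \<subseteq> ?I (Suc n)" for n
    proof (rule A.cgenideal_minimal[OF id])
      have "\<iota> t \<in> A" using tM B.M_in_K B.K_in_A by blast
      then show "y n \<in> ?I (Suc n)" using idealE(4)[OF id self[of "Suc n"], of "\<iota> t"] step[of n] by simp
    qed
    then have mono: "m \<le> n \<Longrightarrow> ?I m \<subseteq> ?I n" for m n by (rule lift_Suc_mono_le)
    have "subset.chain {N. ideal N (int_closure_ring R)} (range ?I)"
      unfolding subset_chain_def
    proof (intro conjI ballI)
      show "range ?I \<subseteq> {N. ideal N (int_closure_ring R)}" using id by auto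
      fix X Y assume "X \<in> range ?I" "Y \<in> range ?I"
      then obtain m n where "X = ?I m" "Y = ?I n" by (elim rangeE)
      then show "X \<subseteq> Y \<or> Y \<subseteq> X" using mono[of m n] mono[of n m] nat_le_linear[of m n] by metis
    qed
    then have "\<Union>(range ?I) \<in> range ?I"
      using noetherian_ring.ideal_chain_is_trivial[OF noeth, of "range ?I"] by blast
    then obtain n where n: "\<Union>(range ?I) = ?I n" by blast
    have "y (Suc n) \<in> ?I n" unfolding n[symmetric] using self by blast
    then obtain a where a: "a \<in> A" "y (Suc n) = a \<otimes>\<^bsub>Q\<^esub> y n" unfolding cgenideal_def by auto
    define j where "j = \<iota> t \<otimes>\<^bsub>Q\<^esub> a"
    have jJ: "j \<in> B.J" unfolding j_def by (rule B.MA_in_J[OF tM a(1)])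
    have jc: "j \<in> carrier Q" using B.J_closed[OF jJ] .
    define z where "z = y (Suc n)"
    have zc: "z \<in> carrier Q" using yc by (simp add: z_def)
    have zj: "z = j \<otimes>\<^bsub>Q\<^esub> z"
    proof -
      have "z = a \<otimes>\<^bsub>Q\<^esub> (\<iota> t \<otimes>\<^bsub>Q\<^esub> z)" unfolding z_def using a(2) step[of n] by simp
      then show ?thesis unfolding j_def using tc zc B.A_closed[OF a(1)] by (simp add: Q.m_ac)
    qed
    text \<open>By Nakayama's lemma \<open>1 - j\<close> is a unit of \<open>A\<close>.\<close>
    let ?N = "{(\<one>\<^bsub>Q\<^esub> \<ominus>\<^bsub>Q\<^esub> j) \<otimes>\<^bsub>Q\<^esub> a | a. a \<in> A}"
    have oc: "\<one>\<^bsub>Q\<^esub> \<ominus>\<^bsub>Q\<^esub> j \<in> carrier Q" using jc by simp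
    have "A \<subseteq> ?N"
    proof (rule B.nakayama)
      show "?N \<subseteq> carrier Q" using oc B.A_closed by auto
      fix u assume "u \<in> ?N"
      then obtain a where a: "a \<in> A" "u = (\<one>\<^bsub>Q\<^esub> \<ominus>\<^bsub>Q\<^esub> j) \<otimes>\<^bsub>Q\<^esub> a" by blast
      { fix v assume "v \<in> ?N"
        then obtain b where b: "b \<in> A" "v = (\<one>\<^bsub>Q\<^esub> \<ominus>\<^bsub>Q\<^esub> j) \<otimes>\<^bsub>Q\<^esub> b" by blast
        have "u \<oplus>\<^bsub>Q\<^esub> v = (\<one>\<^bsub>Q\<^esub> \<ominus>\<^bsub>Q\<^esub> j) \<otimes>\<^bsub>Q\<^esub> (a \<oplus>\<^bsub>Q\<^esub> b)"
          unfolding a(2) b(2) using Q.r_distr[OF B.A_closed[OF a(1)] B.A_closed[OF b(1)] oc] by simp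
        then show "u \<oplus>\<^bsub>Q\<^esub> v \<in> ?N" using B.AE(7)[OF a(1) b(1)] by blast }
      { fix r assume r: "r \<in> K"
        have "r \<otimes>\<^bsub>Q\<^esub> u = (\<one>\<^bsub>Q\<^esub> \<ominus>\<^bsub>Q\<^esub> j) \<otimes>\<^bsub>Q\<^esub> (r \<otimes>\<^bsub>Q\<^esub> a)"
          unfolding a(2) using Q.m_lcomm[OF B.K_closed[OF r] oc B.A_closed[OF a(1)]] .
        then show "r \<otimes>\<^bsub>Q\<^esub> u \<in> ?N" using B.AE(6)[OF B.K_in_A[OF r] a(1)] by blast }
    next
      fix a assume a: "a \<in> A"
      have ac: "a \<in> carrier Q" using a by (rule B.A_closed)
      have "(\<one>\<^bsub>Q\<^esub> \<ominus>\<^bsub>Q\<^esub> j) \<otimes>\<^bsub>Q\<^esub> a \<oplus>\<^bsub>Q\<^esub> a \<otimes>\<^bsub>Q\<^esub> j = ((\<one>\<^bsub>Q\<^esub> \<ominus>\<^bsub>Q\<^esub> j) \<oplus>\<^bsub>Q\<^esub> j) \<otimes>\<^bsub>Q\<^esub> a"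
        using Q.l_distr[OF oc jc ac] Q.m_comm[OF ac jc] by simp
      also have "\<dots> = a" using Q.diff_add_cancel jc ac by simp
      finally have "a = (\<one>\<^bsub>Q\<^esub> \<ominus>\<^bsub>Q\<^esub> j) \<otimes>\<^bsub>Q\<^esub> a \<oplus>\<^bsub>Q\<^esub> a \<otimes>\<^bsub>Q\<^esub> j" by simp
      then show "\<exists>i\<in>?N. \<exists>j\<in>B.J. a = i \<oplus>\<^bsub>Q\<^esub> j" using B.J_mult[OF a jJ] a by blast
    qed
    then obtain c where c: "c \<in> A" "\<one>\<^bsub>Q\<^esub> = (\<one>\<^bsub>Q\<^esub> \<ominus>\<^bsub>Q\<^esub> j) \<otimes>\<^bsub>Q\<^esub> c" using B.AE(3) by blast
    have cc: "c \<in> carrier Q" using c(1) by (rule B.A_closed)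
    have "(\<one>\<^bsub>Q\<^esub> \<ominus>\<^bsub>Q\<^esub> j) \<otimes>\<^bsub>Q\<^esub> z = z \<ominus>\<^bsub>Q\<^esub> j \<otimes>\<^bsub>Q\<^esub> z"
      using jc zc by (simp add: Q.l_distr Q.minus_eq Q.l_minus)
    also have "\<dots> = \<zero>\<^bsub>Q\<^esub>" using zj zc by simp
    finally have "((\<one>\<^bsub>Q\<^esub> \<ominus>\<^bsub>Q\<^esub> j) \<otimes>\<^bsub>Q\<^esub> c) \<otimes>\<^bsub>Q\<^esub> z = \<zero>\<^bsub>Q\<^esub>"
      using oc cc zc by (simp add: Q.m_assoc Q.m_lcomm[of "\<one>\<^bsub>Q\<^esub> \<ominus>\<^bsub>Q\<^esub> j" c z])
    then have "z = \<zero>\<^bsub>Q\<^esub>" unfolding c(2)[symmetric] using zc by simp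
    then show ?thesis using y[of "Suc n"] tc unfolding z_def by simp
  qed
  have J_ideal: "ideal B.J (int_closure_ring R)"
    by (rule A.idealI_cring) (use B.J_in_A B.J_zero B.J_add B.J_mult in auto)
  obtain G where G: "G \<subseteq> A" "finite G" "B.J = Idl\<^bsub>int_closure_ring R\<^esub> G"
    using noetherian_ring.finetely_gen[OF noeth J_ideal] by auto
  define E where "E = (\<lambda>g. \<alpha> \<otimes>\<^bsub>Q\<^esub> g) ` G \<union> (\<lambda>g. \<beta> \<otimes>\<^bsub>Q\<^esub> g) ` G"
  have GJ: "G \<subseteq> B.J" using A.genideal_self[of G] G by simp
  have EJ: "E \<subseteq> B.J" unfolding E_def using GJ B.J_mult[OF ab(1)] B.J_mult[OF ab(2)] by blast
  have Ec: "E \<subseteq> carrier Q" using EJ B.J_closed by blast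
  let ?L = "lin_span Q K E"
  \<comment> \<open>\<open>?L\<close> is by construction only a \<open>K\<close>-module; asking for
    all multiples by elements of \<open>A\<close> yields an ideal of \<open>A\<close>, to which
    minimality of the ideal generated by \<open>G\<close> applies.\<close>
  let ?I = "{w \<in> A. \<forall>a\<in>A. a \<otimes>\<^bsub>Q\<^esub> w \<in> ?L}"
  have "ideal ?I (int_closure_ring R)"
  proof (rule A.idealI_cring)
    show "?I \<subseteq> carrier (int_closure_ring R)" by auto
    show "\<zero>\<^bsub>int_closure_ring R\<^esub> \<in> ?I" using B.AE(2) B.A_closed lin_span.zero[of Q K E] by simp
    fix u assume u: "u \<in> ?I"
    then have uc: "u \<in> A" "u \<in> carrier Q" using B.A_closed by auto
    { fix v assume v: "v \<in> ?I"
      then have vc: "v \<in> A" "v \<in> carrier Q" using B.A_closed by auto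
      have "a \<otimes>\<^bsub>Q\<^esub> (u \<oplus>\<^bsub>Q\<^esub> v) \<in> ?L" if a: "a \<in> A" for a
        using Q.lin_span_add[OF B.KE(1) Ec, of "a \<otimes>\<^bsub>Q\<^esub> u" "a \<otimes>\<^bsub>Q\<^esub> v"] u v a
          Q.r_distr[OF uc(2) vc(2) B.A_closed[OF a]] by simp
      then show "u \<oplus>\<^bsub>int_closure_ring R\<^esub> v \<in> ?I" using B.AE(7)[OF uc(1) vc(1)] by simp }
    { fix b assume "b \<in> carrier (int_closure_ring R)"
      then have b: "b \<in> A" by simp
      have "a \<otimes>\<^bsub>Q\<^esub> (b \<otimes>\<^bsub>Q\<^esub> u) \<in> ?L" if a: "a \<in> A" for a
        using u B.AE(6)[OF a b] Q.m_assoc[OF B.A_closed[OF a] B.A_closed[OF b] uc(2)] by auto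
      then show "b \<otimes>\<^bsub>int_closure_ring R\<^esub> u \<in> ?I" using B.AE(6)[OF b uc(1)] by simp }
  qed
  moreover have "G \<subseteq> ?I"
  proof
    fix g assume g: "g \<in> G"
    then have gc: "g \<in> A" "g \<in> carrier Q" using G(1) B.A_closed by auto
    have "a \<otimes>\<^bsub>Q\<^esub> g \<in> ?L" if a: "a \<in> A" for a
    proof -
      obtain r s where rs: "r \<in> K" "s \<in> K" "a = r \<otimes>\<^bsub>Q\<^esub> \<alpha> \<oplus>\<^bsub>Q\<^esub> s \<otimes>\<^bsub>Q\<^esub> \<beta>" using ab(3)[OF a] by blast
      have c: "r \<in> carrier Q" "s \<in> carrier Q" "\<alpha> \<in> carrier Q" "\<beta> \<in> carrier Q"
        using B.K_closed[OF rs(1)] B.K_closed[OF rs(2)] B.A_closed[OF ab(1)] B.A_closed[OF ab(2)] .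
      have "a \<otimes>\<^bsub>Q\<^esub> g = r \<otimes>\<^bsub>Q\<^esub> (\<alpha> \<otimes>\<^bsub>Q\<^esub> g) \<oplus>\<^bsub>Q\<^esub> s \<otimes>\<^bsub>Q\<^esub> (\<beta> \<otimes>\<^bsub>Q\<^esub> g)"
        unfolding rs(3) using c gc(2) by (simp add: Q.l_distr Q.m_assoc)
      moreover have "\<alpha> \<otimes>\<^bsub>Q\<^esub> g \<in> E" "\<beta> \<otimes>\<^bsub>Q\<^esub> g \<in> E" using g by (simp_all add: E_def)
      then have "r \<otimes>\<^bsub>Q\<^esub> (\<alpha> \<otimes>\<^bsub>Q\<^esub> g) \<in> ?L" "s \<otimes>\<^bsub>Q\<^esub> (\<beta> \<otimes>\<^bsub>Q\<^esub> g) \<in> ?L"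
        using Q.lin_span_term[OF B.KE(1) Ec] rs(1,2) by blast+
      ultimately show ?thesis using Q.lin_span_add[OF B.KE(1) Ec] by simp
    qed
    then show "g \<in> ?I" using gc(1) by blast
  qed
  ultimately have JI: "B.J \<subseteq> ?I" unfolding G(3) by (rule A.genideal_minimal)
  have JL: "B.J \<subseteq> ?L"
  proof
    fix j assume j: "j \<in> B.J"
    then have "\<one>\<^bsub>Q\<^esub> \<otimes>\<^bsub>Q\<^esub> j \<in> ?L" using JI B.AE(3) by blast
    then show "j \<in> ?L" using B.J_closed[OF j] by simp
  qed
  have "finite E" unfolding E_def using G(2) by simp
  from is_two_gen_extension[OF base t sep this EJ JL] t(1) show thesis using that by blast
qed

end

theorem theorem5p8:
  fixes R :: "('a, 'b) ring_scheme" and M :: "'a set"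
  assumes "local_ring R"
    and "krull_dim_one R"
    and "maximalideal M R"
    and "M \<inter> nzd R \<noteq> {}"
  shows "(bass_ring R \<longleftrightarrow> generalized_local_ring R \<and> int_closure_two_gen R) \<and>
         (generalized_local_ring R \<and> int_closure_two_gen R \<longleftrightarrow>
            noetherian_ring (int_closure_ring R) \<and> int_closure_two_gen R)"
proof -
  have "cring R" using assms(1) by (simp add: local_ring_def)
  then interpret dim_one_local R M
    using assms by (intro dim_one_local.intro dim_one_local_axioms.intro)
  \<comment> \<open>Given two generators of the closure, either finiteness condition yields the Bass
    property together with the generalized local property. Since a Bass ring in turn has a
    Noetherian closure with two generators, all equivalences follow.\<close>
  have ext: "bass_ring R \<and> generalized_local_ring R"
    if two: "int_closure_two_gen R"
      and "generalized_local_ring R \<or> noetherian_ring (int_closure_ring R)"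
    using that(2)
  proof
    assume "generalized_local_ring R"
    then show ?thesis
      by (rule extension_of_generalized_local[OF _ two]) (blast intro: bass_of_extension[OF two])
  next
    assume "noetherian_ring (int_closure_ring R)"
    then show ?thesis
      by (rule extension_of_noetherian[OF _ two]) (blast intro: bass_of_extension[OF two])
  qed
  show ?thesis using ext noetherian_two_gen_of_bass by blast
qed

end
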